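(* Let $(W,\mathcal G)$ be a logarithmic simple adapted co-rank one foliation on a smooth threefold over $\mathbb C$, let $D_{\mathrm{inv}}$ be the reduced invariant separatrix divisor, and set $\Sigma_{\tan}:=\operatorname{Sing}\mathcal G\cap|D_{\mathrm{inv}}|$. The reduced tangential arc pro-functor centred on $\Sigma_{\tan}$ is identified with the reduced arc functor of $D_{\mathrm{inv}}$ along $\Sigma_{\tan}$: $$J_\infty^{\tan}(W,\mathcal G;\Sigma_{\tan})_{\mathrm{red}}=J_\infty(D_{\mathrm{inv}};\Sigma_{\tan})_{\mathrm{red}}.$$ Consequently, every irreducible tangential cylinder has a unique generic branch (i.e. a unique irreducible component of $D_{\mathrm{inv}}$ containing its generic arc) unless its generic arc lies in a conductor stratum (an intersection of two distinct components of $D_{\mathrm{inv}}$).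
   Context: A co-rank one foliation on a smooth threefold is locally given by an integrable 1-form $\omega$, unique up to a unit. $(W,\mathcal G)$ is logarithmic simple adapted if every point $p$ of the tangential locus under consideration has a logarithmic simple adapted chart: formal coordinates $x_1,x_2,x_3$ at $p$ such that $D_{\mathrm{inv}}=\{x_1\cdots x_r=0\}$, $1\le r\le3$, is a reduced invariant normal crossing divisor and $$\omega=u\,x_1\cdots x_r\Bigl(\sum_{i=1}^r\lambda_i\frac{dx_i}{x_i}+\sum_{j=r+1}^3h_j(x)\,dx_j\Bigr)$$ is a local generator, with $u$ a unit, $\lambda_i\ne0$ and $\sum a_i\lambda_i\ne0$ for every non-zero $(a_1,\dots,a_r)\in\mathbb Z_{\ge0}^r$. For a closed $Z\subset D_{\mathrm{inv}}$: $J_\infty(D_{\mathrm{inv}};Z)_{\mathrm{red}}$ consists of arcs $\gamma$ on $D_{\mathrm{inv}}$ with $\gamma(0)\in Z$, and $J_\infty^{\tan}(W,\mathcal G;Z)_{\mathrm{red}}=\{\gamma\in J_\infty(W)_{\mathrm{red}}:\gamma(0)\in Z,\ \gamma^*\omega=0\}$. These are reduced arc functors, compared on $K[[t]]$-points for all field extensions $K/\mathbb C$; nothing is asserted about finite-level or non-reduced jet schemes. A tangential cylinder here is a closed cylinder in the reduced tangential arc functor centred on $\Sigma_{\tan}$. *)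

theory Defs
  imports
    "HOL-Analysis.Abstract_Topology"
    "HOL-Library.FuncSet"
    "HOL-Library.Extended_Nat"
    "HOL-Library.Poly_Mapping"
    "HOL-Computational_Algebra.Formal_Power_Series"
begin

unbundle fps_syntax

section \<open>Subalgebras of a field and their ideals\<close>

text \<open>
  Varieties are treated in the language of Chevalley schemes: an integral separated scheme of
  finite type over the complex numbers is the set of its local rings inside its function field
  (EGA I, 8.3 and 8.5).  The function field is a type \<open>'f\<close> of class \<^class>\<open>field\<close> with structure
  map \<open>\<iota>\<close>; rings of functions are subsets of \<open>'f\<close>.  Non-closed points are included.
\<close>

definition alg_hom_on ::
  "'a::comm_ring_1 set \<Rightarrow> (complex \<Rightarrow> 'a) \<Rightarrow> (complex \<Rightarrow> 'b::comm_ring_1) \<Rightarrow> ('a \<Rightarrow> 'b) \<Rightarrow> bool" where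
  "alg_hom_on A \<iota> \<iota>' f \<longleftrightarrow>
     (\<forall>a\<in>A. \<forall>b\<in>A. f (a + b) = f a + f b \<and> f (a * b) = f a * f b) \<and> (\<forall>c. f (\<iota> c) = \<iota>' c)"

definition field_extension :: "(complex \<Rightarrow> 'k::field) \<Rightarrow> bool" where
  "field_extension \<kappa> \<longleftrightarrow> \<kappa> 1 = 1 \<and> (\<forall>x y. \<kappa> (x + y) = \<kappa> x + \<kappa> y \<and> \<kappa> (x * y) = \<kappa> x * \<kappa> y)"

definition subalgebra :: "(complex \<Rightarrow> 'f::field) \<Rightarrow> 'f set \<Rightarrow> bool" where
  "subalgebra \<iota> A \<longleftrightarrow> range \<iota> \<subseteq> A \<and> (\<forall>a\<in>A. \<forall>b\<in>A. a + b \<in> A \<and> a * b \<in> A)"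

definition subalgebra_gen :: "(complex \<Rightarrow> 'f::field) \<Rightarrow> 'f set \<Rightarrow> 'f set" where
  "subalgebra_gen \<iota> S = \<Inter>{A. subalgebra \<iota> A \<and> S \<subseteq> A}"

definition is_ideal :: "'a::comm_ring_1 set \<Rightarrow> 'a set \<Rightarrow> bool" where
  "is_ideal A I \<longleftrightarrow> I \<subseteq> A \<and> 0 \<in> I \<and> (\<forall>x\<in>I. \<forall>y\<in>I. x + y \<in> I) \<and> (\<forall>a\<in>A. \<forall>x\<in>I. a * x \<in> I)"

definition is_prime_ideal :: "'a::comm_ring_1 set \<Rightarrow> 'a set \<Rightarrow> bool" where
  "is_prime_ideal A P \<longleftrightarrow> is_ideal A P \<and> 1 \<notin> P \<and> (\<forall>a\<in>A. \<forall>b\<in>A. a * b \<in> P \<longrightarrow> a \<in> P \<or> b \<in> P)"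

definition ideal_gen :: "'a::comm_ring_1 set \<Rightarrow> 'a set \<Rightarrow> 'a set" where
  "ideal_gen A S = \<Inter>{I. is_ideal A I \<and> S \<subseteq> I}"

definition ideal_pow :: "'a::comm_ring_1 set \<Rightarrow> 'a set \<Rightarrow> nat \<Rightarrow> 'a set" where
  "ideal_pow A I n = ideal_gen A {prod_list xs |xs. length xs = n \<and> set xs \<subseteq> I}"

definition nonunits :: "'f::field set \<Rightarrow> 'f set" where
  "nonunits p = {a \<in> p. a = 0 \<or> inverse a \<notin> p}"

definition local_subring :: "(complex \<Rightarrow> 'f::field) \<Rightarrow> 'f set \<Rightarrow> bool" where
  "local_subring \<iota> p \<longleftrightarrow> subalgebra \<iota> p \<and> is_ideal p (nonunits p)"

definition dominates :: "'f::field set \<Rightarrow> 'f set \<Rightarrow> bool" where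
  "dominates q p \<longleftrightarrow> p \<subseteq> q \<and> nonunits p \<subseteq> nonunits q"

section \<open>Varieties and smooth threefolds\<close>

definition localization :: "'f::field set \<Rightarrow> 'f set \<Rightarrow> 'f set" where
  "localization A P = {a / b |a b. a \<in> A \<and> b \<in> A - P}"

definition spec_points :: "'f::field set \<Rightarrow> 'f set set" where
  "spec_points A = {localization A P |P. is_prime_ideal A P}"

definition affine_model :: "(complex \<Rightarrow> 'f::field) \<Rightarrow> 'f set \<Rightarrow> bool" where
  "affine_model \<iota> A \<longleftrightarrow>
     (\<exists>S. finite S \<and> A = subalgebra_gen \<iota> S) \<and> (\<forall>x. \<exists>a\<in>A. \<exists>b\<in>A. b \<noteq> 0 \<and> x = a / b)"

text \<open>The last condition (two local rings dominated by a common local ring coincide) is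
  separatedness.\<close>

definition variety :: "(complex \<Rightarrow> 'f::field) \<Rightarrow> 'f set set \<Rightarrow> bool" where
  "variety \<iota> W \<longleftrightarrow> field_extension \<iota> \<and>
     (\<exists>\<A>. finite \<A> \<and> (\<forall>A\<in>\<A>. affine_model \<iota> A) \<and> W = (\<Union>A\<in>\<A>. spec_points A)) \<and>
     (\<forall>p\<in>W. \<forall>q\<in>W. \<forall>L. local_subring \<iota> L \<and> dominates L p \<and> dominates L q \<longrightarrow> p = q)"

definition affine_open :: "(complex \<Rightarrow> 'f::field) \<Rightarrow> 'f set set \<Rightarrow> 'f set \<Rightarrow> bool" where
  "affine_open \<iota> W A \<longleftrightarrow> affine_model \<iota> A \<and> spec_points A \<subseteq> W"

definition zariski :: "(complex \<Rightarrow> 'f::field) \<Rightarrow> 'f set set \<Rightarrow> 'f set topology" where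
  "zariski \<iota> W = topology_generated_by {spec_points A |A. affine_open \<iota> W A}"

text \<open>Generization of points is inclusion of local rings, so ascending chains of local rings
  starting at \<open>p\<close> are descending chains of primes of the local ring \<open>p\<close>.\<close>

definition generization_chain :: "'f set set \<Rightarrow> 'f set \<Rightarrow> nat \<Rightarrow> bool" where
  "generization_chain W p n \<longleftrightarrow>
     (\<exists>c. c 0 = p \<and> (\<forall>i\<le>n. c i \<in> W) \<and> (\<forall>i<n. c i \<subset> c (Suc i)))"

definition has_local_dim :: "'f set set \<Rightarrow> 'f set \<Rightarrow> nat \<Rightarrow> bool" where
  "has_local_dim W p n \<longleftrightarrow> generization_chain W p n \<and> \<not> generization_chain W p (Suc n)"

definition regular_point :: "'f::field set set \<Rightarrow> 'f set \<Rightarrow> bool" where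
  "regular_point W p \<longleftrightarrow>
     (\<exists>n S. has_local_dim W p n \<and> finite S \<and> card S = n \<and> S \<subseteq> p \<and> nonunits p = ideal_gen p S)"

definition smooth_threefold :: "(complex \<Rightarrow> 'f::field) \<Rightarrow> 'f set set \<Rightarrow> bool" where
  "smooth_threefold \<iota> W \<longleftrightarrow> variety \<iota> W \<and> (\<forall>p\<in>W. regular_point W p) \<and>
     (\<exists>p\<in>W. generization_chain W p 3) \<and> (\<forall>p\<in>W. \<not> generization_chain W p 4)"

section \<open>Closed subsets, components, divisors\<close>

definition irreducible_in :: "'a topology \<Rightarrow> 'a set \<Rightarrow> bool" where
  "irreducible_in X S \<longleftrightarrow> S \<noteq> {} \<and> S \<subseteq> topspace X \<and>
     (\<forall>C1 C2. closedin X C1 \<and> closedin X C2 \<and> S \<subseteq> C1 \<union> C2 \<longrightarrow> S \<subseteq> C1 \<or> S \<subseteq> C2)"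

definition irreducible_components :: "'a topology \<Rightarrow> 'a set \<Rightarrow> 'a set set" where
  "irreducible_components X D = {E. E \<subseteq> D \<and> irreducible_in X E \<and>
     (\<forall>E'. E' \<subseteq> D \<and> irreducible_in X E' \<and> E \<subseteq> E' \<longrightarrow> E' = E)}"

text \<open>Stalk at \<open>p\<close> of the radical ideal sheaf of a closed set \<open>Z\<close>, i.e. of \<open>Z\<close> with its reduced
  structure; it is the unit ideal when \<open>p\<close> is not in \<open>Z\<close>.\<close>

definition stalk_ideal :: "'f::field set set \<Rightarrow> 'f set \<Rightarrow> 'f set" where
  "stalk_ideal Z p = {a \<in> p. \<forall>q\<in>Z. p \<subseteq> q \<longrightarrow> a \<in> nonunits q}"

text \<open>A reduced (effective) divisor is encoded by its support.\<close>

definition reduced_divisor :: "(complex \<Rightarrow> 'f::field) \<Rightarrow> 'f set set \<Rightarrow> 'f set set \<Rightarrow> bool" where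
  "reduced_divisor \<iota> W D \<longleftrightarrow> closedin (zariski \<iota> W) D \<and>
     (\<forall>E\<in>irreducible_components (zariski \<iota> W) D.
        \<exists>\<eta>\<in>W. E = zariski \<iota> W closure_of {\<eta>} \<and> has_local_dim W \<eta> 1)"

section \<open>Differential forms\<close>

text \<open>
  A finitely supported map \<open>w\<close> stands for the formal sum of the \<open>a\<^sub>b db\<close> with
  \<open>a\<^sub>b = lookup w b\<close>.  The module of Kaehler differentials of a subalgebra \<open>A\<close> is
  \<open>kahler_forms A\<close> modulo \<open>kahler_relations \<iota> A\<close>; we work with representatives.
\<close>

type_synonym 'f form = "'f \<Rightarrow>\<^sub>0 'f"

definition form_smult :: "'f::field \<Rightarrow> 'f form \<Rightarrow> 'f form" where
  "form_smult c w = Poly_Mapping.map ((*) c) w"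

definition kahler_forms :: "'f::field set \<Rightarrow> 'f form set" where
  "kahler_forms A = {w. \<forall>b\<in>Poly_Mapping.keys w. b \<in> A \<and> Poly_Mapping.lookup w b \<in> A}"

inductive_set kahler_relations :: "(complex \<Rightarrow> 'f::field) \<Rightarrow> 'f set \<Rightarrow> 'f form set"
  for \<iota> :: "complex \<Rightarrow> 'f" and A :: "'f set" where
  d_add: "a \<in> A \<Longrightarrow> b \<in> A \<Longrightarrow>
    Poly_Mapping.single (a + b) 1 - Poly_Mapping.single a 1 - Poly_Mapping.single b 1
      \<in> kahler_relations \<iota> A"
| d_mult: "a \<in> A \<Longrightarrow> b \<in> A \<Longrightarrow>
    Poly_Mapping.single (a * b) 1 - Poly_Mapping.single b a - Poly_Mapping.single a b
      \<in> kahler_relations \<iota> A"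
| d_const: "Poly_Mapping.single (\<iota> c) 1 \<in> kahler_relations \<iota> A"
| add: "v \<in> kahler_relations \<iota> A \<Longrightarrow> w \<in> kahler_relations \<iota> A \<Longrightarrow> v + w \<in> kahler_relations \<iota> A"
| smult: "a \<in> A \<Longrightarrow> w \<in> kahler_relations \<iota> A \<Longrightarrow> form_smult a w \<in> kahler_relations \<iota> A"

definition form_eq :: "(complex \<Rightarrow> 'f::field) \<Rightarrow> 'f set \<Rightarrow> 'f form \<Rightarrow> 'f form \<Rightarrow> bool" where
  "form_eq \<iota> A v w \<longleftrightarrow> v - w \<in> kahler_relations \<iota> A"

definition derivations :: "(complex \<Rightarrow> 'f::field) \<Rightarrow> ('f \<Rightarrow> 'f) set" where
  "derivations \<iota> = {\<delta>. (\<forall>a b. \<delta> (a + b) = \<delta> a + \<delta> b \<and> \<delta> (a * b) = a * \<delta> b + b * \<delta> a) \<and>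
     (\<forall>c. \<delta> (\<iota> c) = 0)}"

definition contract :: "'f::field form \<Rightarrow> ('f \<Rightarrow> 'f) \<Rightarrow> 'f" where
  "contract w \<delta> = (\<Sum>b\<in>Poly_Mapping.keys w. Poly_Mapping.lookup w b * \<delta> b)"

text \<open>Value of \<open>dw\<close>, the sum of the \<open>da\<^sub>b \<and> db\<close>, on two derivations.\<close>

definition ext_deriv :: "'f::field form \<Rightarrow> ('f \<Rightarrow> 'f) \<Rightarrow> ('f \<Rightarrow> 'f) \<Rightarrow> 'f" where
  "ext_deriv w \<delta> \<epsilon> = (\<Sum>b\<in>Poly_Mapping.keys w.
     \<delta> (Poly_Mapping.lookup w b) * \<epsilon> b - \<epsilon> (Poly_Mapping.lookup w b) * \<delta> b)"

text \<open>On a smooth variety the sheaves of differential forms are locally free, hence embed into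
  the alternating forms on the derivations of the function field.  Thus \<open>w \<noteq> 0\<close> and
  \<open>w \<and> dw = 0\<close> may be tested on these.\<close>

definition nonzero_form :: "(complex \<Rightarrow> 'f::field) \<Rightarrow> 'f form \<Rightarrow> bool" where
  "nonzero_form \<iota> w \<longleftrightarrow> (\<exists>\<delta>\<in>derivations \<iota>. contract w \<delta> \<noteq> 0)"

definition integrable_form :: "(complex \<Rightarrow> 'f::field) \<Rightarrow> 'f form \<Rightarrow> bool" where
  "integrable_form \<iota> w \<longleftrightarrow> (\<forall>\<delta>1\<in>derivations \<iota>. \<forall>\<delta>2\<in>derivations \<iota>. \<forall>\<delta>3\<in>derivations \<iota>.
     contract w \<delta>1 * ext_deriv w \<delta>2 \<delta>3 + contract w \<delta>2 * ext_deriv w \<delta>3 \<delta>1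
       + contract w \<delta>3 * ext_deriv w \<delta>1 \<delta>2 = 0)"

section \<open>Co-rank one foliations\<close>

text \<open>A foliation is given by pairs \<open>(A, w)\<close> of an affine open set and a generator on it, which
  agree up to a unit in each common stalk.\<close>

type_synonym 'f foliation_data = "('f set \<times> 'f form) set"

definition foliation ::
  "(complex \<Rightarrow> 'f::field) \<Rightarrow> 'f set set \<Rightarrow> 'f foliation_data \<Rightarrow> bool" where
  "foliation \<iota> W G \<longleftrightarrow>
     (\<forall>(A, w)\<in>G. affine_open \<iota> W A \<and> w \<in> kahler_forms A \<and> nonzero_form \<iota> w \<and> integrable_form \<iota> w) \<and>
     W = (\<Union>(A, w)\<in>G. spec_points A) \<and>
     (\<forall>(A, w)\<in>G. \<forall>(B, v)\<in>G. \<forall>p\<in>spec_points A \<inter> spec_points B.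
        \<exists>u\<in>p - nonunits p. form_eq \<iota> p w (form_smult u v))"

definition local_generators :: "'f::field foliation_data \<Rightarrow> 'f set \<Rightarrow> 'f form set" where
  "local_generators G p = {w. \<exists>A. (A, w) \<in> G \<and> p \<in> spec_points A}"

text \<open>The zero locus of the generators: \<open>w\<close> lies in the maximal ideal times the stalk of the
  differentials.\<close>

definition foliation_sing ::
  "(complex \<Rightarrow> 'f::field) \<Rightarrow> 'f set set \<Rightarrow> 'f foliation_data \<Rightarrow> 'f set set" where
  "foliation_sing \<iota> W G = {p \<in> W. \<exists>w\<in>local_generators G p. \<exists>v\<in>kahler_forms p.
     (\<forall>b\<in>Poly_Mapping.keys v. Poly_Mapping.lookup v b \<in> nonunits p) \<and> form_eq \<iota> p w v}"

text \<open>Invariance of \<open>D\<close>: \<open>w \<and> df\<close> is divisible by the ideal of \<open>D\<close> for each \<open>f\<close> in this ideal,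
  tested on local vector fields.\<close>

definition invariant_divisor ::
  "(complex \<Rightarrow> 'f::field) \<Rightarrow> 'f set set \<Rightarrow> 'f foliation_data \<Rightarrow> 'f set set \<Rightarrow> bool" where
  "invariant_divisor \<iota> W G D \<longleftrightarrow> reduced_divisor \<iota> W D \<and>
     (\<forall>p\<in>W. \<forall>w\<in>local_generators G p. \<forall>f\<in>stalk_ideal D p.
        \<forall>\<delta>\<in>derivations \<iota>. \<forall>\<epsilon>\<in>derivations \<iota>. \<delta> ` p \<subseteq> p \<and> \<epsilon> ` p \<subseteq> p \<longrightarrow>
          contract w \<delta> * \<epsilon> f - contract w \<epsilon> * \<delta> f \<in> stalk_ideal D p)"

section \<open>Logarithmic simple adapted charts\<close>

text \<open>Power series in three variables as iterated power series, \<open>x\<^sub>1\<close> being the outermost variable;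
  variables are numbered 1, 2, 3.\<close>

type_synonym fps3 = "complex fps fps fps"

definition const3 :: "complex \<Rightarrow> fps3" where
  "const3 c = fps_const (fps_const (fps_const c))"

definition coord3 :: "nat \<Rightarrow> fps3" where
  "coord3 k = (if k = 1 then fps_X else if k = 2 then fps_const fps_X
     else fps_const (fps_const fps_X))"

definition partial3 :: "nat \<Rightarrow> fps3 \<Rightarrow> fps3" where
  "partial3 k h = (if k = 1 then fps_deriv h
     else if k = 2 then Abs_fps (\<lambda>i. fps_deriv (h $ i))
     else Abs_fps (\<lambda>i. Abs_fps (\<lambda>j. fps_deriv (h $ i $ j))))"

definition max_ideal_pow3 :: "nat \<Rightarrow> fps3 set" where
  "max_ideal_pow3 n = {h. \<forall>i j k. i + j + k < n \<longrightarrow> h $ i $ j $ k = 0}"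

text \<open>\<open>f\<close> induces isomorphisms modulo all powers of the maximal ideals, i.e. it identifies the
  completion of the local ring \<open>p\<close> with the power series ring.\<close>

definition formal_coordinates :: "(complex \<Rightarrow> 'f::field) \<Rightarrow> 'f set \<Rightarrow> ('f \<Rightarrow> fps3) \<Rightarrow> bool" where
  "formal_coordinates \<iota> p f \<longleftrightarrow> alg_hom_on p \<iota> const3 f \<and>
     (\<forall>n. (\<forall>a\<in>p. f a \<in> max_ideal_pow3 n \<longleftrightarrow> a \<in> ideal_pow p (nonunits p) n) \<and>
          (\<forall>h. \<exists>a\<in>p. h - f a \<in> max_ideal_pow3 n))"

text \<open>Coefficient of \<open>dx\<^sub>k\<close> in the image of \<open>w\<close> in the completed module of differentials.\<close>

definition formal_coeff :: "('f::field \<Rightarrow> fps3) \<Rightarrow> 'f form \<Rightarrow> nat \<Rightarrow> fps3" where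
  "formal_coeff f w k = (\<Sum>b\<in>Poly_Mapping.keys w. f (Poly_Mapping.lookup w b) * partial3 k (f b))"

text \<open>The last clause is the logarithmic normal form with the poles cleared, compared
  coefficientwise.\<close>

definition log_simple_adapted_chart ::
  "(complex \<Rightarrow> 'f::field) \<Rightarrow> 'f foliation_data \<Rightarrow> 'f set set \<Rightarrow> 'f set \<Rightarrow> ('f \<Rightarrow> fps3) \<Rightarrow> bool" where
  "log_simple_adapted_chart \<iota> G D p f \<longleftrightarrow> formal_coordinates \<iota> p f \<and>
     (\<exists>r\<in>{1..3}. \<exists>(lam :: nat \<Rightarrow> complex) (u :: fps3) (h :: nat \<Rightarrow> fps3).
        \<exists>w\<in>local_generators G p.
        ideal_gen UNIV (f ` stalk_ideal D p) = ideal_gen UNIV {\<Prod>i\<in>{1..r}. coord3 i} \<and>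
        u dvd 1 \<and>
        (\<forall>i\<in>{1..r}. lam i \<noteq> 0) \<and>
        (\<forall>a :: nat \<Rightarrow> nat. (\<exists>i\<in>{1..r}. a i \<noteq> 0) \<longrightarrow> (\<Sum>i\<in>{1..r}. of_nat (a i) * lam i) \<noteq> 0) \<and>
        (\<forall>k\<in>{1..3}. formal_coeff f w k =
           u * (if k \<le> r then const3 (lam k) * (\<Prod>i\<in>{1..r} - {k}. coord3 i)
                else (\<Prod>i\<in>{1..r}. coord3 i) * h k)))"

text \<open>Formal coordinates only exist at closed points.\<close>

definition log_simple_adapted ::
  "(complex \<Rightarrow> 'f::field) \<Rightarrow> 'f set set \<Rightarrow> 'f foliation_data \<Rightarrow> 'f set set \<Rightarrow> 'f set set \<Rightarrow> bool" where
  "log_simple_adapted \<iota> W G D \<Sigma> \<longleftrightarrow>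
     (\<forall>p\<in>\<Sigma>. closedin (zariski \<iota> W) {p} \<longrightarrow> (\<exists>f. log_simple_adapted_chart \<iota> G D p f))"

section \<open>Arcs\<close>

text \<open>An arc over \<open>K\<close> is a morphism from the spectrum of \<open>K[[t]]\<close> to \<open>W\<close> over the complex
  numbers; as \<open>K[[t]]\<close> is local, this is a point \<open>p = \<gamma>(0)\<close> of \<open>W\<close> and a local homomorphism from
  the local ring \<open>p\<close> to \<open>K[[t]]\<close>.\<close>

type_synonym ('f, 'k) arc = "'f set \<times> ('f \<Rightarrow> 'k fps)"

definition arcs ::
  "(complex \<Rightarrow> 'f::field) \<Rightarrow> (complex \<Rightarrow> 'k::field) \<Rightarrow> 'f set set \<Rightarrow> ('f, 'k) arc set" where
  "arcs \<iota> \<kappa> W = {(p, \<phi>). p \<in> W \<and> \<phi> \<in> extensional p \<and> alg_hom_on p \<iota> (\<lambda>c. fps_const (\<kappa> c)) \<phi> \<and>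
     (\<forall>a\<in>nonunits p. \<phi> a $ 0 = 0)}"

text \<open>The arcs on the reduced closed subscheme \<open>Y\<close> with centre in \<open>Z\<close>.\<close>

definition arcs_on ::
  "(complex \<Rightarrow> 'f::field) \<Rightarrow> (complex \<Rightarrow> 'k::field) \<Rightarrow> 'f set set \<Rightarrow> 'f set set \<Rightarrow> 'f set set \<Rightarrow>
    ('f, 'k) arc set" where
  "arcs_on \<iota> \<kappa> W Y Z = {(p, \<phi>)\<in>arcs \<iota> \<kappa> W. p \<in> Z \<and> (\<forall>a\<in>stalk_ideal Y p. \<phi> a = 0)}"

definition form_pullback :: "('f::field \<Rightarrow> 'r::comm_ring_1 fps) \<Rightarrow> 'f form \<Rightarrow> 'r fps" where
  "form_pullback \<phi> w = (\<Sum>b\<in>Poly_Mapping.keys w. \<phi> (Poly_Mapping.lookup w b) * fps_deriv (\<phi> b))"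

definition tangential_arcs ::
  "(complex \<Rightarrow> 'f::field) \<Rightarrow> (complex \<Rightarrow> 'k::field) \<Rightarrow> 'f set set \<Rightarrow> 'f foliation_data \<Rightarrow> 'f set set \<Rightarrow>
    ('f, 'k) arc set" where
  "tangential_arcs \<iota> \<kappa> W G Z =
     {(p, \<phi>)\<in>arcs \<iota> \<kappa> W. p \<in> Z \<and> (\<forall>w\<in>local_generators G p. form_pullback \<phi> w = 0)}"

section \<open>The arc space as a topological space and its cylinders\<close>

text \<open>
  The polynomial variable \<open>(a, i)\<close> is the function sending an arc to the \<open>i\<close>-th coefficient of
  the pullback of \<open>a\<close>.  A point over \<open>p\<close> of the space of \<open>N\<close>-jets (of arcs for \<open>N = \<infinity>\<close>) is a prime
  ideal of the Hasse-Schmidt algebra of \<open>p\<close> whose trace on \<open>p\<close> is the maximal ideal,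
  given by its preimage \<open>P\<close> in the polynomial ring.
\<close>

type_synonym 'f jet_poly = "('f \<times> nat \<Rightarrow>\<^sub>0 nat) \<Rightarrow>\<^sub>0 complex"
type_synonym 'f jet_point = "'f set \<times> 'f jet_poly set"

definition jet_var :: "'f \<Rightarrow> nat \<Rightarrow> 'f jet_poly" where
  "jet_var a i = Poly_Mapping.single (Poly_Mapping.single (a, i) 1) 1"

definition jet_polys :: "enat \<Rightarrow> 'f set \<Rightarrow> 'f jet_poly set" where
  "jet_polys N A = {g. \<forall>m\<in>Poly_Mapping.keys g. \<forall>(a, i)\<in>Poly_Mapping.keys m. a \<in> A \<and> enat i \<le> N}"

definition jet_prime ::
  "(complex \<Rightarrow> 'f::field) \<Rightarrow> enat \<Rightarrow> 'f set \<Rightarrow> 'f jet_poly set \<Rightarrow> bool" where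
  "jet_prime \<iota> N p P \<longleftrightarrow> is_prime_ideal (jet_polys N p) P \<and>
     (\<forall>a\<in>p. \<forall>b\<in>p. \<forall>i. enat i \<le> N \<longrightarrow>
        jet_var (a + b) i - jet_var a i - jet_var b i \<in> P \<and>
        jet_var (a * b) i - (\<Sum>j\<le>i. jet_var a j * jet_var b (i - j)) \<in> P) \<and>
     (\<forall>c i. enat i \<le> N \<longrightarrow>
        jet_var (\<iota> c) i - (if i = 0 then Poly_Mapping.single 0 c else 0) \<in> P) \<and>
     (\<forall>a\<in>p. jet_var a 0 \<in> P \<longleftrightarrow> a \<in> nonunits p)"

definition jet_points ::
  "(complex \<Rightarrow> 'f::field) \<Rightarrow> enat \<Rightarrow> 'f set set \<Rightarrow> 'f jet_point set" where
  "jet_points \<iota> N W = {(p, P). p \<in> W \<and> jet_prime \<iota> N p P}"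

definition jet_topology ::
  "(complex \<Rightarrow> 'f::field) \<Rightarrow> enat \<Rightarrow> 'f set set \<Rightarrow> 'f jet_point topology" where
  "jet_topology \<iota> N W = topology_generated_by
     {{(p, P)\<in>jet_points \<iota> N W. p \<in> spec_points A \<and> g \<notin> P} |A g.
        affine_open \<iota> W A \<and> g \<in> jet_polys N A}"

definition truncation :: "nat \<Rightarrow> 'f jet_point \<Rightarrow> 'f jet_point" where
  "truncation n \<xi> = (fst \<xi>, snd \<xi> \<inter> jet_polys (enat n) (fst \<xi>))"

definition constructible :: "'a topology \<Rightarrow> 'a set \<Rightarrow> bool" where
  "constructible X S \<longleftrightarrow> (\<exists>\<F>. finite \<F> \<and> (\<forall>(U, C)\<in>\<F>. openin X U \<and> closedin X C) \<and>
     S = (\<Union>(U, C)\<in>\<F>. U \<inter> C))"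

definition universal_arc :: "'f \<Rightarrow> 'f jet_poly fps" where
  "universal_arc a = Abs_fps (jet_var a)"

definition tangential_points ::
  "(complex \<Rightarrow> 'f::field) \<Rightarrow> 'f set set \<Rightarrow> 'f foliation_data \<Rightarrow> 'f set set \<Rightarrow> 'f jet_point set" where
  "tangential_points \<iota> W G Z = {(p, P)\<in>jet_points \<iota> \<infinity> W. p \<in> Z \<and>
     (\<forall>w\<in>local_generators G p. \<forall>n. form_pullback universal_arc w $ n \<in> P)}"

definition tangential_topology ::
  "(complex \<Rightarrow> 'f::field) \<Rightarrow> 'f set set \<Rightarrow> 'f foliation_data \<Rightarrow> 'f set set \<Rightarrow> 'f jet_point topology" where
  "tangential_topology \<iota> W G Z = subtopology (jet_topology \<iota> \<infinity> W) (tangential_points \<iota> W G Z)"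

definition tangential_cylinder ::
  "(complex \<Rightarrow> 'f::field) \<Rightarrow> 'f set set \<Rightarrow> 'f foliation_data \<Rightarrow> 'f set set \<Rightarrow> 'f jet_point set \<Rightarrow> bool" where
  "tangential_cylinder \<iota> W G Z C \<longleftrightarrow> closedin (tangential_topology \<iota> W G Z) C \<and>
     (\<exists>n S. constructible (jet_topology \<iota> (enat n) W) S \<and>
        C = {\<xi>\<in>tangential_points \<iota> W G Z. truncation n \<xi> \<in> S})"

definition jet_eval ::
  "(complex \<Rightarrow> 'k::field) \<Rightarrow> ('f \<Rightarrow> 'k fps) \<Rightarrow> 'f jet_poly \<Rightarrow> 'k" where
  "jet_eval \<kappa> \<phi> g = (\<Sum>m\<in>Poly_Mapping.keys g. \<kappa> (Poly_Mapping.lookup g m) *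
     (\<Prod>(a, i)\<in>Poly_Mapping.keys m. (\<phi> a $ i) ^ Poly_Mapping.lookup m (a, i)))"

text \<open>The image point of an arc in the arc space.\<close>

definition arc_point ::
  "(complex \<Rightarrow> 'k::field) \<Rightarrow> ('f, 'k) arc \<Rightarrow> 'f jet_point" where
  "arc_point \<kappa> \<gamma> = (fst \<gamma>, {g \<in> jet_polys \<infinity> (fst \<gamma>). jet_eval \<kappa> (snd \<gamma>) g = 0})"

text \<open>An arc over some \<open>K\<close> whose image is a generic point of \<open>C\<close>, i.e. the arc over the residue
  field of the generic point, up to extension of this field.\<close>

definition generic_arc ::
  "(complex \<Rightarrow> 'f::field) \<Rightarrow> (complex \<Rightarrow> 'k::field) \<Rightarrow> 'f set set \<Rightarrow> 'f foliation_data \<Rightarrow> 'f set set \<Rightarrow>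
    'f jet_point set \<Rightarrow> ('f, 'k) arc \<Rightarrow> bool" where
  "generic_arc \<iota> \<kappa> W G Z C \<gamma> \<longleftrightarrow> \<gamma> \<in> arcs \<iota> \<kappa> W \<and> arc_point \<kappa> \<gamma> \<in> C \<and>
     tangential_topology \<iota> W G Z closure_of {arc_point \<kappa> \<gamma>} = C"

definition conductor_strata ::
  "(complex \<Rightarrow> 'f::field) \<Rightarrow> 'f set set \<Rightarrow> 'f set set \<Rightarrow> 'f set set set" where
  "conductor_strata \<iota> W D = {E \<inter> E' |E E'. E \<in> irreducible_components (zariski \<iota> W) D \<and>
     E' \<in> irreducible_components (zariski \<iota> W) D \<and> E \<noteq> E'}"

end

theory Submission
  imports
    Defs
    "HOL-Analysis.Continuum_Not_Denumerable"
    "HOL-Computational_Algebra.Fundamental_Theorem_Algebra"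
begin

text \<open>
  At a closed point of \<open>\<Sigma>\<close> a complex arc extends to the formal chart, with components \<open>x\<^sub>i(t)\<close>.  If
  no \<open>x\<^sub>i(t)\<close> with \<open>i \<le> r\<close> vanishes, the pullback of \<open>\<omega> / (u x\<^sub>1 \<cdots> x\<^sub>r)\<close> has residue
  \<open>\<Sum> \<lambda>\<^sub>i ord x\<^sub>i\<close> at \<open>t = 0\<close>, which is non-zero by non-resonance; so a tangential arc lies in the
  divisor, and the converse is read off the normal form.

  Charts only exist at closed points, so an arc over \<open>K\<close> violating either inclusion, possibly
  centred at a non-closed point \<open>p\<close>, is first specialised to a complex one.  Its coefficients lie in
  a complex algebra of countable dimension, which has a homomorphism to the complex numbers keeping
  finitely many given elements non-zero.  The specialised arc is centred at a closed
  specialisation of \<open>p\<close> and still violates the same inclusion.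

  For the branches: an arc lies on a closed set iff the image of its generic point does, and a point
  of the divisor which is on no intersection of two components is on exactly one component.
\<close>

section \<open>Subalgebras of a field\<close>

text \<open>The coefficients of an arc generate an algebra that need not be finitely generated, so
  the usual Nullstellensatz does not apply; as the complex numbers are uncountable, countable
  dimension suffices instead. Finitely many non-vanishing conditions are enough: a single
  coefficient of the pullback of an equation of the divisor, or of the form, witnesses the
  violation, and the denominators of finitely many elements of the local ring keep the new centre
  singular, since a relation between Kaehler differentials involves only finitely many elements. An
  equation of the divisor at the old centre is carried to the new one after multiplication by a
  function that is a unit at the old centre. In the language of local rings a point specialises to
  points with smaller local rings, so the new centre \<open>q\<close> satisfies
  \<open>q \<subseteq> p\<close>. A formal chart only maps the local ring into power series. The arc
  is therefore extended to all power series by approximation modulo powers of the maximal ideal, and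
  the chain rule for this extension needs an argument of its own.\<close>

lemma field_extensionD:
  assumes "field_extension \<kappa>"
  shows "\<kappa> 0 = 0" "\<kappa> 1 = 1" "\<kappa> (x + y) = \<kappa> x + \<kappa> y" "\<kappa> (x * y) = \<kappa> x * \<kappa> y"
    "\<kappa> (- x) = - \<kappa> x" "\<kappa> (x - y) = \<kappa> x - \<kappa> y" "\<kappa> x = \<kappa> y \<longleftrightarrow> x = y"
proof -
  have one: "\<kappa> 1 = 1" and add: "\<kappa> (x + y) = \<kappa> x + \<kappa> y" and mult: "\<kappa> (x * y) = \<kappa> x * \<kappa> y" for x y
    using assms by (auto simp: field_extension_def)
  have "\<kappa> 0 + \<kappa> 0 = \<kappa> 0" using add[of 0 0] by simp
  then have zero: "\<kappa> 0 = 0" by (metis add_cancel_right_right)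
  have neg: "\<kappa> (- x) = - \<kappa> x" for x
    using add[of x "- x"] zero by (simp add: eq_neg_iff_add_eq_0 add.commute)
  have diff: "\<kappa> (x - y) = \<kappa> x - \<kappa> y" for x y
    using add[of x "- y"] neg[of y] by simp
  have "x = y" if "\<kappa> x = \<kappa> y"
  proof (rule ccontr)
    assume "x \<noteq> y"
    then have "\<kappa> (x - y) * \<kappa> (inverse (x - y)) = 1"
      using mult[of "x - y" "inverse (x - y)"] one by simp
    then show False using that diff[of x y] by simp
  qed
  then show "\<kappa> x = \<kappa> y \<longleftrightarrow> x = y" by auto
  show "\<kappa> 0 = 0" "\<kappa> 1 = 1" "\<kappa> (x + y) = \<kappa> x + \<kappa> y" "\<kappa> (x * y) = \<kappa> x * \<kappa> y"
    "\<kappa> (- x) = - \<kappa> x" "\<kappa> (x - y) = \<kappa> x - \<kappa> y"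
    by (fact zero one add mult neg diff)+
qed

locale subalgebra_in_field =
  fixes \<iota> :: "complex \<Rightarrow> 'f::field" and A :: "'f set"
  assumes ext: "field_extension \<iota>" and sub: "subalgebra \<iota> A"
begin

lemma const_in: "\<iota> c \<in> A"
  and add_in: "a \<in> A \<Longrightarrow> b \<in> A \<Longrightarrow> a + b \<in> A"
  and mult_in: "a \<in> A \<Longrightarrow> b \<in> A \<Longrightarrow> a * b \<in> A"
  using sub by (auto simp: subalgebra_def)

lemma zero_in: "0 \<in> A" and one_in: "1 \<in> A"
  using const_in[of 0] const_in[of 1] by (simp_all add: field_extensionD[OF ext])

lemma uminus_in: "a \<in> A \<Longrightarrow> - a \<in> A"
  using mult_in[OF const_in[of "-1"], of a] by (simp add: field_extensionD[OF ext])

lemma diff_in: "a \<in> A \<Longrightarrow> b \<in> A \<Longrightarrow> a - b \<in> A"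
  using add_in[of a "- b"] uminus_in[of b] by simp

lemma sum_in: "(\<And>i. i \<in> I \<Longrightarrow> g i \<in> A) \<Longrightarrow> sum g I \<in> A"
  by (induction I rule: infinite_finite_induct) (auto simp: zero_in add_in)

lemma prod_in: "(\<And>i. i \<in> I \<Longrightarrow> g i \<in> A) \<Longrightarrow> prod g I \<in> A"
  by (induction I rule: infinite_finite_induct) (auto simp: one_in mult_in)

lemma power_in: "a \<in> A \<Longrightarrow> a ^ n \<in> A"
  by (induction n) (auto simp: one_in mult_in)

lemma of_nat_in: "of_nat n \<in> A"
  by (induction n) (auto simp: zero_in one_in add_in)

lemma ideal_uminus: "is_ideal A I \<Longrightarrow> x \<in> I \<Longrightarrow> - x \<in> I"
  using uminus_in[OF one_in] unfolding is_ideal_def by (metis mult_minus1)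

lemma ideal_diff: "is_ideal A I \<Longrightarrow> x \<in> I \<Longrightarrow> y \<in> I \<Longrightarrow> x - y \<in> I"
  using ideal_uminus[of I y] unfolding is_ideal_def by (metis diff_conv_add_uminus)

lemma ideal_sum: "is_ideal A I \<Longrightarrow> (\<And>i. i \<in> J \<Longrightarrow> g i \<in> I) \<Longrightarrow> sum g J \<in> I"
  by (induction J rule: infinite_finite_induct) (auto simp: is_ideal_def)

lemma ideal_extend:
  assumes "is_ideal A I" "x \<in> A"
  shows "is_ideal A {m + r * x | m r. m \<in> I \<and> r \<in> A}" (is "is_ideal A ?J")
    and "I \<subseteq> {m + r * x | m r. m \<in> I \<and> r \<in> A}" "x \<in> {m + r * x | m r. m \<in> I \<and> r \<in> A}"
proof -
  have IA: "I \<subseteq> A" and I0: "0 \<in> I" and Ia: "\<And>x y. x \<in> I \<Longrightarrow> y \<in> I \<Longrightarrow> x + y \<in> I"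
    and Im: "\<And>a x. a \<in> A \<Longrightarrow> x \<in> I \<Longrightarrow> a * x \<in> I"
    using assms(1) by (auto simp: is_ideal_def)
  show 1: "I \<subseteq> ?J"
  proof
    fix m assume "m \<in> I"
    then show "m \<in> ?J" using zero_in by (intro CollectI exI[of _ m] exI[of _ 0]) auto
  qed
  show "x \<in> ?J" using I0 one_in by (intro CollectI exI[of _ 0] exI[of _ 1]) auto
  show "is_ideal A ?J" unfolding is_ideal_def
  proof (intro conjI ballI)
    show "?J \<subseteq> A" using IA assms(2) by (auto intro!: add_in mult_in)
    show "0 \<in> ?J" using 1 I0 by blast
  next
    fix y z assume "y \<in> ?J" "z \<in> ?J"
    then obtain m r m' r' where *: "y = m + r * x" "z = m' + r' * x" "m \<in> I" "m' \<in> I" "r \<in> A" "r' \<in> A"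
      by blast
    then have "y + z = (m + m') + (r + r') * x" by (simp add: algebra_simps)
    then show "y + z \<in> ?J" using * Ia add_in by blast
  next
    fix b y assume b: "b \<in> A" and "y \<in> ?J"
    then obtain m r where *: "y = m + r * x" "m \<in> I" "r \<in> A" by blast
    then have "b * y = b * m + (b * r) * x" by (simp add: algebra_simps)
    then show "b * y \<in> ?J" using * Im mult_in b by blast
  qed
qed

text \<open>Krull's argument: an ideal maximal among those containing \<open>I\<close> and disjoint
  from the multiplicative set \<open>S\<close> is prime. The last conclusion records the maximality;
  for \<open>S = {1}\<close> it says that the quotient by \<open>P\<close> is a field.\<close>

lemma ideal_maximal_disjoint:
  assumes I: "is_ideal A I" and S1: "1 \<in> S" and Sm: "\<And>s t. s \<in> S \<Longrightarrow> t \<in> S \<Longrightarrow> s * t \<in> S"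
    and dis: "I \<inter> S = {}"
  obtains P where "is_prime_ideal A P" "I \<subseteq> P" "P \<inter> S = {}"
    "\<And>x. x \<in> A \<Longrightarrow> x \<notin> P \<Longrightarrow> \<exists>m\<in>P. \<exists>r\<in>A. m + r * x \<in> S"
proof -
  let ?Z = "{J. is_ideal A J \<and> I \<subseteq> J \<and> J \<inter> S = {}}"
  have "\<exists>M\<in>?Z. \<forall>X\<in>?Z. M \<subseteq> X \<longrightarrow> X = M"
  proof (rule subset_Zorn_nonempty)
    show "?Z \<noteq> {}" using I dis by blast
    fix \<C> assume ne: "\<C> \<noteq> {}" and ch: "subset.chain ?Z \<C>"
    then have sub: "\<C> \<subseteq> ?Z" and tot: "\<And>X Y. X \<in> \<C> \<Longrightarrow> Y \<in> \<C> \<Longrightarrow> X \<subseteq> Y \<or> Y \<subseteq> X"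
      by (auto simp: subset_chain_def)
    have "is_ideal A (\<Union>\<C>)" unfolding is_ideal_def
    proof (intro conjI ballI)
      show "\<Union>\<C> \<subseteq> A" using sub by (auto simp: is_ideal_def)
      show "0 \<in> \<Union>\<C>" using sub ne by (auto simp: is_ideal_def)
    next
      fix x y assume "x \<in> \<Union>\<C>" "y \<in> \<Union>\<C>"
      then obtain X where X: "X \<in> \<C>" "x \<in> X" "y \<in> X" using tot by (metis UnionE in_mono)
      then show "x + y \<in> \<Union>\<C>" using sub unfolding is_ideal_def by blast
    next
      fix a x assume "a \<in> A" "x \<in> \<Union>\<C>"
      then show "a * x \<in> \<Union>\<C>" using sub unfolding is_ideal_def by blast
    qed
    then show "\<Union>\<C> \<in> ?Z" using sub ne by auto
  qed
  then obtain P where PZ: "P \<in> ?Z" and mx: "\<forall>X\<in>?Z. P \<subseteq> X \<longrightarrow> X = P"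
    by (rule bexE)
  have P: "is_ideal A P" "I \<subseteq> P" "P \<inter> S = {}" using PZ by simp_all
  have max: "X = P" if "is_ideal A X" "I \<subseteq> X" "X \<inter> S = {}" "P \<subseteq> X" for X
    using mx that by simp
  have ex: "\<exists>m\<in>P. \<exists>r\<in>A. m + r * x \<in> S" if "x \<in> A" "x \<notin> P" for x
  proof (rule ccontr)
    assume "\<not> ?thesis"
    then have "{m + r * x | m r. m \<in> P \<and> r \<in> A} \<inter> S = {}" by blast
    then have "{m + r * x | m r. m \<in> P \<and> r \<in> A} = P"
      using ideal_extend[OF P(1) that(1)] P(2) by (intro max) auto
    then show False using ideal_extend(3)[OF P(1) that(1)] that(2) by simp
  qed
  have "is_prime_ideal A P" unfolding is_prime_ideal_def
  proof (intro conjI ballI impI P(1))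
    show "1 \<notin> P" using P(3) S1 by blast
    fix a b assume ab: "a \<in> A" "b \<in> A" "a * b \<in> P"
    show "a \<in> P \<or> b \<in> P"
    proof (rule ccontr)
      assume "\<not> ?thesis"
      then obtain m r m' r' where *: "m \<in> P" "r \<in> A" "m + r * a \<in> S" "m' \<in> P" "r' \<in> A" "m' + r' * b \<in> S"
        using ex ab by meson
      \<comment> \<open>Two elements of \<open>S\<close> of this form have a product in
        \<open>S\<close>, but every term of the expansion lies in \<open>P\<close>.\<close>
      have "(m + r * a) * (m' + r' * b) = (m' + r' * b) * m + ((r * a) * m' + (r * r') * (a * b))"
        by (simp add: algebra_simps)
      moreover have "(m' + r' * b) * m + ((r * a) * m' + (r * r') * (a * b)) \<in> P"
        using P(1) * ab add_in mult_in unfolding is_ideal_def subset_iff by simp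
      moreover have "(m + r * a) * (m' + r' * b) \<in> S" using Sm * by blast
      ultimately show False using P(3) by auto
    qed
  qed
  then show thesis using that P ex by blast
qed

end

lemma subalgebra_subalgebra_gen: "subalgebra \<iota> (subalgebra_gen \<iota> S)"
  and subset_subalgebra_gen: "S \<subseteq> subalgebra_gen \<iota> S"
  and subalgebra_gen_least: "subalgebra \<iota> B \<Longrightarrow> S \<subseteq> B \<Longrightarrow> subalgebra_gen \<iota> S \<subseteq> B"
  unfolding subalgebra_gen_def subalgebra_def by blast+

lemma ideal_gen_least: "is_ideal A I \<Longrightarrow> S \<subseteq> I \<Longrightarrow> ideal_gen A S \<subseteq> I"
  and subset_ideal_gen: "S \<subseteq> ideal_gen A S"
  unfolding ideal_gen_def by blast+

section \<open>Specialising countably generated algebras to the complex numbers\<close>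

lemma vector_space_extension:
  "field_extension \<kappa> \<Longrightarrow> vector_space (\<lambda>c x. \<kappa> c * x)"
  by unfold_locales (auto simp: field_extensionD algebra_simps)

text \<open>The monomials in countably many generators are countably many and span. That
  \<open>B\<close> lies in the algebra itself is recorded because arcs are later evaluated on its
  elements.\<close>

lemma subalgebra_gen_countable_span:
  fixes \<kappa> :: "complex \<Rightarrow> 'k::field"
  assumes ext: "field_extension \<kappa>" and T: "countable T"
  obtains B where "countable B" "subalgebra_gen \<kappa> T \<subseteq> module.span (\<lambda>c x. \<kappa> c * x) B"
    "B \<subseteq> subalgebra_gen \<kappa> T"
proof -
  interpret vector_space "\<lambda>c x. \<kappa> c * x" by (rule vector_space_extension[OF ext])
  interpret R: subalgebra_in_field \<kappa> "subalgebra_gen \<kappa> T"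
    by unfold_locales (rule ext subalgebra_subalgebra_gen)+
  let ?B = "prod_list ` lists T"
  have cl: "x * y \<in> span ?B" if x: "x \<in> span ?B" and y: "y \<in> span ?B" for x y
  proof -
    have 1: "b * z \<in> span ?B" if b: "b \<in> ?B" and z: "z \<in> span ?B" for b z
      using z
    proof (induction rule: span_induct_alt)
      case base then show ?case by (simp add: span_zero)
    next
      case (step c x y)
      obtain xs ys where "b = prod_list xs" "x = prod_list ys" "xs \<in> lists T" "ys \<in> lists T"
        using b step(1) by blast
      then have "b * x \<in> ?B" by (intro image_eqI[of _ _ "xs @ ys"]) auto
      then show ?case using step span_add[OF span_scale[OF span_base, of "b * x" ?B c]]
        by (simp add: algebra_simps)
    qed
    show ?thesis using x
    proof (induction rule: span_induct_alt)
      case base then show ?case by (simp add: span_zero)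
    next
      case (step c x z)
      then show ?case using span_add[OF span_scale[OF 1[OF step(1) y], of c]]
        by (simp add: algebra_simps)
    qed
  qed
  have "1 \<in> ?B" by (rule image_eqI[of _ _ "[]"]) auto
  have "subalgebra_gen \<kappa> T \<subseteq> span ?B"
  proof (rule subalgebra_gen_least)
    show "subalgebra \<kappa> (span ?B)" unfolding subalgebra_def
      using cl span_add span_scale[OF span_base[OF \<open>1 \<in> ?B\<close>]] by auto
    show "T \<subseteq> span ?B"
    proof
      fix t assume "t \<in> T"
      then have "t \<in> ?B" by (intro image_eqI[of _ _ "[t]"]) auto
      then show "t \<in> span ?B" by (rule span_base)
    qed
  qed
  moreover have "countable ?B" using T by auto
  moreover have "prod_list xs \<in> subalgebra_gen \<kappa> T" if "xs \<in> lists T" for xs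
    using that subset_subalgebra_gen[of T \<kappa>]
    by (induction xs) (auto intro: R.one_in R.mult_in)
  ultimately show thesis using that by blast
qed

lemma ev_linear_factor:
  fixes \<kappa> :: "complex \<Rightarrow> 'k::field"
  assumes "field_extension \<kappa>"
  shows "poly (map_poly \<kappa> ([:-z, 1:] * q)) a = (a - \<kappa> z) * poly (map_poly \<kappa> q) a"
proof -
  note D = field_extensionD[OF assms]
  have add: "map_poly \<kappa> (p + q) = map_poly \<kappa> p + map_poly \<kappa> q" for p q
    by (rule poly_eqI) (simp add: coeff_map_poly D)
  have sm: "map_poly \<kappa> (smult c p) = smult (\<kappa> c) (map_poly \<kappa> p)" for c p
    by (rule poly_eqI) (simp add: coeff_map_poly D)
  have "[:-z, 1:] * q = smult (- z) q + pCons 0 q" by simp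
  then show ?thesis
    by (simp only: add sm map_poly_pCons D) (simp add: algebra_simps)
qed

text \<open>Over the complex numbers \<open>q\<close> splits into linear factors, and a prime ideal
  containing their product at \<open>a\<close> contains one of them: an element algebraic modulo
  \<open>P\<close> is constant modulo \<open>P\<close>.\<close>

lemma (in subalgebra_in_field) poly_value_in_prime:
  assumes P: "is_prime_ideal A P" and a: "a \<in> A"
  shows "q \<noteq> 0 \<Longrightarrow> poly (map_poly \<iota> q) a \<in> P \<Longrightarrow> \<exists>z. a - \<iota> z \<in> P"
proof (induction "degree q" arbitrary: q rule: less_induct)
  case less
  note D = field_extensionD[OF ext]
  have Pid: "is_ideal A P" and P1: "1 \<notin> P" using P by (auto simp: is_prime_ideal_def)
  show ?case
  proof (cases "degree q = 0")
    case True
    then obtain c where c: "q = [:c:]" by (metis degree_eq_zeroE)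
    then have "c \<noteq> 0" "\<iota> c \<in> P" using less by (auto simp: map_poly_pCons D)
    then have "\<iota> (inverse c) * \<iota> c \<in> P" using Pid const_in by (auto simp: is_ideal_def)
    then show ?thesis using P1 \<open>c \<noteq> 0\<close> D(2) D(4)[of "inverse c" c] by simp
  next
    case False
    then have "\<not> constant (poly q)" by (simp add: constant_degree)
    then obtain z where "poly q z = 0" using fundamental_theorem_of_algebra by blast
    then obtain q' where q': "q = [:-z, 1:] * q'" by (metis poly_eq_0_iff_dvd dvdE)
    have "q' \<noteq> 0" using q' less.prems by auto
    then have deg: "degree q' < degree q" unfolding q' by (subst degree_mult_eq) auto
    have "(a - \<iota> z) * poly (map_poly \<iota> q') a \<in> P"
      using less.prems unfolding q' ev_linear_factor[OF ext] by simp
    moreover have "poly (map_poly \<iota> q') a \<in> A"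
      unfolding poly_altdef by (auto intro!: sum_in mult_in power_in const_in a simp: coeff_map_poly D)
    ultimately have "a - \<iota> z \<in> P \<or> poly (map_poly \<iota> q') a \<in> P"
      using P diff_in[OF a const_in] unfolding is_prime_ideal_def by blast
    then show ?thesis using less.hyps[OF deg \<open>q' \<noteq> 0\<close>] by blast
  qed
qed

text \<open>A field extension of countable dimension over the complex numbers is trivial: otherwise
  the inverses of the \<open>a - z\<close> would be uncountably many linearly independent elements.\<close>

lemma (in subalgebra_in_field) countable_residue:
  assumes B: "countable B" "A \<subseteq> module.span (\<lambda>c x. \<iota> c * x) B"
    and P: "is_prime_ideal A P"
    and max: "\<And>x. x \<in> A \<Longrightarrow> x \<notin> P \<Longrightarrow> \<exists>m\<in>P. \<exists>r\<in>A. m + r * x = 1"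
    and a: "a \<in> A"
  shows "\<exists>z. a - \<iota> z \<in> P"
proof (rule ccontr)
  assume neg: "\<not> ?thesis"
  interpret vector_space "\<lambda>c x. \<iota> c * x" by (rule vector_space_extension[OF ext])
  note D = field_extensionD[OF ext]
  have Pid: "is_ideal A P" and P1: "1 \<notin> P" using P by (auto simp: is_prime_ideal_def)
  have Pm: "\<And>r x. r \<in> A \<Longrightarrow> x \<in> P \<Longrightarrow> r * x \<in> P" using Pid by (auto simp: is_ideal_def)
  \<comment> \<open>By maximality each \<open>a - \<iota> z\<close>, being outside \<open>P\<close>,
    has an inverse modulo \<open>P\<close>; \<open>r z\<close> is a representative of it in
    \<open>A\<close>.\<close>
  have "\<exists>r. r \<in> A \<and> r * (a - \<iota> z) - 1 \<in> P" for z
  proof -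
    obtain m r where *: "m \<in> P" "r \<in> A" "m + r * (a - \<iota> z) = 1"
      using max[of "a - \<iota> z"] neg diff_in[OF a const_in] by blast
    then have "r * (a - \<iota> z) - 1 = - m" by (simp add: algebra_simps)
    then show ?thesis using ideal_uminus[OF Pid *(1)] * by metis
  qed
  then obtain r where rA: "\<And>z. r z \<in> A" and r: "\<And>z. r z * (a - \<iota> z) - 1 \<in> P" by metis
  \<comment> \<open>The dependence below is a dependence of elements of \<open>A\<close>, not of
    classes modulo \<open>P\<close>; injectivity lets it be indexed by the numbers
    \<open>z\<close>.\<close>
  have inj: "inj r"
  proof (rule injI, rule ccontr)
    fix x y assume eq: "r x = r y" and "x \<noteq> y"
    have "(r x * (a - \<iota> x) - 1) - (r y * (a - \<iota> y) - 1) \<in> P" using ideal_diff[OF Pid r r] .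
    then have "r x * \<iota> (y - x) \<in> P" using eq by (simp add: algebra_simps D)
    then have "\<iota> (inverse (y - x)) * (r x * \<iota> (y - x)) \<in> P" by (rule Pm[OF const_in])
    moreover have "\<iota> (inverse (y - x)) * \<iota> (y - x) = 1"
      using \<open>x \<noteq> y\<close> D(2) D(4)[of "inverse (y - x)" "y - x"] by simp
    ultimately have "r x \<in> P" by (metis mult.left_commute mult.right_neutral)
    then have "(a - \<iota> x) * r x \<in> P" by (rule Pm[OF diff_in[OF a const_in]])
    then have "(a - \<iota> x) * r x - (r x * (a - \<iota> x) - 1) \<in> P" using ideal_diff[OF Pid _ r] by blast
    then show False using P1 by simp
  qed
  \<comment> \<open>The spans of the finite initial pieces of \<open>B\<close> exhaust
    \<open>A\<close>. If each contained only finitely many of the \<open>r z\<close>, there would be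
    only countably many complex numbers.\<close>
  have "\<exists>F. finite F \<and> infinite {z. r z \<in> span F}"
  proof -
    define Bn where "Bn n = (if B = {} then {} else from_nat_into B ` {..n::nat})" for n
    have "\<exists>n. r z \<in> span (Bn n)" for z
    proof -
      have "r z \<in> span B" using B rA by blast
      then obtain F where F: "finite F" "F \<subseteq> B" "r z \<in> span F"
        unfolding span_explicit by (force intro: span_sum span_scale span_base)
      then have "F \<subseteq> Bn (Max (insert 0 (to_nat_on B ` F)))"
      proof (intro subsetI)
        fix x assume x: "x \<in> F"
        then have "x = from_nat_into B (to_nat_on B x)" using F B(1) by auto
        moreover have "to_nat_on B x \<le> Max (insert 0 (to_nat_on B ` F))" using F x by auto
        ultimately show "x \<in> Bn (Max (insert 0 (to_nat_on B ` F)))"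
          using x F unfolding Bn_def by auto
      qed
      then show ?thesis using F span_mono by blast
    qed
    then have U: "UNIV = (\<Union>n. {z. r z \<in> span (Bn n)})" by auto
    have "uncountable (UNIV :: complex set)"
    proof
      assume "countable (UNIV :: complex set)"
      then have "countable (range complex_of_real)" by (rule countable_subset[OF subset_UNIV])
      then have "countable (UNIV :: real set)"
        by (rule countable_image_inj_on) (rule inj_of_real)
      then show False using uncountable_UNIV_real by blast
    qed
    then have "uncountable (\<Union>n. {z. r z \<in> span (Bn n)})" using U by argo
    then have "\<exists>n. infinite {z. r z \<in> span (Bn n)}"
      using countable_UN[of UNIV "\<lambda>n. {z. r z \<in> span (Bn n)}"] countable_finite by auto
    moreover have "finite (Bn n)" for n by (simp add: Bn_def)
    ultimately show ?thesis by blast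
  qed
  then obtain F where F: "finite F" and inf: "infinite {z. r z \<in> span F}" by blast
  have "infinite (r ` {z. r z \<in> span F})"
    using inf inj by (simp add: finite_image_iff inj_on_subset)
  then have "dependent (r ` {z. r z \<in> span F})"
    using independent_span_bound[OF F] by blast
  then obtain t u v where t: "finite t" "t \<subseteq> r ` {z. r z \<in> span F}" "(\<Sum>v\<in>t. \<iota> (u v) * v) = 0"
    "v \<in> t" "u v \<noteq> 0" unfolding dependent_explicit by blast
  define L where "L = r -` t"
  have tL: "t = r ` L" using t(2) by (auto simp: L_def)
  have L: "finite L" using t(1) inj by (simp add: L_def finite_vimageI)
  obtain z0 where z0: "z0 \<in> L" "u (r z0) \<noteq> 0" using t tL by blast
  have sum0: "(\<Sum>z\<in>L. \<iota> (u (r z)) * r z) = 0"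
    using t(3) unfolding tL by (subst (asm) sum.reindex) (auto intro: inj_on_subset[OF inj])
  \<comment> \<open>The relation between the inverses of the \<open>a - z\<close>, multiplied by the
    product of all \<open>a - y\<close>: modulo \<open>P\<close> it becomes a polynomial equation
    for \<open>a\<close>.\<close>
  define Q where "Q = (\<Sum>z\<in>L. smult (u (r z)) (\<Prod>y\<in>L-{z}. [:-y, 1:]))"
  have add: "map_poly \<iota> (p + q) = map_poly \<iota> p + map_poly \<iota> q" for p q
    by (rule poly_eqI) (simp add: coeff_map_poly D)
  have sm: "map_poly \<iota> (smult c p) = smult (\<iota> c) (map_poly \<iota> p)" for c p
    by (rule poly_eqI) (simp add: coeff_map_poly D)
  have msum: "poly (map_poly \<iota> (sum g S)) a = (\<Sum>i\<in>S. poly (map_poly \<iota> (g i)) a)"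
    for g :: "complex \<Rightarrow> complex poly" and S
    by (induction S rule: infinite_finite_induct) (auto simp: add)
  have mprod: "poly (map_poly \<iota> (\<Prod>y\<in>S. [:-y, 1:])) a = (\<Prod>y\<in>S. a - \<iota> y)" if "finite S" for S
    using that
  proof (induction S)
    case empty then show ?case by (simp add: one_pCons map_poly_pCons D)
  next
    case (insert x F)
    show ?case unfolding prod.insert[OF insert.hyps] ev_linear_factor[OF ext] insert.IH ..
  qed
  have evQ: "poly (map_poly \<iota> Q) a = (\<Sum>z\<in>L. \<iota> (u (r z)) * (\<Prod>y\<in>L-{z}. a - \<iota> y))"
    unfolding Q_def msum sm poly_smult using L by (intro sum.cong refl) (subst mprod, auto)
  have "(\<Sum>z\<in>L. \<iota> (u (r z)) * (\<Prod>y\<in>L-{z}. a - \<iota> y))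
      = (\<Prod>y\<in>L. a - \<iota> y) * (\<Sum>z\<in>L. \<iota> (u (r z)) * r z)
        - (\<Sum>z\<in>L. (\<iota> (u (r z)) * (\<Prod>y\<in>L-{z}. a - \<iota> y)) * (r z * (a - \<iota> z) - 1))"
    unfolding sum_distrib_left sum_subtractf[symmetric]
    by (intro sum.cong refl) (simp add: prod.remove[OF L] algebra_simps)
  also have "\<dots> = - (\<Sum>z\<in>L. (\<iota> (u (r z)) * (\<Prod>y\<in>L-{z}. a - \<iota> y)) * (r z * (a - \<iota> z) - 1))"
    by (simp add: sum0)
  also have "\<dots> \<in> P"
    by (intro ideal_uminus[OF Pid] ideal_sum[OF Pid] Pm r mult_in const_in prod_in diff_in a)
  finally have inP: "poly (map_poly \<iota> Q) a \<in> P" unfolding evQ .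
  \<comment> \<open>At \<open>z0\<close> every summand other than the one for \<open>z0\<close>
    contains the factor \<open>z0 - z0\<close>, so \<open>Q\<close> is not the zero
    polynomial.\<close>
  have "poly Q z0 = (\<Sum>z\<in>L. u (r z) * (\<Prod>y\<in>L-{z}. z0 - y))"
    by (simp add: Q_def poly_sum poly_prod)
  also have "\<dots> = u (r z0) * (\<Prod>y\<in>L-{z0}. z0 - y)"
    using z0 L by (subst sum.remove[OF L z0(1)]) (auto intro!: sum.neutral prod_zero)
  also have "\<dots> \<noteq> 0" using z0 L by auto
  finally have "Q \<noteq> 0" by auto
  then show False using poly_value_in_prime[OF P a _ inP] neg by blast
qed

section \<open>Localisation at a prime ideal and residue homomorphisms\<close>

context subalgebra_in_field
begin

lemma
  assumes P: "is_prime_ideal A P"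
  shows subset_localization: "A \<subseteq> localization A P"
    and subalgebra_localization: "subalgebra \<iota> (localization A P)"
    and nonunits_localization: "nonunits (localization A P) = {a / b |a b. a \<in> P \<and> b \<in> A - P}"
    and nonunits_localization_Int: "A \<inter> nonunits (localization A P) = P"
    and ideal_nonunits_localization: "is_ideal (localization A P) (nonunits (localization A P))"
proof -
  let ?p = "localization A P"
  have PA: "P \<subseteq> A" and P0: "0 \<in> P" and Pa: "\<And>x y. x \<in> P \<Longrightarrow> y \<in> P \<Longrightarrow> x + y \<in> P"
    and Pm: "\<And>a x. a \<in> A \<Longrightarrow> x \<in> P \<Longrightarrow> a * x \<in> P" and P1: "1 \<notin> P"
    and Pp: "\<And>a b. a \<in> A \<Longrightarrow> b \<in> A \<Longrightarrow> a * b \<in> P \<Longrightarrow> a \<in> P \<or> b \<in> P"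
    using P by (auto simp: is_prime_ideal_def is_ideal_def)
  have locI: "a / b \<in> ?p" if "a \<in> A" "b \<in> A" "b \<notin> P" for a b
    using that by (auto simp: localization_def)
  have locE: "\<exists>a b. x = a / b \<and> a \<in> A \<and> b \<in> A \<and> b \<notin> P \<and> b \<noteq> 0" if "x \<in> ?p" for x
    using that P0 by (force simp: localization_def)
  have mP: "b * d \<in> A \<and> b * d \<notin> P" if "b \<in> A" "b \<notin> P" "d \<in> A" "d \<notin> P" for b d
    using Pp that mult_in by blast
  show sA: "A \<subseteq> ?p" using locI[OF _ one_in P1] by auto
  show "subalgebra \<iota> ?p" unfolding subalgebra_def
  proof (intro conjI ballI)
    show "range \<iota> \<subseteq> ?p" using const_in sA by blast
    fix x y assume "x \<in> ?p" "y \<in> ?p"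
    then obtain a b c d where *: "x = a / b" "a \<in> A" "b \<in> A" "b \<notin> P" "b \<noteq> 0"
      "y = c / d" "c \<in> A" "d \<in> A" "d \<notin> P" "d \<noteq> 0" using locE by meson
    then have "x + y = (a * d + c * b) / (b * d)" "x * y = (a * c) / (b * d)"
      by (simp_all add: field_simps)
    then show "x + y \<in> ?p" "x * y \<in> ?p" using * mP[of b d] locI add_in mult_in by simp_all
  qed
  show nu: "nonunits ?p = {a / b |a b. a \<in> P \<and> b \<in> A - P}"
  proof (intro equalityI subsetI)
    fix x assume x: "x \<in> nonunits ?p"
    then obtain a b where *: "x = a / b" "a \<in> A" "b \<in> A" "b \<notin> P" "b \<noteq> 0"
      using locE[of x] by (auto simp: nonunits_def)
    have "a \<in> P"
    proof (rule ccontr)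
      assume "a \<notin> P"
      then have "inverse x \<in> ?p" "x \<noteq> 0" using * locI[of b a] P0 by auto
      then show False using x by (simp add: nonunits_def)
    qed
    then show "x \<in> {a / b |a b. a \<in> P \<and> b \<in> A - P}" using * by blast
  next
    fix x assume "x \<in> {a / b |a b. a \<in> P \<and> b \<in> A - P}"
    then obtain a b where *: "x = a / b" "a \<in> P" "b \<in> A" "b \<notin> P" "b \<noteq> 0" using P0 by blast
    have "inverse x \<notin> ?p" if "x \<noteq> 0"
    proof
      assume "inverse x \<in> ?p"
      then obtain c d where c: "inverse x = c / d" "c \<in> A" "d \<in> A" "d \<notin> P" "d \<noteq> 0"
        using locE by blast
      then have "b * d = c * a" using * that by (auto simp: field_simps)
      then show False using Pm[OF c(2) *(2)] mP[OF *(3,4) c(3,4)] by simp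
    qed
    then show "x \<in> nonunits ?p" using * locI PA by (auto simp: nonunits_def)
  qed
  show "A \<inter> nonunits ?p = P"
  proof (intro equalityI subsetI)
    fix x assume x: "x \<in> A \<inter> nonunits ?p"
    then obtain a b where *: "x = a / b" "a \<in> P" "b \<in> A" "b \<notin> P" "b \<noteq> 0"
      using P0 unfolding nu by blast
    then have "x * b \<in> P" by simp
    then show "x \<in> P" using x * Pp by blast
  next
    fix x assume "x \<in> P"
    then have "x / 1 \<in> nonunits ?p" unfolding nu using P1 one_in by blast
    then show "x \<in> A \<inter> nonunits ?p" using \<open>x \<in> P\<close> PA by auto
  qed
  show "is_ideal ?p (nonunits ?p)" unfolding is_ideal_def
  proof (intro conjI ballI)
    show "nonunits ?p \<subseteq> ?p" by (auto simp: nonunits_def)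
    show "0 \<in> nonunits ?p" using sA zero_in by (auto simp: nonunits_def)
  next
    fix x y assume "x \<in> nonunits ?p" "y \<in> nonunits ?p"
    then obtain a b c d where *: "x = a / b" "a \<in> P" "b \<in> A" "b \<notin> P" "b \<noteq> 0"
      "y = c / d" "c \<in> P" "d \<in> A" "d \<notin> P" "d \<noteq> 0" using P0 unfolding nu by blast
    then have "x + y = (d * a + b * c) / (b * d)" by (simp add: field_simps)
    then show "x + y \<in> nonunits ?p" unfolding nu using * mP[of b d] Pa Pm by blast
  next
    fix x y assume "x \<in> ?p" "y \<in> nonunits ?p"
    then obtain a b c d where *: "x = a / b" "a \<in> A" "b \<in> A" "b \<notin> P" "b \<noteq> 0"
      "y = c / d" "c \<in> P" "d \<in> A" "d \<notin> P" "d \<noteq> 0" using P0 locE unfolding nu by blast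
    then have "x * y = (a * c) / (b * d)" by simp
    then show "x * y \<in> nonunits ?p" unfolding nu using * mP[of b d] Pm by blast
  qed
qed

text \<open>The localisation is the centre of the local ring \<open>p\<close> on the spectrum of
  \<open>A\<close>. Domination is the relation in which separatedness of a variety is
  phrased.\<close>

lemma prime_ideal_Int_nonunits:
  assumes "subalgebra \<iota> p" "is_ideal p (nonunits p)" "A \<subseteq> p"
  shows "is_prime_ideal A (A \<inter> nonunits p)" "localization A (A \<inter> nonunits p) \<subseteq> p"
    "dominates p (localization A (A \<inter> nonunits p))"
proof -
  interpret p: subalgebra_in_field \<iota> p by unfold_locales (rule ext assms)+
  have one: "1 \<notin> nonunits p" using p.one_in by (auto simp: nonunits_def)
  have inv: "inverse b \<in> p" "b \<noteq> 0" if "b \<in> A" "b \<notin> nonunits p" for b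
    using that assms(3) by (auto simp: nonunits_def)
  have idm: "a * x \<in> nonunits p" if "a \<in> p" "x \<in> nonunits p" for x a
    using assms(2) that by (auto simp: is_ideal_def)
  show P: "is_prime_ideal A (A \<inter> nonunits p)"
    unfolding is_prime_ideal_def
  proof (intro conjI ballI impI)
    show "is_ideal A (A \<inter> nonunits p)"
      using assms(2,3) add_in mult_in zero_in unfolding is_ideal_def by blast
    fix a b assume ab: "a \<in> A" "b \<in> A" "a * b \<in> A \<inter> nonunits p"
    show "a \<in> A \<inter> nonunits p \<or> b \<in> A \<inter> nonunits p"
    proof (rule ccontr)
      assume "\<not> ?thesis"
      then have *: "a \<notin> nonunits p" "b \<notin> nonunits p" using ab by auto
      have "(inverse a * inverse b) * (a * b) \<in> nonunits p"
        using ab(3) idm[OF p.mult_in[OF inv(1)[OF ab(1) *(1)] inv(1)[OF ab(2) *(2)]], of "a * b"]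
        by simp
      then show False using one inv[OF ab(1) *(1)] inv[OF ab(2) *(2)] by (simp add: field_simps)
    qed
  qed (use one in auto)
  show sub: "localization A (A \<inter> nonunits p) \<subseteq> p"
  proof
    fix x assume "x \<in> localization A (A \<inter> nonunits p)"
    then obtain a b where *: "x = a / b" "a \<in> A" "b \<in> A" "b \<notin> nonunits p"
      by (auto simp: localization_def)
    then show "x \<in> p" unfolding *(1) divide_inverse using assms(3) by (intro p.mult_in inv) auto
  qed
  have "nonunits (localization A (A \<inter> nonunits p)) \<subseteq> nonunits p"
  proof
    fix x assume "x \<in> nonunits (localization A (A \<inter> nonunits p))"
    then obtain a b where *: "x = a / b" "a \<in> nonunits p" "b \<in> A" "b \<notin> nonunits p"
      unfolding nonunits_localization[OF P] by blast
    have "inverse b * a \<in> nonunits p" using * by (intro idm inv)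
    then show "x \<in> nonunits p" using * by (simp add: field_simps)
  qed
  then show "dominates p (localization A (A \<inter> nonunits p))"
    using sub by (simp add: dominates_def)
qed

text \<open>Nonzero constants are units, so the constant congruent to a given \<open>x\<close> is
  unique; \<open>s\<close> takes \<open>x\<close> to it, and uniqueness makes \<open>s\<close> a
  homomorphism.\<close>

lemma residue_hom:
  assumes loc: "is_ideal A (nonunits A)" and res: "\<And>x. x \<in> A \<Longrightarrow> \<exists>z. x - \<iota> z \<in> nonunits A"
  obtains s where "alg_hom_on A \<iota> (\<lambda>z. z) s" "\<And>x. x \<in> A \<Longrightarrow> s x = 0 \<longleftrightarrow> x \<in> nonunits A"
proof -
  note D = field_extensionD[OF ext]
  obtain s where s: "\<And>x. x \<in> A \<Longrightarrow> x - \<iota> (s x) \<in> nonunits A" using res by metis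
  have c0: "z = 0" if "\<iota> z \<in> nonunits A" for z
  proof (rule ccontr)
    assume "z \<noteq> 0"
    have "\<iota> z * \<iota> (inverse z) = 1" using D(2) D(4)[of z "inverse z"] \<open>z \<noteq> 0\<close> by simp
    then have "inverse (\<iota> z) = \<iota> (inverse z)" "\<iota> z \<noteq> 0" by (auto intro: inverse_unique)
    then show False using that const_in by (auto simp: nonunits_def)
  qed
  have uniq: "s x = z" if "x \<in> A" "x - \<iota> z \<in> nonunits A" for x z
  proof -
    have "(x - \<iota> z) - (x - \<iota> (s x)) \<in> nonunits A" using ideal_diff[OF loc that(2) s[OF that(1)]] .
    then have "\<iota> (s x - z) \<in> nonunits A" by (simp add: D)
    then show ?thesis using c0 by fastforce
  qed
  have ida: "x + y \<in> nonunits A" if "x \<in> nonunits A" "y \<in> nonunits A" for x y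
    using loc that by (auto simp: is_ideal_def)
  have idm: "a * x \<in> nonunits A" if "a \<in> A" "x \<in> nonunits A" for x a
    using loc that by (auto simp: is_ideal_def)
  have "alg_hom_on A \<iota> (\<lambda>z. z) s" unfolding alg_hom_on_def
  proof (intro conjI ballI allI)
    fix a b assume a: "a \<in> A" and b: "b \<in> A"
    have "(a - \<iota> (s a)) + (b - \<iota> (s b)) \<in> nonunits A" by (intro ida s a b)
    then show "s (a + b) = s a + s b"
      by (intro uniq add_in a b) (simp add: D algebra_simps)
    have "b * (a - \<iota> (s a)) + \<iota> (s a) * (b - \<iota> (s b)) \<in> nonunits A"
      by (intro ida idm s a b const_in)
    then show "s (a * b) = s a * s b"
      by (intro uniq mult_in a b) (simp add: D algebra_simps)
  next
    fix z show "s (\<iota> z) = z"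
      by (rule uniq[OF const_in]) (use zero_in in \<open>simp add: nonunits_def\<close>)
  qed
  moreover have "s x = 0 \<longleftrightarrow> x \<in> nonunits A" if "x \<in> A" for x
    using uniq[OF that, of 0] s[OF that] by (auto simp: D)
  ultimately show thesis using that by blast
qed

end

text \<open>A Nullstellensatz for algebras of countable dimension: divide by a maximal ideal, whose
  residue field is the field of complex numbers by \<open>countable_residue\<close>. Localising at
  that ideal gives the last conclusion, which allows division by elements with non-zero
  value.\<close>

lemma complex_specialization:
  fixes \<kappa> :: "complex \<Rightarrow> 'k::field"
  assumes ext: "field_extension \<kappa>" and T: "countable T"
    and c: "c \<in> subalgebra_gen \<kappa> T" "c \<noteq> 0"
  obtains R s where "subalgebra \<kappa> R" "T \<subseteq> R" "alg_hom_on R \<kappa> (\<lambda>z. z) s" "s c \<noteq> 0"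
    "\<And>r. r \<in> R \<Longrightarrow> s r \<noteq> 0 \<Longrightarrow> inverse r \<in> R"
proof -
  note D = field_extensionD[OF ext]
  \<comment> \<open>With its inverse adjoined, \<open>c\<close> is a unit and lies in no maximal
    ideal.\<close>
  let ?T = "insert (inverse c) T" let ?R = "subalgebra_gen \<kappa> ?T"
  interpret R0: subalgebra_in_field \<kappa> ?R
    by unfold_locales (rule ext subalgebra_subalgebra_gen)+
  have TR: "?T \<subseteq> ?R" by (rule subset_subalgebra_gen)
  then have "T \<subseteq> ?R" by blast
  then have "subalgebra_gen \<kappa> T \<subseteq> ?R" by (rule subalgebra_gen_least[OF R0.sub])
  then have cR: "c \<in> ?R" using c(1) by (rule subsetD)
  have cR': "inverse c \<in> ?R" using TR by blast
  have cT: "countable ?T" using T by simp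
  obtain B where B: "countable B" "?R \<subseteq> module.span (\<lambda>c x. \<kappa> c * x) B" "B \<subseteq> ?R"
    by (rule subalgebra_gen_countable_span[OF ext cT])
  have "is_ideal ?R {0}" by (auto simp: is_ideal_def R0.zero_in)
  then obtain M where M: "is_prime_ideal ?R M" "{0} \<subseteq> M" "M \<inter> {1} = {}"
    and max: "\<And>x. x \<in> ?R \<Longrightarrow> x \<notin> M \<Longrightarrow> \<exists>m\<in>M. \<exists>r\<in>?R. m + r * x \<in> {1}"
    by (rule R0.ideal_maximal_disjoint[of "{0}" "{1}"]) simp_all
  note M = M(1)
  have res0: "\<exists>z. x - \<kappa> z \<in> M" if "x \<in> ?R" for x
    using R0.countable_residue[OF B(1,2) M _ that] max by simp
  let ?L = "localization ?R M"
  interpret L: subalgebra_in_field \<kappa> ?L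
    by unfold_locales (rule ext R0.subalgebra_localization[OF M])+
  have RL: "?R \<subseteq> ?L" by (rule R0.subset_localization[OF M])
  have LI: "is_ideal ?L (nonunits ?L)" by (rule R0.ideal_nonunits_localization[OF M])
  have LM: "x \<in> M \<Longrightarrow> x \<in> nonunits ?L" for x using R0.nonunits_localization_Int[OF M] by blast
  have Mid: "is_ideal ?R M" using M by (auto simp: is_prime_ideal_def)
  \<comment> \<open>Localising does not enlarge the residue field: if \<open>a\<close> and
    \<open>b\<close> are congruent to \<open>y\<close> and \<open>z\<close>, then
    \<open>a / b\<close> is congruent to \<open>y / z\<close>.\<close>
  have "\<exists>z. x - \<kappa> z \<in> nonunits ?L" if x: "x \<in> ?L" for x
  proof -
    obtain a b where ab: "x = a / b" "a \<in> ?R" "b \<in> ?R" "b \<notin> M" using x unfolding localization_def by blast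
    obtain y z where yz: "a - \<kappa> y \<in> M" "b - \<kappa> z \<in> M" using res0 ab by meson
    have b0: "b \<noteq> 0" using ab Mid by (auto simp: is_ideal_def)
    have z0: "z \<noteq> 0" using yz ab by (auto simp: D)
    have "inverse b \<in> ?L" using ab b0 R0.one_in by (auto simp: localization_def inverse_eq_divide)
    have "(a - \<kappa> y) - \<kappa> (y / z) * (b - \<kappa> z) \<in> M"
      using R0.ideal_diff[OF Mid yz(1)] yz(2) Mid R0.const_in unfolding is_ideal_def by blast
    moreover have "\<kappa> (y / z) * \<kappa> z = \<kappa> y" using z0 by (simp add: D(4)[symmetric])
    ultimately have "a - \<kappa> (y / z) * b \<in> M" by (simp add: algebra_simps)
    then have "inverse b * (a - \<kappa> (y / z) * b) \<in> nonunits ?L"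
      using LI LM \<open>inverse b \<in> ?L\<close> by (auto simp: is_ideal_def)
    moreover have "inverse b * (a - \<kappa> (y / z) * b) = x - \<kappa> (y / z)"
      using b0 ab by (simp add: field_simps)
    ultimately show ?thesis by metis
  qed
  then obtain s where s: "alg_hom_on ?L \<kappa> (\<lambda>z. z) s" "\<And>x. x \<in> ?L \<Longrightarrow> s x = 0 \<longleftrightarrow> x \<in> nonunits ?L"
    using L.residue_hom[OF LI] by blast
  show thesis
  proof (rule that[OF L.sub _ s(1)])
    show "T \<subseteq> ?L" using RL TR by blast
    have "c \<in> ?L" "inverse c \<in> ?L" using RL cR cR' by blast+
    then show "s c \<noteq> 0" using s(2)[of c] c(2) by (auto simp: nonunits_def)
    show "inverse r \<in> ?L" if "r \<in> ?L" "s r \<noteq> 0" for r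
      using s(2)[OF that(1)] that by (auto simp: nonunits_def)
  qed
qed

text \<open>\<open>alg_hom_on\<close> demands nothing of the structure map of the target. The
  assumed values at 0, 1 and -1 are what makes \<open>f\<close> respect zero, one and
  negation.\<close>

locale algebra_hom = subalgebra_in_field \<iota> A for \<iota> and A :: "'f::field set" +
  fixes \<iota>' :: "complex \<Rightarrow> 'b::comm_ring_1" and f :: "'f \<Rightarrow> 'b"
  assumes hom: "alg_hom_on A \<iota> \<iota>' f" and const_one: "\<iota>' 0 = 0" "\<iota>' 1 = 1" "\<iota>' (-1) = -1"
begin

lemma hom_const: "f (\<iota> c) = \<iota>' c"
  and hom_add: "a \<in> A \<Longrightarrow> b \<in> A \<Longrightarrow> f (a + b) = f a + f b"
  and hom_mult: "a \<in> A \<Longrightarrow> b \<in> A \<Longrightarrow> f (a * b) = f a * f b"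
  using hom by (auto simp: alg_hom_on_def)

lemma hom_zero: "f 0 = 0" and hom_one: "f 1 = 1"
  using hom_const[of 0] hom_const[of 1] const_one by (simp_all add: field_extensionD[OF ext])

lemma hom_uminus: "a \<in> A \<Longrightarrow> f (- a) = - f a"
  using hom_mult[OF const_in[of "-1"], of a] hom_const[of "-1"] const_one
  by (simp add: field_extensionD[OF ext])

lemma hom_diff: "a \<in> A \<Longrightarrow> b \<in> A \<Longrightarrow> f (a - b) = f a - f b"
  using hom_add[of a "- b"] hom_uminus[of b] uminus_in[of b] by simp

lemma hom_sum: "(\<And>i. i \<in> I \<Longrightarrow> g i \<in> A) \<Longrightarrow> f (sum g I) = (\<Sum>i\<in>I. f (g i))"
  by (induction I rule: infinite_finite_induct) (auto simp: hom_zero hom_add sum_in)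

lemma hom_prod: "(\<And>i. i \<in> I \<Longrightarrow> g i \<in> A) \<Longrightarrow> f (prod g I) = (\<Prod>i\<in>I. f (g i))"
  by (induction I rule: infinite_finite_induct) (auto simp: hom_one hom_mult prod_in)

lemma hom_of_nat: "f (of_nat n) = of_nat n"
  by (induction n) (auto simp: hom_zero hom_one hom_add one_in of_nat_in)

end

section \<open>Points of a variety and the Zariski topology\<close>

lemma spec_pointsD:
  assumes "field_extension \<iota>" "subalgebra \<iota> A" "p \<in> spec_points A"
  shows "A \<subseteq> p" "subalgebra \<iota> p" "is_ideal p (nonunits p)" "is_prime_ideal A (A \<inter> nonunits p)"
    "p = localization A (A \<inter> nonunits p)"
proof -
  interpret subalgebra_in_field \<iota> A by unfold_locales (rule assms)+
  obtain P where P: "is_prime_ideal A P" "p = localization A P"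
    using assms(3) by (auto simp: spec_points_def)
  show "A \<subseteq> p" "subalgebra \<iota> p" "is_ideal p (nonunits p)" "is_prime_ideal A (A \<inter> nonunits p)"
    "p = localization A (A \<inter> nonunits p)"
    using subset_localization[OF P(1)] subalgebra_localization[OF P(1)] P
      ideal_nonunits_localization[OF P(1)] nonunits_localization_Int[OF P(1)] by simp_all
qed

lemma spec_pointsE:
  assumes "field_extension \<iota>" "subalgebra \<iota> A" "p \<in> spec_points A" "x \<in> p"
  obtains a b where "a \<in> A" "b \<in> A" "b \<notin> nonunits p" "b \<noteq> 0" "x = a / b"
proof -
  note s = spec_pointsD[OF assms(1-3)]
  obtain a b where ab: "a \<in> A" "b \<in> A" "b \<notin> nonunits p" "x = a / b"
    using assms(4) s(5) unfolding localization_def by blast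
  have "0 \<in> nonunits p" using s(3) by (simp add: is_ideal_def)
  then have "b \<noteq> 0" using ab by auto
  then show thesis using that ab by blast
qed

lemma affine_openD:
  assumes "affine_open \<iota> W A"
  shows "subalgebra \<iota> A" "spec_points A \<subseteq> W"
  using assms subalgebra_subalgebra_gen unfolding affine_open_def affine_model_def by auto

locale variety_loc =
  fixes \<iota> :: "complex \<Rightarrow> 'f::field" and W :: "'f set set"
  assumes var: "variety \<iota> W"
begin

lemma ext: "field_extension \<iota>" using var by (simp add: variety_def)

lemma affine_cover:
  assumes "p \<in> W" obtains A where "affine_open \<iota> W A" "p \<in> spec_points A"
proof -
  obtain \<A> where "\<forall>A\<in>\<A>. affine_model \<iota> A" "W = (\<Union>A\<in>\<A>. spec_points A)"
    using var unfolding variety_def by blast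
  then show thesis using assms that unfolding affine_open_def by blast
qed

lemma points:
  assumes "p \<in> W"
  shows "subalgebra \<iota> p" "is_ideal p (nonunits p)" "subalgebra_in_field \<iota> p"
proof -
  obtain A where A: "affine_open \<iota> W A" "p \<in> spec_points A" using affine_cover[OF assms] .
  show "subalgebra \<iota> p" "is_ideal p (nonunits p)"
    using spec_pointsD[OF ext affine_openD(1)[OF A(1)] A(2)] by auto
  then show "subalgebra_in_field \<iota> p" using ext by unfold_locales
qed

text \<open>Both \<open>p\<close> and its centre on the spectrum of \<open>A\<close> are dominated
  by \<open>p\<close>, so separatedness identifies them. Membership of a point in an affine open
  thus reduces to inclusion of rings.\<close>

lemma spec_pointsI:
  assumes A: "affine_open \<iota> W A" and p: "p \<in> W" "A \<subseteq> p"
  shows "p \<in> spec_points A"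
proof -
  interpret subalgebra_in_field \<iota> A by unfold_locales (rule ext affine_openD(1)[OF A])+
  let ?q = "localization A (A \<inter> nonunits p)"
  note P = prime_ideal_Int_nonunits[OF points(1,2)[OF p(1)] p(2)]
  have q: "?q \<in> spec_points A" using P(1) by (auto simp: spec_points_def)
  then have "?q \<in> W" using affine_openD(2)[OF A] by blast
  moreover have "local_subring \<iota> p" "dominates p p" "dominates p ?q"
    using points(1,2)[OF p(1)] P(3) by (auto simp: local_subring_def dominates_def)
  ultimately have "p = ?q" using var p unfolding variety_def by blast
  then show ?thesis using q by simp
qed

lemma generization_in_spec:
  assumes "affine_open \<iota> W A" "q \<in> spec_points A" "p \<in> W" "q \<subseteq> p"
  shows "p \<in> spec_points A"
  using spec_pointsI[OF assms(1,3)] spec_pointsD(1)[OF ext affine_openD(1)[OF assms(1)] assms(2)] assms(4)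
  by blast

lemma nonunits_mono:
  assumes "q \<subseteq> p" "x \<in> q" "x \<in> nonunits p" shows "x \<in> nonunits q"
  using assms by (auto simp: nonunits_def)

lemma spec_points_eqI:
  assumes "affine_open \<iota> W A" "p \<in> spec_points A" "q \<in> spec_points A"
    "A \<inter> nonunits p = A \<inter> nonunits q"
  shows "p = q"
  using spec_pointsD(5)[OF ext affine_openD(1)[OF assms(1)] assms(2)]
    spec_pointsD(5)[OF ext affine_openD(1)[OF assms(1)] assms(3)] assms(4) by simp

lemma unit_inverse: "p \<in> W \<Longrightarrow> b \<in> p \<Longrightarrow> b \<notin> nonunits p \<Longrightarrow> inverse b \<in> p \<and> b \<noteq> 0"
  by (simp add: nonunits_def)

lemma nonunits_absorb: "p \<in> W \<Longrightarrow> a \<in> p \<Longrightarrow> x \<in> nonunits p \<Longrightarrow> a * x \<in> nonunits p"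
  using points(2)[of p] by (auto simp: is_ideal_def)

text \<open>\<open>B\<close> is generated by finitely many elements, each a fraction over
  \<open>A\<close> with denominator a unit at \<open>x\<close>; take \<open>h\<close> to be the
  product of these denominators. Where \<open>h\<close> is a unit, the local ring contains
  \<open>B\<close>.\<close>

lemma principal_nbhd_Int:
  assumes A: "affine_open \<iota> W A" "x \<in> spec_points A" and B: "affine_open \<iota> W B" "x \<in> spec_points B"
  obtains h where "h \<in> A" "h \<notin> nonunits x"
    "\<And>y. y \<in> spec_points A \<Longrightarrow> h \<notin> nonunits y \<Longrightarrow> y \<in> spec_points B"
proof -
  interpret subalgebra_in_field \<iota> A by unfold_locales (rule ext affine_openD(1)[OF A(1)])+
  note Ax = spec_pointsD[OF ext affine_openD(1)[OF A(1)]]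
  obtain S where S: "finite S" "B = subalgebra_gen \<iota> S"
    using B(1) by (auto simp: affine_open_def affine_model_def)
  have "S \<subseteq> x" using spec_pointsD(1)[OF ext affine_openD(1)[OF B(1)] B(2)]
      subset_subalgebra_gen[of S \<iota>] S(2) by blast
  then have "\<forall>b\<in>S. \<exists>a h. a \<in> A \<and> h \<in> A \<and> h \<notin> nonunits x \<and> b = a / h"
    using spec_pointsE[OF ext affine_openD(1)[OF A(1)] A(2)] by (metis subsetD)
  then obtain a h where ah: "\<And>b. b \<in> S \<Longrightarrow> a b \<in> A \<and> h b \<in> A \<and> h b \<notin> nonunits x \<and> b = a b / h b"
    by metis
  show thesis
  proof (rule that[of "\<Prod>b\<in>S. h b"])
    show "(\<Prod>b\<in>S. h b) \<in> A" using ah by (intro prod_in) blast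
    have P: "is_prime_ideal A (A \<inter> nonunits x)" using Ax(4) A(2) .
    have "(\<Prod>b\<in>S'. h b) \<notin> A \<inter> nonunits x" if "S' \<subseteq> S" for S'
      using finite_subset[OF that S(1)] that
    proof (induction S')
      case empty then show ?case using P by (auto simp: is_prime_ideal_def)
    next
      case (insert b F)
      then have "h b \<in> A" "h b \<notin> A \<inter> nonunits x" "(\<Prod>b\<in>F. h b) \<in> A" "(\<Prod>b\<in>F. h b) \<notin> A \<inter> nonunits x"
        using ah by (auto intro!: prod_in)
      then have "h b * (\<Prod>b\<in>F. h b) \<notin> A \<inter> nonunits x" using P unfolding is_prime_ideal_def by blast
      then show ?case by (simp only: prod.insert[OF insert.hyps] simp_thms)
    qed
    then show "(\<Prod>b\<in>S. h b) \<notin> nonunits x" using \<open>(\<Prod>b\<in>S. h b) \<in> A\<close> by blast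
    fix y assume y: "y \<in> spec_points A" "(\<Prod>b\<in>S. h b) \<notin> nonunits y"
    have yW: "y \<in> W" using y affine_openD(2)[OF A(1)] by blast
    interpret y: subalgebra_in_field \<iota> y by (rule points(3)[OF yW])
    have Ay: "A \<subseteq> y" by (rule Ax(1)[OF y(1)])
    have "S \<subseteq> y"
    proof
      fix b assume b: "b \<in> S"
      have "h b \<notin> nonunits y"
      proof
        assume "h b \<in> nonunits y"
        moreover have "(\<Prod>b\<in>S-{b}. h b) \<in> y" using ah Ay by (intro y.prod_in) blast
        ultimately have "(\<Prod>b\<in>S-{b}. h b) * h b \<in> nonunits y" by (intro nonunits_absorb[OF yW])
        then show False using y(2) prod.remove[OF S(1) b, of h] by (simp add: mult.commute)
      qed
      then have "inverse (h b) \<in> y" using ah[OF b] Ay unit_inverse[OF yW] by blast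
      then have "a b * inverse (h b) \<in> y" using ah[OF b] Ay by (intro y.mult_in) auto
      then show "b \<in> y" using ah[OF b] by (simp add: divide_inverse)
    qed
    then have "B \<subseteq> y" unfolding S(2) by (rule subalgebra_gen_least[OF y.sub])
    then show "y \<in> spec_points B" by (rule spec_pointsI[OF B(1) yW])
  qed
qed

text \<open>\<open>zariski\<close> is only given by generators, so the argument is an induction over
  generated open sets: \<open>principal_nbhd_Int\<close> handles a generator, and intersections
  correspond to products of functions.\<close>

lemma openin_zariski_principal:
  assumes U: "openin (zariski \<iota> W) U" and A: "affine_open \<iota> W A"
  shows "x \<in> U \<Longrightarrow> x \<in> spec_points A \<Longrightarrow>
    \<exists>h\<in>A. h \<notin> nonunits x \<and> (\<forall>y\<in>spec_points A. h \<notin> nonunits y \<longrightarrow> y \<in> U)"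
proof -
  interpret subalgebra_in_field \<iota> A by unfold_locales (rule ext affine_openD(1)[OF A])+
  have AW: "y \<in> spec_points A \<Longrightarrow> y \<in> W \<and> A \<subseteq> y" for y
    using affine_openD(2)[OF A] spec_pointsD(1)[OF ext affine_openD(1)[OF A]] by blast
  have "generate_topology_on {spec_points A |A. affine_open \<iota> W A} U"
    using U by (simp add: zariski_def openin_topology_generated_by_iff)
  then show "x \<in> U \<Longrightarrow> x \<in> spec_points A \<Longrightarrow>
    \<exists>h\<in>A. h \<notin> nonunits x \<and> (\<forall>y\<in>spec_points A. h \<notin> nonunits y \<longrightarrow> y \<in> U)"
  proof (induction arbitrary: x)
    case (Int U V)
    have x: "x \<in> U" "x \<in> V" using Int.prems(1) by auto
    obtain g h where gh: "g \<in> A" "g \<notin> nonunits x" "\<forall>y\<in>spec_points A. g \<notin> nonunits y \<longrightarrow> y \<in> U"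
      "h \<in> A" "h \<notin> nonunits x" "\<forall>y\<in>spec_points A. h \<notin> nonunits y \<longrightarrow> y \<in> V"
      using Int.IH(1)[OF x(1) Int.prems(2)] Int.IH(2)[OF x(2) Int.prems(2)] by blast
    have P: "is_prime_ideal A (A \<inter> nonunits x)"
      using spec_pointsD(4)[OF ext affine_openD(1)[OF A] Int.prems(2)] .
    then have "g * h \<notin> nonunits x" using gh mult_in unfolding is_prime_ideal_def by blast
    moreover have "y \<in> U \<inter> V" if y: "y \<in> spec_points A" "g * h \<notin> nonunits y" for y
    proof -
      have "y \<in> W" "g \<in> y" "h \<in> y" using AW[OF y(1)] gh by auto
      then have "g \<notin> nonunits y" "h \<notin> nonunits y"
        using nonunits_absorb[of y g h] nonunits_absorb[of y h g] y(2) by (auto simp: mult.commute)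
      then show ?thesis using gh y by blast
    qed
    ultimately show ?case using mult_in gh by blast
  next
    case (UN K)
    then obtain k where k: "k \<in> K" "x \<in> k" by blast
    show ?case using UN.IH[OF k UN.prems(2)] k by blast
  next
    case (Basis s)
    then obtain B where B: "s = spec_points B" "affine_open \<iota> W B" by blast
    then have "x \<in> spec_points B" using Basis by simp
    then obtain h where "h \<in> A" "h \<notin> nonunits x"
      "\<And>y. y \<in> spec_points A \<Longrightarrow> h \<notin> nonunits y \<Longrightarrow> y \<in> spec_points B"
      using principal_nbhd_Int[OF A Basis.prems(2) B(2)] by blast
    then show ?case using B by blast
  qed simp
qed

lemma topspace_zariski: "topspace (zariski \<iota> W) = W"
proof -
  have "\<Union>{spec_points A |A. affine_open \<iota> W A} = W"
  proof (intro equalityI subsetI)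
    fix p assume "p \<in> W"
    then obtain A where "affine_open \<iota> W A" "p \<in> spec_points A" by (rule affine_cover)
    then show "p \<in> \<Union>{spec_points A |A. affine_open \<iota> W A}" by blast
  qed (use affine_openD(2) in blast)
  then show ?thesis unfolding zariski_def topology_generated_by_topspace .
qed

lemma closed_principal:
  assumes "closedin (zariski \<iota> W) D" "affine_open \<iota> W A" "x \<in> spec_points A" "x \<notin> D"
  obtains h where "h \<in> A" "h \<notin> nonunits x" "\<And>y. y \<in> spec_points A \<Longrightarrow> y \<in> D \<Longrightarrow> h \<in> nonunits y"
proof -
  have "openin (zariski \<iota> W) (W - D)" using assms(1) by (simp add: closedin_def topspace_zariski)
  moreover have "x \<in> W - D" using assms(3,4) affine_openD(2)[OF assms(2)] by blast
  ultimately obtain h where "h \<in> A" "h \<notin> nonunits x"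
    "\<forall>y\<in>spec_points A. h \<notin> nonunits y \<longrightarrow> y \<in> W - D"
    using openin_zariski_principal[OF _ assms(2) _ assms(3)] by blast
  then show thesis by (intro that) blast+
qed

text \<open>A function of the chart that vanishes on \<open>D\<close> but not at \<open>q\<close>
  would vanish at the generization \<open>p\<close>, hence be a non-unit in the smaller ring
  \<open>q\<close> as well.\<close>

lemma closed_specialization:
  assumes "closedin (zariski \<iota> W) D" "q \<in> W" "p \<in> D" "q \<subseteq> p"
  shows "q \<in> D"
proof (rule ccontr)
  assume q: "q \<notin> D"
  obtain A where A: "affine_open \<iota> W A" "q \<in> spec_points A" using affine_cover[OF assms(2)] .
  obtain h where h: "h \<in> A" "h \<notin> nonunits q" "\<And>y. y \<in> spec_points A \<Longrightarrow> y \<in> D \<Longrightarrow> h \<in> nonunits y"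
    by (rule closed_principal[OF assms(1) A q]) blast
  have "p \<in> W" using assms(1,3) closedin_subset topspace_zariski by blast
  then have "h \<in> nonunits p" using h(3) generization_in_spec[OF A _ assms(4)] assms(3) by blast
  moreover have "h \<in> q" using h(1) spec_pointsD(1)[OF ext affine_openD(1)[OF A(1)] A(2)] by blast
  ultimately show False using h(2) nonunits_mono[OF assms(4)] by blast
qed

text \<open>\<open>B\<close> is the ring of fractions of \<open>A\<close> with powers of
  \<open>h\<close> as denominators; the point is that it is again finitely generated and that its
  local rings are local rings of \<open>A\<close>.\<close>

lemma affine_open_principal:
  assumes A: "affine_open \<iota> W A" and h: "h \<in> A" "h \<noteq> 0"
  obtains B where "affine_open \<iota> W B" "inverse h \<in> B"
    "\<And>x. x \<in> spec_points A \<Longrightarrow> h \<notin> nonunits x \<Longrightarrow> x \<in> spec_points B"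
proof -
  interpret A: subalgebra_in_field \<iota> A by unfold_locales (rule ext affine_openD(1)[OF A])+
  obtain S where S: "finite S" "A = subalgebra_gen \<iota> S" "\<forall>x. \<exists>a\<in>A. \<exists>b\<in>A. b \<noteq> 0 \<and> x = a / b"
    using A unfolding affine_open_def affine_model_def by blast
  define B where "B = subalgebra_gen \<iota> (insert (inverse h) S)"
  interpret B: subalgebra_in_field \<iota> B
    unfolding B_def by unfold_locales (rule ext subalgebra_subalgebra_gen)+
  have SB: "insert (inverse h) S \<subseteq> B" unfolding B_def by (rule subset_subalgebra_gen)
  then have "S \<subseteq> B" by blast
  then have AB: "A \<subseteq> B" unfolding S(2) by (rule subalgebra_gen_least[OF B.sub])
  have hB: "inverse h \<in> B" using SB by blast
  have form: "\<exists>n. h ^ n * x \<in> A" if "x \<in> B" for x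
  proof -
    have "B \<subseteq> {x. \<exists>n. h ^ n * x \<in> A}" (is "_ \<subseteq> ?C") unfolding B_def
    proof (rule subalgebra_gen_least)
      have SA: "S \<subseteq> A" unfolding S(2) by (rule subset_subalgebra_gen)
      have AC: "A \<subseteq> ?C"
      proof
        fix x assume "x \<in> A" then have "h ^ 0 * x \<in> A" by simp
        then show "x \<in> ?C" by blast
      qed
      have "h ^ 1 * inverse h \<in> A" using h A.one_in by simp
      then show "insert (inverse h) S \<subseteq> ?C" using SA AC by blast
      show "subalgebra \<iota> ?C" unfolding subalgebra_def
      proof (intro conjI ballI)
        show "range \<iota> \<subseteq> ?C" using AC A.const_in by blast
        fix x y assume "x \<in> ?C" "y \<in> ?C"
        then obtain m n where *: "h ^ m * x \<in> A" "h ^ n * y \<in> A" by blast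
        have "h ^ n * (h ^ m * x) + h ^ m * (h ^ n * y) \<in> A" "(h ^ m * x) * (h ^ n * y) \<in> A"
          using * h by (auto intro!: A.add_in A.mult_in[of _ "_ * _"] A.power_in)
        then have "h ^ (n + m) * (x + y) \<in> A" "h ^ (m + n) * (x * y) \<in> A"
          by (simp_all add: power_add algebra_simps)
        then show "x + y \<in> ?C" "x * y \<in> ?C" by blast+
      qed
    qed
    then show ?thesis using that by blast
  qed
  have sub: "spec_points B \<subseteq> spec_points A"
  proof
    fix y assume y: "y \<in> spec_points B"
    note By = spec_pointsD[OF ext B.sub y]
    interpret y: subalgebra_in_field \<iota> y by unfold_locales (rule ext By(2))+
    have Ay: "A \<subseteq> y" using AB By(1) by blast
    note P = A.prime_ideal_Int_nonunits[OF By(2,3) Ay]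
    have hu: "h ^ n \<notin> nonunits y" for n
      using h AB By(1) y.power_in[of "inverse h" n] hB by (auto simp: nonunits_def power_inverse)
    have "y \<subseteq> localization A (A \<inter> nonunits y)"
    proof
      fix x assume "x \<in> y"
      then obtain a b where ab: "a \<in> B" "b \<in> B" "b \<notin> nonunits y" "b \<noteq> 0" "x = a / b"
        by (rule spec_pointsE[OF ext B.sub y])
      \<comment> \<open>Powers of \<open>h\<close> clear the denominators of numerator and
        denominator separately; as \<open>h\<close> is a unit at \<open>y\<close>, the new
        denominator remains one.\<close>
      obtain m n where mn: "h ^ m * a \<in> A" "h ^ n * b \<in> A" using form ab by meson
      have "x = (h ^ n * (h ^ m * a)) / (h ^ m * (h ^ n * b))" using ab h by (simp add: field_simps)
      moreover have "h ^ n * (h ^ m * a) \<in> A" "h ^ m * (h ^ n * b) \<in> A"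
        using mn h by (auto intro: A.mult_in A.power_in)
      moreover have "h ^ m * (h ^ n * b) \<notin> nonunits y"
      proof
        assume *: "h ^ m * (h ^ n * b) \<in> nonunits y"
        have "inverse h ^ (m + n) \<in> y" using hB By(1) by (intro y.power_in) blast
        then have "inverse h ^ (m + n) * (h ^ m * (h ^ n * b)) \<in> nonunits y"
          using By(3) * by (auto simp: is_ideal_def)
        moreover have "inverse h ^ (m + n) * (h ^ m * (h ^ n * b)) = b"
          using h by (simp add: power_add power_inverse field_simps)
        ultimately show False using ab(3) by simp
      qed
      ultimately show "x \<in> localization A (A \<inter> nonunits y)" unfolding localization_def by blast
    qed
    then have "y = localization A (A \<inter> nonunits y)" using P(2) by blast
    then show "y \<in> spec_points A" unfolding spec_points_def using P(1) by blast
  qed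
  have "affine_open \<iota> W B" unfolding affine_open_def affine_model_def
  proof (intro conjI)
    show "\<exists>S. finite S \<and> B = subalgebra_gen \<iota> S" using S(1) B_def by blast
    show "\<forall>x. \<exists>a\<in>B. \<exists>b\<in>B. b \<noteq> 0 \<and> x = a / b" using S(3) AB by blast
    show "spec_points B \<subseteq> W" using sub affine_openD(2)[OF A] by blast
  qed
  moreover have "x \<in> spec_points B" if x: "x \<in> spec_points A" "h \<notin> nonunits x" for x
  proof -
    have xW: "x \<in> W" using affine_openD(2)[OF A] x by blast
    have Ax: "A \<subseteq> x" by (rule spec_pointsD(1)[OF ext A.sub x(1)])
    have "S \<subseteq> A" unfolding S(2) by (rule subset_subalgebra_gen)
    then have "insert (inverse h) S \<subseteq> x" using Ax unit_inverse[OF xW _ x(2)] h by blast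
    then have "B \<subseteq> x" unfolding B_def by (rule subalgebra_gen_least[OF points(1)[OF xW]])
    then show ?thesis by (rule spec_pointsI[OF \<open>affine_open \<iota> W B\<close> xW])
  qed
  ultimately show thesis using that hB by blast
qed

text \<open>A point with complex residue field cuts out a maximal ideal on each affine chart
  containing it, so every other point of the chart is separated from it by a function vanishing at
  \<open>q\<close> only.\<close>

lemma closed_rational_point:
  assumes q: "q \<in> W" and res: "\<And>x. x \<in> q \<Longrightarrow> \<exists>z. x - \<iota> z \<in> nonunits q"
  shows "closedin (zariski \<iota> W) {q}"
proof -
  have "\<exists>U. openin (zariski \<iota> W) U \<and> x \<in> U \<and> U \<subseteq> W - {q}" if x: "x \<in> W - {q}" for x
  proof -
    have xW: "x \<in> W" using x by blast
    obtain B where B: "affine_open \<iota> W B" "x \<in> spec_points B" using affine_cover[OF xW] .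
    have op: "openin (zariski \<iota> W) (spec_points C)" if "affine_open \<iota> W C" for C
      unfolding zariski_def using that by (intro topology_generated_by_Basis) blast
    show ?thesis
    proof (cases "q \<in> spec_points B")
      case False then show ?thesis using op[OF B(1)] B(2) affine_openD(2)[OF B(1)] by blast
    next
      case True
      note Bs = affine_openD(1)[OF B(1)]
      note Bx = spec_pointsD[OF ext Bs B(2)] and Bq = spec_pointsD[OF ext Bs True]
      interpret B: subalgebra_in_field \<iota> B by unfold_locales (rule ext Bs)+
      interpret x: subalgebra_in_field \<iota> x by (rule points(3)[OF xW])
      interpret q: subalgebra_in_field \<iota> q by (rule points(3)[OF q])
      have "\<exists>h\<in>B. h \<in> nonunits q \<and> h \<notin> nonunits x"
      proof (rule ccontr)
        assume "\<not> ?thesis"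
        then have sub: "\<And>h. h \<in> B \<Longrightarrow> h \<in> nonunits q \<Longrightarrow> h \<in> nonunits x" by blast
        \<comment> \<open>Maximality: \<open>b\<close> differs from a constant by a function
          vanishing at \<open>q\<close>, hence at \<open>x\<close>. As \<open>b\<close> vanishes at
          \<open>x\<close>, so does the constant, which is therefore zero.\<close>
        have "b \<in> nonunits q" if b: "b \<in> B" "b \<in> nonunits x" for b
        proof -
          obtain z where z: "b - \<iota> z \<in> nonunits q" using res b Bq(1) by blast
          then have "b - \<iota> z \<in> nonunits x" using sub B.diff_in[OF b(1) B.const_in] by blast
          then have "b - (b - \<iota> z) \<in> nonunits x" by (rule x.ideal_diff[OF Bx(3) b(2)])
          then have zx: "\<iota> z \<in> nonunits x" by simp
          have "z = 0"
          proof (rule ccontr)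
            assume "z \<noteq> 0"
            have "\<iota> z * \<iota> (inverse z) = 1"
              using field_extensionD(2)[OF ext] field_extensionD(4)[OF ext, of z "inverse z"] \<open>z \<noteq> 0\<close> by simp
            then have "inverse (\<iota> z) = \<iota> (inverse z)" "\<iota> z \<noteq> 0" by (auto intro: inverse_unique)
            then show False using zx x.const_in by (auto simp: nonunits_def)
          qed
          then show ?thesis using z by (simp add: field_extensionD(1)[OF ext])
        qed
        then have "B \<inter> nonunits x = B \<inter> nonunits q" using sub by blast
        then show False using spec_points_eqI[OF B True] x by blast
      qed
      then obtain h where h: "h \<in> B" "h \<in> nonunits q" "h \<notin> nonunits x" by blast
      have "h \<noteq> 0" using h(3) x.zero_in by (auto simp: nonunits_def)
      then obtain C where C: "affine_open \<iota> W C" "inverse h \<in> C"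
        "\<And>x. x \<in> spec_points B \<Longrightarrow> h \<notin> nonunits x \<Longrightarrow> x \<in> spec_points C"
        using affine_open_principal[OF B(1) h(1)] by blast
      have "q \<notin> spec_points C"
      proof
        assume "q \<in> spec_points C"
        then have "inverse h \<in> q" using spec_pointsD(1)[OF ext affine_openD(1)[OF C(1)]] C(2) by blast
        then show False using h \<open>h \<noteq> 0\<close> by (simp add: nonunits_def)
      qed
      then show ?thesis using op[OF C(1)] C(3)[OF B(2) h(3)] affine_openD(2)[OF C(1)] by blast
    qed
  qed
  then have "openin (zariski \<iota> W) (W - {q})" by (subst openin_subopen) blast
  then show ?thesis using q by (simp add: closedin_def topspace_zariski)
qed

text \<open>The stalk at \<open>p\<close> of the ideal of \<open>D\<close> comes from the ideal
  \<open>J\<close> of \<open>D\<close> on the whole chart, up to denominators that are units at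
  \<open>p\<close>. It makes an equation of \<open>D\<close> at the centre of an arc usable at a
  specialisation of the centre.\<close>

lemma stalk_ideal_spread:
  assumes D: "closedin (zariski \<iota> W) D" and A: "affine_open \<iota> W A" "p \<in> spec_points A"
    and a: "a \<in> A" "a \<in> stalk_ideal D p"
  obtains b where "b \<in> A" "b \<notin> nonunits p" "\<And>q. q \<in> spec_points A \<Longrightarrow> a * b \<in> stalk_ideal D q"
proof -
  interpret A: subalgebra_in_field \<iota> A by unfold_locales (rule ext affine_openD(1)[OF A(1)])+
  note sp = spec_pointsD[OF ext A.sub]
  have pW: "y \<in> spec_points A \<Longrightarrow> y \<in> W" for y using affine_openD(2)[OF A(1)] by blast
  define J where "J = {h \<in> A. \<forall>y\<in>spec_points A. y \<in> D \<longrightarrow> h \<in> nonunits y}"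
  have J: "is_ideal A J" unfolding is_ideal_def
  proof (intro conjI ballI)
    show "J \<subseteq> A" by (auto simp: J_def)
    have id: "y \<in> spec_points A \<Longrightarrow> is_ideal y (nonunits y) \<and> A \<subseteq> y" for y using sp(1,3) by blast
    show "0 \<in> J" using A.zero_in id by (auto simp: J_def is_ideal_def)
    show "x + y \<in> J" if "x \<in> J" "y \<in> J" for x y
      using that id A.add_in unfolding J_def is_ideal_def by blast
    show "a * x \<in> J" if "a \<in> A" "x \<in> J" for a x
      using that id A.mult_in unfolding J_def is_ideal_def by blast
  qed
  \<comment> \<open>If \<open>S\<close> missed \<open>J\<close>, a prime containing \<open>J\<close>
    and missing \<open>S\<close> would be a point of \<open>D\<close> generizing \<open>p\<close>
    (it misses the units at \<open>p\<close>) at which \<open>a\<close> is a unit, against the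
    choice of \<open>a\<close>.\<close>
  define S where "S = {a ^ n * b |n b. b \<in> A \<and> b \<notin> nonunits p}"
  have P: "is_prime_ideal A (A \<inter> nonunits p)" by (rule sp(4)[OF A(2)])
  have bb: "b * c \<in> A \<and> b * c \<notin> nonunits p" if "b \<in> A" "b \<notin> nonunits p" "c \<in> A" "c \<notin> nonunits p" for b c
    using that P A.mult_in unfolding is_prime_ideal_def by blast
  have one: "1 \<in> A" "1 \<notin> nonunits p" using P A.one_in by (auto simp: is_prime_ideal_def)
  have "S \<inter> J \<noteq> {}"
  proof
    assume "S \<inter> J = {}"
    moreover have "a ^ 0 * 1 \<in> S" unfolding S_def using one by blast
    then have "1 \<in> S" by simp
    moreover have "s * t \<in> S" if "s \<in> S" "t \<in> S" for s t
    proof -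
      obtain m b n c where "s = a ^ m * b" "t = a ^ n * c" "b \<in> A" "b \<notin> nonunits p" "c \<in> A" "c \<notin> nonunits p"
        using \<open>s \<in> S\<close> \<open>t \<in> S\<close> unfolding S_def by blast
      then have "s * t = a ^ (m + n) * (b * c)" "b * c \<in> A" "b * c \<notin> nonunits p"
        using bb[of b c] by (auto simp: power_add algebra_simps)
      then show ?thesis unfolding S_def by blast
    qed
    ultimately obtain Q where Q: "is_prime_ideal A Q" "J \<subseteq> Q" "Q \<inter> S = {}"
      using A.ideal_maximal_disjoint[OF J, of S] by (metis inf_commute)
    let ?y = "localization A Q"
    have y: "?y \<in> spec_points A" using Q(1) unfolding spec_points_def by blast
    have yQ: "A \<inter> nonunits ?y = Q" by (rule A.nonunits_localization_Int[OF Q(1)])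
    have "?y \<in> D"
    proof (rule ccontr)
      assume "?y \<notin> D"
      then obtain h where "h \<in> A" "h \<notin> nonunits ?y" "\<And>y. y \<in> spec_points A \<Longrightarrow> y \<in> D \<Longrightarrow> h \<in> nonunits y"
        using closed_principal[OF D A(1) y] by blast
      then show False using Q(2) yQ unfolding J_def by blast
    qed
    have nP: "b \<in> nonunits p" if "b \<in> Q" for b
    proof (rule ccontr)
      assume "b \<notin> nonunits p"
      moreover have "b \<in> A" using that yQ by blast
      ultimately have "a ^ 0 * b \<in> S" unfolding S_def by blast
      then show False using that Q(3) by auto
    qed
    have "p \<subseteq> ?y"
    proof
      fix x assume "x \<in> p"
      then obtain c b where "c \<in> A" "b \<in> A" "b \<notin> nonunits p" "b \<noteq> 0" "x = c / b"
        by (rule spec_pointsE[OF ext A.sub A(2)])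
      then show "x \<in> ?y" using nP unfolding localization_def by blast
    qed
    then have "a \<in> nonunits ?y" using a(2) \<open>?y \<in> D\<close> unfolding stalk_ideal_def by blast
    then have "a \<in> Q" using yQ a(1) by blast
    moreover have "a ^ 1 * 1 \<in> S" unfolding S_def using one by blast
    ultimately show False using Q(3) by auto
  qed
  then obtain n b where b: "b \<in> A" "b \<notin> nonunits p" "a ^ n * b \<in> J" unfolding S_def by blast
  have "a * b \<in> nonunits y" if y: "y \<in> spec_points A" "y \<in> D" for y
  proof (rule ccontr)
    assume ab: "a * b \<notin> nonunits y"
    have P: "is_prime_ideal A (A \<inter> nonunits y)" by (rule sp(4)[OF y(1)])
    have yW: "y \<in> W" "A \<subseteq> y" using pW sp(1) y by blast+
    have "a \<notin> nonunits y" "b \<notin> nonunits y"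
      using ab nonunits_absorb[OF yW(1), of a b] nonunits_absorb[OF yW(1), of b a] yW a(1) b(1)
      by (auto simp: mult.commute)
    then have "a ^ n * b \<notin> A \<inter> nonunits y"
    proof (induction n)
      case (Suc n)
      then have "a * (a ^ n * b) \<notin> A \<inter> nonunits y" using P a(1) b(1) A.mult_in A.power_in
        unfolding is_prime_ideal_def by blast
      then show ?case by (simp add: mult.assoc)
    qed simp
    then show False using b y unfolding J_def by blast
  qed
  moreover have "a * b \<in> q" if "q \<in> spec_points A" for q
    using sp(1)[OF that] A.mult_in a(1) b(1) by blast
  ultimately have "a * b \<in> stalk_ideal D q" if "q \<in> spec_points A" for q
    using that generization_in_spec[OF A(1) that] closedin_subset[OF D] topspace_zariski
    unfolding stalk_ideal_def by blast
  then show thesis using that b by blast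
qed

end

section \<open>Pulling back differential forms\<close>

lemma lookup_form_smult: "Poly_Mapping.lookup (form_smult c w) b = c * Poly_Mapping.lookup w b"
  by (simp add: form_smult_def Poly_Mapping.map.rep_eq when_def)

lemma kahler_formsI: "(\<And>b. Poly_Mapping.lookup w b \<noteq> 0 \<Longrightarrow> b \<in> A \<and> Poly_Mapping.lookup w b \<in> A) \<Longrightarrow> w \<in> kahler_forms A"
  by (auto simp: kahler_forms_def in_keys_iff)

lemma kahler_formsD:
  assumes "w \<in> kahler_forms A" "Poly_Mapping.lookup w b \<noteq> 0" shows "b \<in> A" "Poly_Mapping.lookup w b \<in> A"
  using assms by (auto simp: kahler_forms_def in_keys_iff)

context subalgebra_in_field
begin

lemma kahler_forms_lookup: "w \<in> kahler_forms A \<Longrightarrow> Poly_Mapping.lookup w b \<in> A"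
  using kahler_formsD(2)[of w A b] zero_in by (cases "Poly_Mapping.lookup w b = 0") auto

lemma kahler_forms_add: "v \<in> kahler_forms A \<Longrightarrow> w \<in> kahler_forms A \<Longrightarrow> v + w \<in> kahler_forms A"
  by (rule kahler_formsI)
    (metis add.right_neutral add_in kahler_formsD kahler_forms_lookup lookup_add)

lemma kahler_forms_diff: "v \<in> kahler_forms A \<Longrightarrow> w \<in> kahler_forms A \<Longrightarrow> v - w \<in> kahler_forms A"
  by (rule kahler_formsI)
    (metis diff_self diff_in kahler_formsD kahler_forms_lookup lookup_minus)

lemma kahler_forms_smult: "c \<in> A \<Longrightarrow> w \<in> kahler_forms A \<Longrightarrow> form_smult c w \<in> kahler_forms A"
  by (rule kahler_formsI) (auto simp: lookup_form_smult kahler_formsD intro: mult_in)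

lemma kahler_forms_single: "c \<in> A \<Longrightarrow> b \<in> A \<Longrightarrow> Poly_Mapping.single b c \<in> kahler_forms A"
  by (rule kahler_formsI) (auto simp: lookup_single when_def split: if_splits)

lemma kahler_relations_forms: "w \<in> kahler_relations \<iota> A \<Longrightarrow> w \<in> kahler_forms A"
  by (induction rule: kahler_relations.induct)
    (auto intro!: kahler_forms_diff kahler_forms_add kahler_forms_smult kahler_forms_single
      add_in mult_in one_in const_in)

text \<open>The inductive derivation of a relation mentions only finitely many ring elements and
  remains valid in any subalgebra containing them. Hence vanishing of a form at a point can be
  transported to a specialisation.\<close>

lemma kahler_relations_localize:
  assumes "w \<in> kahler_relations \<iota> A"
  obtains F where "finite F" "F \<subseteq> A"
    "\<And>q. subalgebra \<iota> q \<Longrightarrow> F \<subseteq> q \<Longrightarrow> w \<in> kahler_relations \<iota> q"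
proof -
  have "\<exists>F. finite F \<and> F \<subseteq> A \<and> (\<forall>q. subalgebra \<iota> q \<longrightarrow> F \<subseteq> q \<longrightarrow> w \<in> kahler_relations \<iota> q)"
    using assms
  proof (induction rule: kahler_relations.induct)
    case (d_add a b)
    then show ?case by (intro exI[of _ "{a, b}"]) (auto intro: kahler_relations.d_add)
  next
    case (d_mult a b)
    then show ?case by (intro exI[of _ "{a, b}"]) (auto intro: kahler_relations.d_mult)
  next
    case (d_const c)
    then show ?case by (intro exI[of _ "{}"]) (auto intro: kahler_relations.d_const)
  next
    case (add v w)
    then obtain F F' where "finite F" "F \<subseteq> A" "finite F'" "F' \<subseteq> A"
      "\<forall>q. subalgebra \<iota> q \<longrightarrow> F \<subseteq> q \<longrightarrow> v \<in> kahler_relations \<iota> q"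
      "\<forall>q. subalgebra \<iota> q \<longrightarrow> F' \<subseteq> q \<longrightarrow> w \<in> kahler_relations \<iota> q" by blast
    then show ?case by (intro exI[of _ "F \<union> F'"]) (auto intro: kahler_relations.add)
  next
    case (smult a w)
    then obtain F where "finite F" "F \<subseteq> A"
      "\<forall>q. subalgebra \<iota> q \<longrightarrow> F \<subseteq> q \<longrightarrow> w \<in> kahler_relations \<iota> q" by blast
    then show ?case using smult by (intro exI[of _ "insert a F"]) (auto intro: kahler_relations.smult)
  qed
  then show thesis using that by blast
qed

end

locale series_hom = algebra_hom \<iota> A "\<lambda>c. fps_const (\<kappa> c)" \<phi>
  for \<iota> and A :: "'f::field set" and \<kappa> :: "complex \<Rightarrow> 'r::comm_ring_1" and \<phi>
begin

lemma form_pullback_superset: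
  assumes "finite S" "Poly_Mapping.keys w \<subseteq> S"
  shows "form_pullback \<phi> w = (\<Sum>b\<in>S. \<phi> (Poly_Mapping.lookup w b) * fps_deriv (\<phi> b))"
  unfolding form_pullback_def using assms
  by (intro sum.mono_neutral_left) (auto simp: in_keys_iff hom_zero)

lemma form_pullback_add:
  assumes "v \<in> kahler_forms A" "w \<in> kahler_forms A"
  shows "form_pullback \<phi> (v + w) = form_pullback \<phi> v + form_pullback \<phi> w"
proof -
  let ?S = "Poly_Mapping.keys v \<union> Poly_Mapping.keys w"
  have "form_pullback \<phi> (v + w) = (\<Sum>b\<in>?S. \<phi> (Poly_Mapping.lookup (v + w) b) * fps_deriv (\<phi> b))"
    by (rule form_pullback_superset) (auto simp: keys_add)
  also have "\<dots> = (\<Sum>b\<in>?S. \<phi> (Poly_Mapping.lookup v b) * fps_deriv (\<phi> b)) + (\<Sum>b\<in>?S. \<phi> (Poly_Mapping.lookup w b) * fps_deriv (\<phi> b))"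
    unfolding sum.distrib[symmetric] lookup_add
    by (intro sum.cong refl) (simp add: hom_add kahler_forms_lookup assms algebra_simps)
  finally show ?thesis by (simp add: form_pullback_superset[of ?S])
qed

lemma form_pullback_diff:
  assumes "v \<in> kahler_forms A" "w \<in> kahler_forms A"
  shows "form_pullback \<phi> (v - w) = form_pullback \<phi> v - form_pullback \<phi> w"
  using form_pullback_add[OF kahler_forms_diff[OF assms] assms(2)] by simp

lemma form_pullback_smult:
  assumes "c \<in> A" "w \<in> kahler_forms A"
  shows "form_pullback \<phi> (form_smult c w) = \<phi> c * form_pullback \<phi> w"
proof -
  have "form_pullback \<phi> (form_smult c w)
      = (\<Sum>b\<in>Poly_Mapping.keys w. \<phi> (Poly_Mapping.lookup (form_smult c w) b) * fps_deriv (\<phi> b))"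
    by (rule form_pullback_superset) (auto simp: in_keys_iff lookup_form_smult)
  then show ?thesis unfolding form_pullback_def
    by (simp add: lookup_form_smult hom_mult assms kahler_forms_lookup sum_distrib_left mult.assoc)
qed

lemma form_pullback_single: "form_pullback \<phi> (Poly_Mapping.single b c) = \<phi> c * fps_deriv (\<phi> b)"
  by (subst form_pullback_superset[of "{b}"]) auto

text \<open>The derivative of power series is additive, satisfies the Leibniz rule and kills
  constants; so the pullback is well defined on Kaehler differentials although forms are handled
  through representatives.\<close>

lemma form_pullback_relation:
  "w \<in> kahler_relations \<iota> A \<Longrightarrow> form_pullback \<phi> w = 0"
proof (induction rule: kahler_relations.induct)
  case (d_add a b)
  then show ?case
    by (simp add: form_pullback_diff form_pullback_single kahler_forms_diff kahler_forms_single
        add_in one_in hom_add hom_one)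
next
  case (d_mult a b)
  then have "form_pullback \<phi> (Poly_Mapping.single (a * b) 1 - Poly_Mapping.single b a - Poly_Mapping.single a b)
      = fps_deriv (\<phi> a * \<phi> b) - \<phi> a * fps_deriv (\<phi> b) - \<phi> b * fps_deriv (\<phi> a)"
    by (simp add: form_pullback_diff form_pullback_single kahler_forms_diff kahler_forms_single
        mult_in one_in hom_mult hom_one)
  then show ?case by (simp add: algebra_simps)
qed (simp_all add: form_pullback_single form_pullback_add form_pullback_smult kahler_relations_forms
    hom_one hom_const)

lemma form_pullback_proportional:
  assumes "form_eq \<iota> A w (form_smult u v)" "u \<in> A" "v \<in> kahler_forms A" "w \<in> kahler_forms A"
  shows "form_pullback \<phi> w = \<phi> u * form_pullback \<phi> v"
  using form_pullback_relation[of "w - form_smult u v"] assms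
  by (simp add: form_eq_def form_pullback_diff kahler_forms_smult form_pullback_smult)

end

section \<open>Arcs as points of the arc space\<close>

lemma jet_eval_superset:
  assumes "field_extension \<kappa>" "finite S" "Poly_Mapping.keys g \<subseteq> S"
  shows "jet_eval \<kappa> \<phi> g = (\<Sum>m\<in>S. \<kappa> (Poly_Mapping.lookup g m) *
     (\<Prod>(a, i)\<in>Poly_Mapping.keys m. (\<phi> a $ i) ^ Poly_Mapping.lookup m (a, i)))"
  unfolding jet_eval_def using assms(2,3)
  by (intro sum.mono_neutral_left) (auto simp: in_keys_iff field_extensionD[OF assms(1)])

lemma jet_eval_add:
  assumes "field_extension \<kappa>"
  shows "jet_eval \<kappa> \<phi> (g + h) = jet_eval \<kappa> \<phi> g + jet_eval \<kappa> \<phi> h"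
proof -
  let ?S = "Poly_Mapping.keys g \<union> Poly_Mapping.keys h"
  have "Poly_Mapping.keys (g + h) \<subseteq> ?S" by (rule keys_add)
  then show ?thesis
    by (simp add: jet_eval_superset[OF assms, of ?S] lookup_add field_extensionD[OF assms]
        distrib_right sum.distrib)
qed

lemma jet_eval_sum:
  assumes "field_extension \<kappa>"
  shows "jet_eval \<kappa> \<phi> (sum g I) = (\<Sum>i\<in>I. jet_eval \<kappa> \<phi> (g i))"
proof -
  have "jet_eval \<kappa> \<phi> 0 = 0" by (simp add: jet_eval_def)
  then show ?thesis
    by (induction I rule: infinite_finite_induct) (simp_all add: jet_eval_add[OF assms])
qed

text \<open>Terms of this shape make up the coefficients of the universal pullback of a form, the
  factor \<open>of_nat n\<close> coming from \<open>fps_deriv\<close>.\<close>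

lemma jet_eval_var_mult:
  fixes \<kappa> :: "complex \<Rightarrow> 'k::field"
  assumes "field_extension \<kappa>"
  shows "jet_eval \<kappa> \<phi> (jet_var a i * (of_nat n * jet_var b j)) = \<phi> a $ i * (of_nat n * \<phi> b $ j)"
proof -
  have \<kappa>n: "\<kappa> (of_nat n) = of_nat n" by (induction n) (auto simp: field_extensionD[OF assms])
  let ?m = "Poly_Mapping.single (a, i) 1 + Poly_Mapping.single (b, j) (1::nat)"
  have "jet_var a i * (of_nat n * jet_var b j) = Poly_Mapping.single ?m (of_nat n)"
    by (simp add: jet_var_def mult_single flip: single_of_nat)
  moreover have "(\<Prod>x\<in>Poly_Mapping.keys ?m. case x of (a, i) \<Rightarrow> (\<phi> a $ i) ^ Poly_Mapping.lookup ?m (a, i))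
      = (\<Prod>x\<in>{(a, i), (b, j)}. case x of (a, i) \<Rightarrow> (\<phi> a $ i) ^ Poly_Mapping.lookup ?m (a, i))"
    by (intro prod.mono_neutral_left)
      (auto simp: in_keys_iff lookup_add lookup_single when_def split: if_splits)
  \<comment> \<open>The two variables may coincide; then there is one key with exponent 2 instead of
    two with exponent 1.\<close>
  moreover have "\<dots> = \<phi> a $ i * \<phi> b $ j"
    by (cases "(a, i) = (b, j)") (auto simp: lookup_add lookup_single when_def power2_eq_square numeral_2_eq_2)
  ultimately show ?thesis
    by (simp add: jet_eval_superset[OF assms, of "{?m}"] \<kappa>n mult.left_commute)
qed

lemma jet_eval_form_pullback:
  assumes "field_extension \<kappa>"
  shows "jet_eval \<kappa> \<phi> (form_pullback universal_arc w $ n) = form_pullback \<phi> w $ n"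
  unfolding form_pullback_def universal_arc_def fps_sum_nth fps_mult_nth fps_deriv_nth fps_nth_Abs_fps
    jet_eval_sum[OF assms]
  by (simp only: jet_eval_var_mult[OF assms])

text \<open>The prime of \<open>arc_point\<close> is the kernel of evaluation at the arc, so the
  tangency equations lie in it exactly when the coefficients of the pulled back form vanish.\<close>

lemma tangential_points_arc:
  assumes "field_extension \<kappa>" "\<gamma> \<in> arcs \<iota> \<kappa> W" "arc_point \<kappa> \<gamma> \<in> tangential_points \<iota> W G Z"
  shows "\<gamma> \<in> tangential_arcs \<iota> \<kappa> W G Z"
proof -
  obtain p \<phi> where \<gamma>: "\<gamma> = (p, \<phi>)" by (cases \<gamma>)
  have "p \<in> Z" and *: "\<And>w n. w \<in> local_generators G p \<Longrightarrow> jet_eval \<kappa> \<phi> (form_pullback universal_arc w $ n) = 0"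
    using assms(3) unfolding \<gamma> arc_point_def tangential_points_def by auto
  then have "form_pullback \<phi> w = 0" if "w \<in> local_generators G p" for w
    using that by (intro fps_ext) (simp flip: jet_eval_form_pullback[OF assms(1)])
  then show ?thesis using assms(2) \<open>p \<in> Z\<close> by (simp add: \<gamma> tangential_arcs_def)
qed

section \<open>Components\<close>

text \<open>Zorn's lemma applies because the union of a chain of irreducible sets is
  irreducible.\<close>

lemma irreducible_in_component:
  assumes "irreducible_in X S" "S \<subseteq> D"
  obtains E where "E \<in> irreducible_components X D" "S \<subseteq> E"
proof -
  let ?Z = "{T. S \<subseteq> T \<and> T \<subseteq> D \<and> irreducible_in X T}"
  have "\<exists>M\<in>?Z. \<forall>T\<in>?Z. M \<subseteq> T \<longrightarrow> T = M"
  proof (rule subset_Zorn_nonempty)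
    show "?Z \<noteq> {}" using assms by blast
    fix \<C> assume ne: "\<C> \<noteq> {}" and ch: "subset.chain ?Z \<C>"
    then have sub: "\<C> \<subseteq> ?Z" and tot: "\<And>T U. T \<in> \<C> \<Longrightarrow> U \<in> \<C> \<Longrightarrow> T \<subseteq> U \<or> U \<subseteq> T"
      by (auto simp: subset_chain_def)
    have "irreducible_in X (\<Union>\<C>)" unfolding irreducible_in_def
    proof (intro conjI allI impI)
      obtain T0 where "T0 \<in> \<C>" using ne by blast
      then show "\<Union>\<C> \<noteq> {}" using sub unfolding irreducible_in_def by blast
      show "\<Union>\<C> \<subseteq> topspace X" using sub unfolding irreducible_in_def by blast
      fix C1 C2 assume *: "closedin X C1 \<and> closedin X C2 \<and> \<Union>\<C> \<subseteq> C1 \<union> C2"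
      then have "T \<subseteq> C1 \<or> T \<subseteq> C2" if "T \<in> \<C>" for T
        using sub that unfolding irreducible_in_def by blast
      \<comment> \<open>If one member of the chain were not inside \<open>C1\<close> and another not
        inside \<open>C2\<close>, the larger of them would be inside neither.\<close>
      then show "\<Union>\<C> \<subseteq> C1 \<or> \<Union>\<C> \<subseteq> C2" using tot by (metis Sup_least order_trans)
    qed
    then show "\<Union>\<C> \<in> ?Z" using sub ne by blast
  qed
  then obtain M where M: "M \<in> ?Z" "\<forall>T\<in>?Z. M \<subseteq> T \<longrightarrow> T = M" by (rule bexE)
  then have "M \<in> irreducible_components X D" unfolding irreducible_components_def by blast
  then show thesis using that M by blast
qed

text \<open>The closure of an irreducible set is irreducible, and it stays inside the closed set
  \<open>D\<close>; maximality then gives equality.\<close>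

lemma closedin_irreducible_component:
  assumes E: "E \<in> irreducible_components X D" and D: "closedin X D"
  shows "closedin X E"
proof -
  have irr: "irreducible_in X E" and ED: "E \<subseteq> D"
    and mx: "\<And>E'. E' \<subseteq> D \<Longrightarrow> irreducible_in X E' \<Longrightarrow> E \<subseteq> E' \<Longrightarrow> E' = E"
    using E unfolding irreducible_components_def by blast+
  have sub: "E \<subseteq> X closure_of E" using irr by (simp add: irreducible_in_def closure_of_subset)
  have "irreducible_in X (X closure_of E)" unfolding irreducible_in_def
  proof (intro conjI allI impI closure_of_subset_topspace)
    show "X closure_of E \<noteq> {}" using sub irr unfolding irreducible_in_def by blast
    fix C1 C2 assume *: "closedin X C1 \<and> closedin X C2 \<and> X closure_of E \<subseteq> C1 \<union> C2"
    then have "E \<subseteq> C1 \<or> E \<subseteq> C2" using irr sub unfolding irreducible_in_def by blast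
    then show "X closure_of E \<subseteq> C1 \<or> X closure_of E \<subseteq> C2" using * closure_of_minimal by metis
  qed
  moreover have "X closure_of E \<subseteq> D" by (rule closure_of_minimal[OF ED D])
  ultimately have "X closure_of E = E" using mx sub by blast
  then show ?thesis by (metis closedin_closure_of)
qed

section \<open>Formal power series in three variables\<close>

lemma max_ideal_pow3_mult:
  assumes "h \<in> max_ideal_pow3 n" shows "g * h \<in> max_ideal_pow3 n"
proof -
  have "(g * h) $ i $ j $ k = (\<Sum>i'=0..i. \<Sum>j'=0..j. \<Sum>k'=0..k.
      g $ i' $ j' $ k' * h $ (i - i') $ (j - j') $ (k - k'))" for i j k
    by (simp add: fps_mult_nth fps_sum_nth)
  moreover have "(i - i') + (j - j') + (k - k') \<le> i + j + k" for i i' j j' k k' :: nat by linarith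
  ultimately show ?thesis using assms unfolding max_ideal_pow3_def
    by (auto intro!: sum.neutral)
qed

lemma max_ideal_pow3_add:
  "g \<in> max_ideal_pow3 n \<Longrightarrow> h \<in> max_ideal_pow3 n \<Longrightarrow> g + h \<in> max_ideal_pow3 n"
  and max_ideal_pow3_diff:
  "g \<in> max_ideal_pow3 n \<Longrightarrow> h \<in> max_ideal_pow3 n \<Longrightarrow> g - h \<in> max_ideal_pow3 n"
  by (auto simp: max_ideal_pow3_def)

lemma max_ideal_pow3_mono: "m \<le> n \<Longrightarrow> h \<in> max_ideal_pow3 n \<Longrightarrow> h \<in> max_ideal_pow3 m"
  by (auto simp: max_ideal_pow3_def)

text \<open>A derivation of the coefficient ring acts coefficientwise as a derivation of the series.
  One and two applications to \<open>fps_deriv\<close> give the partial derivatives in the inner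
  variables.\<close>

lemma fps_map_derivation:
  fixes D :: "'a::comm_ring_1 \<Rightarrow> 'a"
  assumes add: "\<And>a b. D (a + b) = D a + D b" and mult: "\<And>a b. D (a * b) = a * D b + D a * b"
  shows "Abs_fps (\<lambda>i. D ((g + h) $ i)) = Abs_fps (\<lambda>i. D (g $ i)) + Abs_fps (\<lambda>i. D (h $ i))"
    and "Abs_fps (\<lambda>i. D ((g * h) $ i)) = g * Abs_fps (\<lambda>i. D (h $ i)) + Abs_fps (\<lambda>i. D (g $ i)) * h"
proof -
  have "D 0 + D 0 = D 0" using add[of 0 0] by simp
  then have D0: "D 0 = 0" by (metis add_cancel_right_right)
  have "D (sum g I) = (\<Sum>i\<in>I. D (g i))" for g :: "nat \<Rightarrow> 'a" and I
    by (induction I rule: infinite_finite_induct) (simp_all add: D0 add)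
  then show "Abs_fps (\<lambda>i. D ((g * h) $ i)) = g * Abs_fps (\<lambda>i. D (h $ i)) + Abs_fps (\<lambda>i. D (g $ i)) * h"
    by (intro fps_ext) (simp add: fps_mult_nth mult sum.distrib)
qed (intro fps_ext, simp add: add)

lemma partial3_add: "partial3 k (g + h) = partial3 k g + partial3 k h"
  and partial3_mult: "partial3 k (g * h) = g * partial3 k h + partial3 k g * h"
proof -
  note d1 = fps_map_derivation[where D = fps_deriv, OF fps_deriv_add fps_deriv_mult]
  note d2 = fps_map_derivation[where D = "\<lambda>h. Abs_fps (\<lambda>j. fps_deriv (h $ j))",
      OF fps_map_derivation[where D = fps_deriv, OF fps_deriv_add fps_deriv_mult]]
  show "partial3 k (g + h) = partial3 k g + partial3 k h"
    unfolding partial3_def using d1(1)[of g h] d2(1)[of g h] by simp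
  show "partial3 k (g * h) = g * partial3 k h + partial3 k g * h"
    unfolding partial3_def using d1(2)[of g h] d2(2)[of g h] by simp
qed

lemma partial3_const: "partial3 k (const3 c) = 0"
  by (auto simp: partial3_def const3_def fps_eq_iff)

lemma partial3_coord:
  "j \<in> {1..3} \<Longrightarrow> k \<in> {1..3} \<Longrightarrow> partial3 k (coord3 j) = (if k = j then 1 else 0)"
  by (auto simp: partial3_def coord3_def fps_eq_iff fps_X_def)

section \<open>Expansion along the coordinates and the logarithmic derivative\<close>

lemma fps_split:
  fixes h :: "'a::comm_ring_1 fps"
  shows "h = fps_const (h $ 0) + fps_X * fps_shift 1 h"
  by (rule fps_ext) (simp add: fps_X_mult_nth)

text \<open>The first variable is split off \<open>h\<close>, the second off what is left at
  \<open>x\<^sub>1 = 0\<close>, the third off what is left at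
  \<open>x\<^sub>1 = x\<^sub>2 = 0\<close>. It replaces Taylor expansion in the proof of the chain
  rule.\<close>

lemma fps3_decomp:
  "\<exists>F. h = const3 (h $ 0 $ 0 $ 0) + (\<Sum>k=1..3. coord3 k * F k)"
proof -
  define F where "F k = (if k = 1 then fps_shift 1 h else if k = 2 then fps_const (fps_shift 1 (h $ 0))
      else fps_const (fps_const (fps_shift 1 (h $ 0 $ 0))))" for k :: nat
  have s: "sum G {1..3} = G 1 + G 2 + G 3" for G :: "nat \<Rightarrow> fps3"
    by (simp add: numeral_3_eq_3 numeral_2_eq_2)
  have "h = fps_const (h $ 0) + fps_X * fps_shift 1 h" by (rule fps_split)
  also have "fps_const (h $ 0) = fps_const (fps_const (h $ 0 $ 0)) + coord3 2 * F 2"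
    by (subst fps_split[of "h $ 0"]) (simp add: F_def coord3_def)
  also have "fps_const (fps_const (h $ 0 $ 0)) = const3 (h $ 0 $ 0 $ 0) + coord3 3 * F 3"
    by (subst fps_split[of "h $ 0 $ 0"]) (simp add: F_def coord3_def const3_def)
  also have "fps_X * fps_shift 1 h = coord3 1 * F 1" by (simp add: F_def coord3_def)
  finally have "h = const3 (h $ 0 $ 0 $ 0) + (\<Sum>k=1..3. coord3 k * F k)"
    unfolding s by (simp add: algebra_simps)
  then show ?thesis by blast
qed

text \<open>Write \<open>x\<close> as a power of \<open>t\<close> times a unit \<open>y\<close>:
  then \<open>t x' / x\<close> is the order of \<open>x\<close> plus \<open>t y' / y\<close>. This
  is the statement that \<open>dx / x\<close> has residue the order of \<open>x\<close>.\<close>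

lemma fps_log_derivative:
  fixes x :: "'a::field fps"
  assumes "x \<noteq> 0"
  obtains v where "fps_X * fps_deriv x = x * (fps_const (of_nat (subdegree x)) + fps_X * v)"
proof -
  let ?n = "subdegree x" and ?y = "unit_factor x"
  have x: "x = fps_X ^ ?n * ?y" using fps_unit_factor_decompose[of x]
    by (simp add: subdegree_decompose' mult.commute)
  have y: "?y $ 0 \<noteq> 0" using assms by simp
  \<comment> \<open>For order 0 the exponent \<open>?n - 1\<close> is truncated to 0, but the factor
    \<open>of_nat ?n\<close> vanishes.\<close>
  have X: "fps_const (of_nat ?n) * (fps_X * fps_X ^ (?n - 1)) = fps_const (of_nat ?n) * (fps_X :: 'a fps) ^ ?n"
    by (cases ?n) simp_all
  have "fps_deriv x = fps_const (of_nat ?n) * fps_X ^ (?n - 1) * ?y + fps_X ^ ?n * fps_deriv ?y"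
    by (subst x) (simp add: fps_deriv_power)
  then have "fps_X * fps_deriv x = fps_const (of_nat ?n) * (fps_X * fps_X ^ (?n - 1)) * ?y
      + fps_X ^ ?n * fps_X * fps_deriv ?y"
    by (simp add: algebra_simps)
  also have "\<dots> = fps_X ^ ?n * (?y * fps_const (of_nat ?n) + fps_X * fps_deriv ?y)"
    unfolding X by (simp add: algebra_simps)
  also have "fps_deriv ?y = ?y * (inverse ?y * fps_deriv ?y)"
    using inverse_mult_eq_1'[OF y] by (simp add: mult.assoc[symmetric])
  also have "fps_X ^ ?n * (?y * fps_const (of_nat ?n) + fps_X * (?y * (inverse ?y * fps_deriv ?y)))
    = (fps_X ^ ?n * ?y) * (fps_const (of_nat ?n) + fps_X * (inverse ?y * fps_deriv ?y))"
    by (simp add: algebra_simps)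
  finally show thesis unfolding x[symmetric] by (rule that)
qed

section \<open>Arcs in formal coordinates\<close>

locale formal_arc = series_hom \<iota> A "\<lambda>z. z" \<psi> for \<iota> and A :: "'f::field set" and \<psi> +
  fixes f :: "'f \<Rightarrow> fps3"
  assumes coords: "formal_coordinates \<iota> A f" and centre: "\<And>a. a \<in> nonunits A \<Longrightarrow> \<psi> a $ 0 = 0"
begin

sublocale f: algebra_hom \<iota> A const3 f
  using coords by unfold_locales (auto simp: formal_coordinates_def const3_def fps_const_neg[symmetric]
    simp del: fps_const_neg)

text \<open>A product of \<open>n\<close> non-units goes to a product of \<open>n\<close> series
  without constant term. This is the continuity that permits passing to the completion.\<close>

lemma ideal_pow_order:
  assumes "a \<in> ideal_pow A (nonunits A) n" "i < n" shows "\<psi> a $ i = 0"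
proof -
  let ?I = "{a \<in> A. \<forall>i<n. \<psi> a $ i = 0}"
  have "is_ideal A ?I" unfolding is_ideal_def
    by (auto simp: zero_in add_in mult_in hom_zero hom_add hom_mult fps_mult_nth intro!: sum.neutral)
  moreover have "prod_list xs \<in> {a \<in> A. \<forall>i<length xs. \<psi> a $ i = 0}" if "set xs \<subseteq> nonunits A" for xs
    using that
  proof (induction xs)
    case Nil then show ?case by (simp add: one_in)
  next
    case (Cons x xs)
    have x: "x \<in> A" "\<psi> x $ 0 = 0" using Cons.prems centre by (auto simp: nonunits_def)
    have xs: "prod_list xs \<in> A" "\<And>i. i < length xs \<Longrightarrow> \<psi> (prod_list xs) $ i = 0"
      using Cons by auto
    have "\<psi> (x * prod_list xs) $ i = 0" if "i < length (x # xs)" for i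
      unfolding hom_mult[OF x(1) xs(1)] fps_mult_nth
    proof (intro sum.neutral ballI)
      fix j assume "j \<in> {0..i}"
      then show "\<psi> x $ j * \<psi> (prod_list xs) $ (i - j) = 0"
        using x(2) xs(2)[of "i - j"] that by (cases "j = 0") auto
    qed
    then show ?case using mult_in[OF x(1) xs(1)] by simp
  qed
  ultimately have "ideal_pow A (nonunits A) n \<subseteq> ?I"
    unfolding ideal_pow_def by (intro ideal_gen_least) auto
  then show ?thesis using assms by blast
qed

text \<open>The continuous extension of the arc to the completion. Its coefficient at
  \<open>n\<close> is read off some ring element approximating \<open>h\<close> modulo the power
  \<open>Suc n\<close> of the maximal ideal, the lowest power that cannot affect this
  coefficient.\<close>

definition formal_ext :: "fps3 \<Rightarrow> complex fps" where
  "formal_ext h = Abs_fps (\<lambda>n. \<psi> (SOME a. a \<in> A \<and> h - f a \<in> max_ideal_pow3 (Suc n)) $ n)"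

text \<open>Independence of the approximation: two of them differ by an element whose image, hence
  by \<open>formal_coordinates\<close> which itself, lies in the \<open>Suc n\<close>-th power of
  the maximal ideal, and \<open>ideal_pow_order\<close> applies.\<close>

lemma formal_ext_nth:
  assumes "a \<in> A" "h - f a \<in> max_ideal_pow3 N" "n < N"
  shows "formal_ext h $ n = \<psi> a $ n"
proof -
  let ?P = "\<lambda>b. b \<in> A \<and> h - f b \<in> max_ideal_pow3 (Suc n)"
  define b where "b = (SOME b. ?P b)"
  have P: "?P a" using assms max_ideal_pow3_mono[of "Suc n" N] by auto
  then have b: "?P b" unfolding b_def by (rule someI)
  have "(h - f b) - (h - f a) \<in> max_ideal_pow3 (Suc n)" using P b by (blast intro: max_ideal_pow3_diff)
  then have "f (a - b) \<in> max_ideal_pow3 (Suc n)" using P b by (simp add: f.hom_diff)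
  then have "a - b \<in> ideal_pow A (nonunits A) (Suc n)"
    using coords P b diff_in unfolding formal_coordinates_def by blast
  then have "\<psi> (a - b) $ n = 0" by (rule ideal_pow_order) simp
  then show ?thesis using P b by (simp add: formal_ext_def flip: b_def) (simp add: hom_diff)
qed

lemma approx: obtains a where "a \<in> A" "h - f a \<in> max_ideal_pow3 n"
  using coords unfolding formal_coordinates_def by blast

lemma formal_ext_hom: "a \<in> A \<Longrightarrow> formal_ext (f a) = \<psi> a"
proof (rule fps_ext)
  fix n assume "a \<in> A"
  then show "formal_ext (f a) $ n = \<psi> a $ n"
    by (rule formal_ext_nth[of _ _ "Suc n"]) (auto simp: max_ideal_pow3_def)
qed

lemma formal_ext_const: "formal_ext (const3 c) = fps_const c"
  using formal_ext_hom[OF const_in, of c] by (simp add: hom_const f.hom_const)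

lemma formal_ext_zero: "formal_ext 0 = 0" and formal_ext_one: "formal_ext 1 = 1"
  using formal_ext_const[of 0] formal_ext_const[of 1] by (simp_all add: const3_def)

lemma formal_ext_add: "formal_ext (g + h) = formal_ext g + formal_ext h"
proof (rule fps_ext)
  fix n
  obtain a where a: "a \<in> A" "g - f a \<in> max_ideal_pow3 (Suc n)" by (rule approx)
  obtain b where b: "b \<in> A" "h - f b \<in> max_ideal_pow3 (Suc n)" by (rule approx)
  have "(g + h) - f (a + b) = (g - f a) + (h - f b)" using a b by (simp add: f.hom_add)
  then have "(g + h) - f (a + b) \<in> max_ideal_pow3 (Suc n)" using a b max_ideal_pow3_add by metis
  then have "formal_ext (g + h) $ n = \<psi> (a + b) $ n" using a b add_in by (intro formal_ext_nth) auto
  moreover have "formal_ext g $ n = \<psi> a $ n" "formal_ext h $ n = \<psi> b $ n"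
    using formal_ext_nth[OF a] formal_ext_nth[OF b] by simp_all
  ultimately show "formal_ext (g + h) $ n = (formal_ext g + formal_ext h) $ n"
    using a b by (simp add: hom_add)
qed

lemma formal_ext_mult: "formal_ext (g * h) = formal_ext g * formal_ext h"
proof (rule fps_ext)
  fix n
  obtain a where a: "a \<in> A" "g - f a \<in> max_ideal_pow3 (Suc n)" by (rule approx)
  obtain b where b: "b \<in> A" "h - f b \<in> max_ideal_pow3 (Suc n)" by (rule approx)
  have "(g * h) - f (a * b) = g * (h - f b) + f b * (g - f a)"
    using a b by (simp add: f.hom_mult algebra_simps)
  then have "(g * h) - f (a * b) \<in> max_ideal_pow3 (Suc n)"
    using a b max_ideal_pow3_add max_ideal_pow3_mult by metis
  then have "formal_ext (g * h) $ n = \<psi> (a * b) $ n" using a b mult_in by (intro formal_ext_nth) auto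
  also have "\<dots> = (\<Sum>i=0..n. \<psi> a $ i * \<psi> b $ (n - i))" using a b by (simp add: hom_mult fps_mult_nth)
  also have "\<dots> = (\<Sum>i=0..n. formal_ext g $ i * formal_ext h $ (n - i))"
    using formal_ext_nth[OF a] formal_ext_nth[OF b] by (intro sum.cong) auto
  finally show "formal_ext (g * h) $ n = (formal_ext g * formal_ext h) $ n" by (simp add: fps_mult_nth)
qed

lemma formal_ext_sum: "formal_ext (sum g I) = (\<Sum>i\<in>I. formal_ext (g i))"
  by (induction I rule: infinite_finite_induct) (simp_all add: formal_ext_zero formal_ext_add)

lemma formal_ext_prod: "formal_ext (prod g I) = (\<Prod>i\<in>I. formal_ext (g i))"
  by (induction I rule: infinite_finite_induct) (simp_all add: formal_ext_one formal_ext_mult)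

lemma formal_ext_coord: "formal_ext (coord3 k) $ 0 = 0"
proof -
  have "coord3 k \<in> max_ideal_pow3 1"
    by (auto simp: max_ideal_pow3_def coord3_def)
  then have "formal_ext (coord3 k) $ 0 = \<psi> 0 $ 0"
    by (intro formal_ext_nth[of _ _ 1]) (auto simp: zero_in f.hom_zero)
  then show ?thesis by (simp add: hom_zero)
qed

text \<open>The defect \<open>E\<close> of the chain rule is a derivation which kills constants and coordinates;
  as each series is a constant plus a combination of the coordinates, \<open>E\<close> is divisible by all
  powers of \<open>t\<close>.\<close>

lemma formal_chain_rule:
  "fps_deriv (formal_ext h) = (\<Sum>k=1..3. formal_ext (partial3 k h) * fps_deriv (formal_ext (coord3 k)))"
proof -
  define E where "E h = fps_deriv (formal_ext h)
    - (\<Sum>k=1..3. formal_ext (partial3 k h) * fps_deriv (formal_ext (coord3 k)))" for h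
  have E_add: "E (g + h) = E g + E h" for g h
    by (simp add: E_def formal_ext_add partial3_add distrib_right sum.distrib)
  have E_mult: "E (g * h) = formal_ext g * E h + formal_ext h * E g" for g h
    by (simp add: E_def formal_ext_mult formal_ext_add partial3_mult algebra_simps sum.distrib sum_distrib_left)
  have E_const: "E (const3 c) = 0" for c
    by (simp add: E_def formal_ext_const partial3_const formal_ext_zero)
  have E_sum: "E (sum g I) = (\<Sum>i\<in>I. E (g i))" for g :: "nat \<Rightarrow> fps3" and I
    using E_const[of 0] by (induction I rule: infinite_finite_induct) (simp_all add: E_add const3_def)
  have E_coord: "E (coord3 j) = 0" if "j \<in> {1..3}" for j
  proof -
    have "(\<Sum>k=1..3. formal_ext (partial3 k (coord3 j)) * fps_deriv (formal_ext (coord3 k)))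
        = (\<Sum>k=1..3. if k = j then fps_deriv (formal_ext (coord3 j)) else 0)"
      by (intro sum.cong refl) (simp add: partial3_coord[OF that] formal_ext_one formal_ext_zero)
    also have "\<dots> = fps_deriv (formal_ext (coord3 j))" using that by (subst sum.delta) auto
    finally show ?thesis by (simp add: E_def)
  qed
  have "E h $ m = 0" if "m < n" for h m n
    using that
  proof (induction n arbitrary: h m)
    case (Suc n)
    obtain F where F: "h = const3 (h $ 0 $ 0 $ 0) + (\<Sum>k=1..3. coord3 k * F k)"
      using fps3_decomp by blast
    have "E h = (\<Sum>k=1..3. formal_ext (coord3 k) * E (F k))"
      by (subst F) (simp add: E_add E_const E_sum E_mult E_coord)
    moreover have "(formal_ext (coord3 k) * E (F k)) $ m = 0" for k
      unfolding fps_mult_nth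
    proof (intro sum.neutral ballI)
      fix i assume "i \<in> {0..m}"
      then show "formal_ext (coord3 k) $ i * E (F k) $ (m - i) = 0"
        \<comment> \<open>For \<open>i = 0\<close> the coordinate factor vanishes; for larger
          \<open>i\<close> the other factor is a coefficient of lower index, covered by the
          induction hypothesis.\<close>
        using formal_ext_coord Suc by (cases "i = 0") auto
    qed
    ultimately show ?case by (simp add: fps_sum_nth)
  qed simp
  then have "E h = 0" by (intro fps_ext) (metis fps_zero_nth lessI)
  then show ?thesis by (simp add: E_def)
qed

text \<open>The chain rule applied to each \<open>db\<close>, with the two sums exchanged. It
  reduces tangency to the coefficients occurring in the normal form.\<close>

lemma form_pullback_formal:
  assumes "w \<in> kahler_forms A"
  shows "form_pullback \<psi> w
    = (\<Sum>k=1..3. formal_ext (formal_coeff f w k) * fps_deriv (formal_ext (coord3 k)))"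
proof -
  let ?K = "Poly_Mapping.keys w"
  have K: "b \<in> A" "Poly_Mapping.lookup w b \<in> A" if "b \<in> ?K" for b
    using assms that by (auto simp: kahler_forms_def)
  have "form_pullback \<psi> w = (\<Sum>b\<in>?K. \<Sum>k=1..3. formal_ext (f (Poly_Mapping.lookup w b) * partial3 k (f b))
      * fps_deriv (formal_ext (coord3 k)))"
    unfolding form_pullback_def
    by (intro sum.cong refl) (simp add: formal_ext_hom[symmetric] K formal_chain_rule[of "f _"]
        formal_ext_mult sum_distrib_left mult.assoc)
  then show ?thesis
    by (simp add: formal_coeff_def formal_ext_sum sum_distrib_right sum.swap[of _ ?K])
qed

section \<open>The logarithmic normal form along an arc\<close>

context
  fixes r :: nat and lam :: "nat \<Rightarrow> complex" and u :: fps3 and h :: "nat \<Rightarrow> fps3" and w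
  assumes r: "r \<in> {1..3}" and u: "u dvd 1" and w: "w \<in> kahler_forms A"
    and coeff: "\<And>k. k \<in> {1..3} \<Longrightarrow> formal_coeff f w k =
      u * (if k \<le> r then const3 (lam k) * (\<Prod>i\<in>{1..r} - {k}. coord3 i)
        else (\<Prod>i\<in>{1..r}. coord3 i) * h k)"
begin

lemma form_pullback_log_form:
  "form_pullback \<psi> w = formal_ext u *
    ((\<Sum>k=1..r. fps_const (lam k) * (\<Prod>i\<in>{1..r}-{k}. formal_ext (coord3 i)) * fps_deriv (formal_ext (coord3 k)))
     + (\<Prod>i\<in>{1..r}. formal_ext (coord3 i)) * (\<Sum>k=Suc r..3. formal_ext (h k) * fps_deriv (formal_ext (coord3 k))))"
proof -
  have "{1..3} = {1..r} \<union> {Suc r..3}" using r by auto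
  then have split: "sum g {1..3} = sum g {1..r} + sum g {Suc r..3}" for g :: "nat \<Rightarrow> complex fps"
    by (metis sum.union_disjoint finite_atLeastAtMost atLeastatMost_empty_iff disjoint_iff atLeastAtMost_iff not_less_eq_eq)
  have 1: "formal_ext (formal_coeff f w k) = formal_ext u * (fps_const (lam k) * (\<Prod>i\<in>{1..r}-{k}. formal_ext (coord3 i)))"
    if "k \<in> {1..r}" for k
    using that r by (subst coeff) (auto simp: formal_ext_mult formal_ext_const formal_ext_prod)
  have 2: "formal_ext (formal_coeff f w k) = formal_ext u * ((\<Prod>i\<in>{1..r}. formal_ext (coord3 i)) * formal_ext (h k))"
    if "k \<in> {Suc r..3}" for k
    using that r by (subst coeff) (auto simp: formal_ext_mult formal_ext_const formal_ext_prod)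
  have "(\<Sum>k=1..r. formal_ext (formal_coeff f w k) * fps_deriv (formal_ext (coord3 k)))
      = (\<Sum>k=1..r. formal_ext u * (fps_const (lam k) * (\<Prod>i\<in>{1..r}-{k}. formal_ext (coord3 i)))
          * fps_deriv (formal_ext (coord3 k)))"
    by (intro sum.cong refl) (simp only: 1)
  moreover have "(\<Sum>k=Suc r..3. formal_ext (formal_coeff f w k) * fps_deriv (formal_ext (coord3 k)))
      = (\<Sum>k=Suc r..3. formal_ext u * ((\<Prod>i\<in>{1..r}. formal_ext (coord3 i)) * formal_ext (h k))
          * fps_deriv (formal_ext (coord3 k)))"
    by (intro sum.cong refl) (simp only: 2)
  ultimately show ?thesis unfolding form_pullback_formal[OF w] split
    by (simp add: distrib_left sum_distrib_left mult.assoc)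
qed

text \<open>Power series over a field form a domain, so some \<open>x\<^sub>j(t)\<close> with
  \<open>j \<le> r\<close> vanishes. Every term then contains this series or its derivative.\<close>

lemma tangential_if_in_divisor:
  assumes "formal_ext (\<Prod>i\<in>{1..r}. coord3 i) = 0"
  shows "form_pullback \<psi> w = 0"
proof -
  have P: "(\<Prod>i\<in>{1..r}. formal_ext (coord3 i)) = 0" using assms by (simp add: formal_ext_prod)
  then obtain j where j: "j \<in> {1..r}" "formal_ext (coord3 j) = 0" by (auto simp: prod_zero_iff)
  have "fps_const (lam k) * (\<Prod>i\<in>{1..r}-{k}. formal_ext (coord3 i)) * fps_deriv (formal_ext (coord3 k)) = 0"
    for k
  proof (cases "k = j")
    case False
    then have "(\<Prod>i\<in>{1..r}-{k}. formal_ext (coord3 i)) = 0" using j by (intro prod_zero) auto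
    then show ?thesis by simp
  qed (simp add: j)
  then have "(\<Sum>k=1..r. fps_const (lam k) * (\<Prod>i\<in>{1..r}-{k}. formal_ext (coord3 i))
      * fps_deriv (formal_ext (coord3 k))) = 0" by (intro sum.neutral ballI)
  then show ?thesis unfolding form_pullback_log_form P by simp
qed

text \<open>For \<open>x\<^sub>1 \<cdots> x\<^sub>r \<noteq> 0\<close>, the pullback of the logarithmic form has residue \<open>\<Sum>\<lambda>\<^sub>i ord x\<^sub>i\<close>.\<close>

lemma in_divisor_if_tangential:
  assumes tang: "form_pullback \<psi> w = 0"
    and lam: "\<And>a :: nat \<Rightarrow> nat. \<exists>i\<in>{1..r}. a i \<noteq> 0 \<Longrightarrow> (\<Sum>i\<in>{1..r}. of_nat (a i) * lam i) \<noteq> 0"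
  shows "formal_ext (\<Prod>i\<in>{1..r}. coord3 i) = 0"
proof (rule ccontr)
  let ?x = "\<lambda>i. formal_ext (coord3 i)"
  let ?H = "\<Sum>k=Suc r..3. formal_ext (h k) * fps_deriv (?x k)"
  assume "formal_ext (\<Prod>i\<in>{1..r}. coord3 i) \<noteq> 0"
  then have P: "(\<Prod>i\<in>{1..r}. ?x i) \<noteq> 0" by (simp add: formal_ext_prod)
  then have x: "?x i \<noteq> 0" if "i \<in> {1..r}" for i using that by (auto simp: prod_zero_iff)
  have "\<exists>v. fps_X * fps_deriv (?x i) = ?x i * (fps_const (of_nat (subdegree (?x i))) + fps_X * v)"
    if "i \<in> {1..r}" for i
    using fps_log_derivative[OF x[OF that]] by metis
  then obtain v where v: "\<And>i. i \<in> {1..r} \<Longrightarrow>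
      fps_X * fps_deriv (?x i) = ?x i * (fps_const (of_nat (subdegree (?x i))) + fps_X * v i)" by metis
  obtain u' where "u * u' = 1" using u by (metis dvdE)
  then have "formal_ext u * formal_ext u' = 1" by (metis formal_ext_mult formal_ext_one)
  then have "formal_ext u \<noteq> 0" by auto
  then have 0: "(\<Sum>k=1..r. fps_const (lam k) * (\<Prod>i\<in>{1..r}-{k}. ?x i) * fps_deriv (?x k))
     + (\<Prod>i\<in>{1..r}. ?x i) * ?H = 0"
    using tang unfolding form_pullback_log_form by simp
  have summand: "fps_X * (fps_const (lam k) * (\<Prod>i\<in>{1..r}-{k}. ?x i) * fps_deriv (?x k))
      = (\<Prod>i\<in>{1..r}. ?x i) * (fps_const (lam k) * (fps_const (of_nat (subdegree (?x k))) + fps_X * v k))"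
    if k: "k \<in> {1..r}" for k
  proof -
    have "fps_X * (fps_const (lam k) * (\<Prod>i\<in>{1..r}-{k}. ?x i) * fps_deriv (?x k))
      = fps_const (lam k) * (\<Prod>i\<in>{1..r}-{k}. ?x i) * (fps_X * fps_deriv (?x k))" by (simp add: mult_ac)
    also have "\<dots> = (?x k * (\<Prod>i\<in>{1..r}-{k}. ?x i)) *
        (fps_const (lam k) * (fps_const (of_nat (subdegree (?x k))) + fps_X * v k))"
      unfolding v[OF k] by (simp add: mult_ac)
    also have "?x k * (\<Prod>i\<in>{1..r}-{k}. ?x i) = (\<Prod>i\<in>{1..r}. ?x i)"
      using k by (simp add: prod.remove)
    finally show ?thesis .
  qed
  \<comment> \<open>Multiplication by \<open>t\<close> clears the simple pole: the product of the
    \<open>x\<^sub>i(t)\<close> becomes a common factor and can be cancelled.\<close>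
  have "0 = fps_X * ((\<Sum>k=1..r. fps_const (lam k) * (\<Prod>i\<in>{1..r}-{k}. ?x i) * fps_deriv (?x k))
     + (\<Prod>i\<in>{1..r}. ?x i) * ?H)" unfolding 0 by simp
  also have "\<dots> = (\<Sum>k=1..r. fps_X * (fps_const (lam k) * (\<Prod>i\<in>{1..r}-{k}. ?x i) * fps_deriv (?x k)))
     + (\<Prod>i\<in>{1..r}. ?x i) * (fps_X * ?H)" by (simp only: distrib_left sum_distrib_left mult.left_commute)
  also have "\<dots> = (\<Prod>i\<in>{1..r}. ?x i) *
      ((\<Sum>k=1..r. fps_const (lam k) * (fps_const (of_nat (subdegree (?x k))) + fps_X * v k)) + fps_X * ?H)"
    by (simp only: summand distrib_left sum_distrib_left cong: sum.cong)
  finally have "(\<Sum>k=1..r. fps_const (lam k) * (fps_const (of_nat (subdegree (?x k))) + fps_X * v k)) + fps_X * ?H = 0"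
    using P by simp
  then have "((\<Sum>k=1..r. fps_const (lam k) * (fps_const (of_nat (subdegree (?x k))) + fps_X * v k)) + fps_X * ?H) $ 0 = 0"
    by simp
  then have "(\<Sum>k\<in>{1..r}. of_nat (subdegree (?x k)) * lam k) = 0"
    by (simp add: fps_sum_nth mult.commute)
  \<comment> \<open>The vector of orders is not zero: \<open>r\<close> is at least 1, and
    \<open>x\<^sub>1(t)\<close> has no constant term because the arc starts at the origin of the
    chart. Thus non-resonance applies.\<close>
  moreover have "subdegree (?x 1) \<noteq> 0" using x[of 1] r formal_ext_coord[of 1] by (auto simp: subdegree_eq_0_iff)
  moreover have "1 \<in> {1..r}" using r by simp
  ultimately show False using lam[of "\<lambda>i. subdegree (?x i)"] by blast
qed

end

end

section \<open>Specialising arcs to closed points\<close>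

text \<open>A unit of the local ring goes to an invertible series, whose constant term is not zero;
  hence the constant term detects non-units in both directions.\<close>

lemma arcs_series_hom:
  assumes "variety \<iota> W" "field_extension \<kappa>" "(p, \<phi>) \<in> arcs \<iota> \<kappa> W"
  shows "series_hom \<iota> p \<kappa> \<phi>" "\<And>a. a \<in> p \<Longrightarrow> a \<in> nonunits p \<longleftrightarrow> \<phi> a $ 0 = 0"
proof -
  interpret variety_loc \<iota> W by unfold_locales (rule assms)
  have pW: "p \<in> W" and hom: "alg_hom_on p \<iota> (\<lambda>c. fps_const (\<kappa> c)) \<phi>"
    and nu: "\<And>a. a \<in> nonunits p \<Longrightarrow> \<phi> a $ 0 = 0" using assms(3) by (auto simp: arcs_def)
  interpret p: subalgebra_in_field \<iota> p by (rule points(3)[OF pW])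
  show "series_hom \<iota> p \<kappa> \<phi>"
    using hom by unfold_locales
      (auto simp: field_extensionD[OF assms(2)] fps_const_neg[symmetric] simp del: fps_const_neg)
  then interpret series_hom \<iota> p \<kappa> \<phi> .
  show "a \<in> nonunits p \<longleftrightarrow> \<phi> a $ 0 = 0" if a: "a \<in> p" for a
  proof (rule iffI[OF nu], assumption, rule ccontr)
    assume *: "\<phi> a $ 0 = 0" "a \<notin> nonunits p"
    then have inv: "inverse a \<in> p" "a \<noteq> 0" using a by (auto simp: nonunits_def)
    have "\<phi> a * \<phi> (inverse a) = 1" using hom_mult[OF a inv(1)] inv(2) hom_one by simp
    then have "(\<phi> a * \<phi> (inverse a)) $ 0 = 1" by simp
    then show False using * by simp
  qed
qed

text \<open>Apply \<open>complex_specialization\<close> to the algebra of coefficients. The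
  homomorphism \<open>s\<close> evaluates the arc's centre as a complex point \<open>q\<close>;
  besides \<open>c\<close>, it must not kill the denominators of the elements of \<open>F\<close>,
  so that \<open>F\<close> survives in the smaller ring.\<close>

lemma (in variety_loc) arc_specialization:
  fixes \<kappa> :: "complex \<Rightarrow> 'k::field"
  assumes \<kappa>: "field_extension \<kappa>" and arc: "(p, \<phi>) \<in> arcs \<iota> \<kappa> W"
    and A: "affine_open \<iota> W A" "p \<in> spec_points A" and F: "finite F" "F \<subseteq> p"
    and c: "c \<in> subalgebra_gen \<kappa> {\<phi> a $ i |a i. a \<in> A}" "c \<noteq> 0"
  obtains q R s where "q \<in> spec_points A" "q \<subseteq> p" "closedin (zariski \<iota> W) {q}" "F \<subseteq> q"
    "subalgebra \<kappa> R" "alg_hom_on R \<kappa> (\<lambda>z. z) s" "s c \<noteq> 0"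
    "\<And>a i. a \<in> q \<Longrightarrow> \<phi> a $ i \<in> R" "\<And>a. a \<in> nonunits q \<Longrightarrow> s (\<phi> a $ 0) = 0"
proof -
  interpret A: subalgebra_in_field \<iota> A by unfold_locales (rule ext affine_openD(1)[OF A(1)])+
  interpret \<phi>: series_hom \<iota> p \<kappa> \<phi> by (rule arcs_series_hom[OF var \<kappa> arc])
  note nonunit = arcs_series_hom(2)[OF var \<kappa> arc]
  have Ap: "A \<subseteq> p" by (rule spec_pointsD(1)[OF ext A.sub A(2)])
  obtain S where S: "finite S" "A = subalgebra_gen \<iota> S"
    using A(1) by (auto simp: affine_open_def affine_model_def)
  obtain B where B: "countable B" "A \<subseteq> module.span (\<lambda>c x. \<iota> c * x) B" "B \<subseteq> A"
    by (rule subalgebra_gen_countable_span[OF ext countable_finite[OF S(1)]]) (simp add: S(2))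
  \<comment> \<open>Coefficients depend linearly on the function, so those of a countable spanning
    set generate all of them.\<close>
  define T where "T = (\<lambda>(b, i). \<phi> b $ i) ` (B \<times> (UNIV :: nat set))"
  have cT: "countable T" unfolding T_def using B(1) by simp
  let ?G = "subalgebra_gen \<kappa> T"
  interpret G: subalgebra_in_field \<kappa> ?G by unfold_locales (rule \<kappa> subalgebra_subalgebra_gen)+
  have coeff: "\<phi> a $ i \<in> ?G" if "a \<in> A" for a i
  proof -
    interpret vector_space "\<lambda>c x. \<iota> c * x" by (rule vector_space_extension[OF ext])
    have "a \<in> span B" using that B(2) by blast
    then have "a \<in> p \<and> (\<forall>i. \<phi> a $ i \<in> ?G)"
    proof (induction rule: span_induct_alt)
      case base then show ?case by (simp add: \<phi>.zero_in \<phi>.hom_zero G.zero_in)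
    next
      case (step c x y)
      have x: "x \<in> p" using step(1) B(3) Ap by blast
      have xG: "\<phi> x $ i \<in> ?G" for i
        using subset_subalgebra_gen[of T \<kappa>] step(1) unfolding T_def by blast
      have "\<phi> (\<iota> c * x + y) $ i = \<kappa> c * \<phi> x $ i + \<phi> y $ i" for i
        using x step(2) by (simp add: \<phi>.hom_add \<phi>.hom_mult \<phi>.mult_in \<phi>.const_in \<phi>.hom_const)
      then show ?case using x xG step(2)
        by (auto intro: \<phi>.add_in \<phi>.mult_in \<phi>.const_in G.add_in G.mult_in G.const_in)
    qed
    then show ?thesis by blast
  qed
  then have "{\<phi> a $ i |a i. a \<in> A} \<subseteq> ?G" by blast
  then have cG: "c \<in> ?G" using c(1) subalgebra_gen_least[OF G.sub] by (meson subsetD)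
  have "\<exists>a b. a \<in> A \<and> b \<in> A \<and> b \<notin> nonunits p \<and> x = a / b" if "x \<in> F" for x
    using spec_pointsE[OF ext A.sub A(2), of x] that F(2) by blast
  then obtain num den where nd: "\<And>x. x \<in> F \<Longrightarrow> num x \<in> A \<and> den x \<in> A \<and> den x \<notin> nonunits p \<and> x = num x / den x"
    by metis
  let ?d = "\<Prod>x\<in>F. \<phi> (den x) $ 0"
  have d0: "\<phi> (den x) $ 0 \<noteq> 0" "\<phi> (den x) $ 0 \<in> ?G" if "x \<in> F" for x
    using nd[OF that] nonunit Ap coeff by auto
  have dG: "?d \<in> ?G" using d0 by (intro G.prod_in)
  have "c * ?d \<in> ?G" "c * ?d \<noteq> 0" using cG dG c(2) d0 F(1) by (auto intro: G.mult_in)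
  then obtain R s where R: "subalgebra \<kappa> R" "T \<subseteq> R" "alg_hom_on R \<kappa> (\<lambda>z. z) s" "s (c * ?d) \<noteq> 0"
    and inv: "\<And>r. r \<in> R \<Longrightarrow> s r \<noteq> 0 \<Longrightarrow> inverse r \<in> R"
    by (rule complex_specialization[OF \<kappa> cT]) blast
  interpret s: algebra_hom \<kappa> R "\<lambda>z. z" s by unfold_locales (use \<kappa> R in auto)
  have GR: "?G \<subseteq> R" by (rule subalgebra_gen_least[OF R(1,2)])
  have sc: "s c \<noteq> 0" "s ?d \<noteq> 0"
    using R(4) s.hom_mult[OF subsetD[OF GR cG] subsetD[OF GR dG]] by auto
  have "s ?d = (\<Prod>x\<in>F. s (\<phi> (den x) $ 0))" using d0(2) GR by (intro s.hom_prod) blast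
  then have sd: "s (\<phi> (den x) $ 0) \<noteq> 0" if "x \<in> F" for x using sc(2) that F(1) by auto
  \<comment> \<open>The ideal on the chart of the specialised centre. Functions outside it are units
    at \<open>p\<close>, which gives the inclusion of \<open>q\<close> in \<open>p\<close>.\<close>
  define m where "m = {a \<in> A. s (\<phi> a $ 0) = 0}"
  have cR: "\<phi> a $ i \<in> R" if "a \<in> A" for a i using coeff[OF that] GR by blast
  have s_add: "s (\<phi> (a + b) $ 0) = s (\<phi> a $ 0) + s (\<phi> b $ 0)"
    and s_mult: "s (\<phi> (a * b) $ 0) = s (\<phi> a $ 0) * s (\<phi> b $ 0)" if "a \<in> A" "b \<in> A" for a b
    using that Ap cR by (auto simp: \<phi>.hom_add \<phi>.hom_mult s.hom_add s.hom_mult subset_iff)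
  have m: "is_prime_ideal A m" unfolding is_prime_ideal_def is_ideal_def
    by (auto simp: m_def A.zero_in A.one_in A.add_in A.mult_in s_add s_mult \<phi>.hom_zero \<phi>.hom_one
        s.hom_zero s.hom_one)
  define q where "q = localization A m"
  have q: "q \<in> spec_points A" using m unfolding q_def spec_points_def by blast
  have qW: "q \<in> W" using q affine_openD(2)[OF A(1)] by blast
  interpret q: subalgebra_in_field \<iota> q by (rule points(3)[OF qW])
  have unit: "b \<notin> nonunits p" if "b \<in> A" "b \<notin> m" for b
  proof
    assume "b \<in> nonunits p"
    then have "\<phi> b $ 0 = 0" using nonunit that Ap by blast
    then show False using that by (simp add: m_def s.hom_zero)
  qed
  have qp: "q \<subseteq> p"
  proof
    fix x assume "x \<in> q"
    then obtain a b where ab: "a \<in> A" "b \<in> A" "b \<notin> m" "x = a / b" unfolding q_def localization_def by blast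
    have "b \<in> p" using ab Ap by blast
    then have "inverse b \<in> p" using unit[OF ab(2,3)] by (auto simp: nonunits_def)
    then show "x \<in> p" using ab Ap by (auto simp: divide_inverse intro: \<phi>.mult_in)
  qed
  have m0: "0 \<in> m" using m by (auto simp: is_prime_ideal_def is_ideal_def)
  \<comment> \<open>Elements of \<open>q\<close> are fractions. Dividing power series recursively
    inverts only the constant term of the denominator, and \<open>s\<close> does not kill it, so its
    inverse is in \<open>R\<close>.\<close>
  have qR: "\<phi> x $ i \<in> R" if x: "x \<in> q" for x i
  proof -
    obtain a b where ab: "a \<in> A" "b \<in> A" "b \<notin> m" "x = a / b"
      using x unfolding q_def localization_def by blast
    have b: "s (\<phi> b $ 0) \<noteq> 0" "b \<noteq> 0" using ab m0 by (auto simp: m_def)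
    then have b': "\<phi> b $ 0 \<noteq> 0" by (auto simp: s.hom_zero)
    have "\<phi> a = \<phi> x * \<phi> b" using \<phi>.hom_mult[of x b] ab b x qp Ap by auto
    then have "\<phi> a $ i = (\<Sum>j<i. \<phi> x $ j * \<phi> b $ (i - j)) + \<phi> x $ i * \<phi> b $ 0" for i
      by (simp add: fps_mult_nth atLeast0AtMost lessThan_Suc_atMost[symmetric])
    then have eq: "\<phi> x $ i = inverse (\<phi> b $ 0) * (\<phi> a $ i - (\<Sum>j<i. \<phi> x $ j * \<phi> b $ (i - j)))" for i
      using b' by (simp add: field_simps)
    show ?thesis
    proof (induction i rule: less_induct)
      case (less i)
      have "(\<Sum>j<i. \<phi> x $ j * \<phi> b $ (i - j)) \<in> R"
        using less cR[OF ab(2)] by (intro s.sum_in s.mult_in) auto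
      then show ?case unfolding eq[of i]
        by (intro s.mult_in s.diff_in inv cR ab b)
    qed
  qed
  have sq_mult: "s (\<phi> (x * y) $ 0) = s (\<phi> x $ 0) * s (\<phi> y $ 0)" if "x \<in> q" "y \<in> q" for x y
    using that qp qR by (simp add: \<phi>.hom_mult s.hom_mult subset_iff)
  have nq: "s (\<phi> x $ 0) = 0" if x: "x \<in> nonunits q" for x
  proof -
    obtain a b where ab: "a \<in> m" "b \<in> A" "b \<notin> m" "x = a / b"
      using x A.nonunits_localization[OF m] unfolding q_def by blast
    have "b \<noteq> 0" using ab m0 by auto
    moreover have "b \<in> q" using ab A.subset_localization[OF m] by (auto simp: q_def)
    ultimately have "s (\<phi> a $ 0) = s (\<phi> x $ 0) * s (\<phi> b $ 0)"
      using sq_mult[of x b] x ab by (simp add: nonunits_def)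
    then show ?thesis using ab by (auto simp: m_def)
  qed
  \<comment> \<open>The residue field of \<open>q\<close> is the complex field: were
    \<open>x\<close> minus its value a unit of \<open>q\<close>, the value 0 would be invertible.
    This makes \<open>q\<close> a closed point.\<close>
  have res: "\<exists>z. x - \<iota> z \<in> nonunits q" if x: "x \<in> q" for x
  proof (intro exI[of _ "s (\<phi> x $ 0)"], rule ccontr)
    let ?y = "x - \<iota> (s (\<phi> x $ 0))"
    assume "?y \<notin> nonunits q"
    have y: "?y \<in> q" using x by (intro q.diff_in q.const_in)
    then have i: "inverse ?y \<in> q" "?y \<noteq> 0" using \<open>?y \<notin> nonunits q\<close> by (auto simp: nonunits_def)
    have "\<phi> ?y $ 0 = \<phi> x $ 0 - \<kappa> (s (\<phi> x $ 0))"
      using x qp by (simp add: \<phi>.hom_diff \<phi>.const_in \<phi>.hom_const subset_iff)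
    then have "s (\<phi> ?y $ 0) = 0" using qR[OF x] by (simp add: s.hom_diff s.const_in s.hom_const)
    moreover have "s (\<phi> ?y $ 0) * s (\<phi> (inverse ?y) $ 0) = 1"
      using sq_mult[OF y i(1)] i(2) by (simp add: \<phi>.hom_one s.hom_one)
    ultimately show False by simp
  qed
  have "F \<subseteq> q"
  proof
    fix x assume x: "x \<in> F"
    then have "den x \<notin> m" using sd by (auto simp: m_def)
    then show "x \<in> q" using nd[OF x] unfolding q_def localization_def by blast
  qed
  then show thesis
    using that[OF q qp closed_rational_point[OF qW res] _ R(1,3) sc(1) qR nq] by blast
qed

text \<open>Each coefficient of a product or derivative of series is a finite expression in
  coefficients of the factors, so applying \<open>s\<close> coefficientwise commutes with these
  operations.\<close>

lemma specialized_series_hom: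
  assumes \<phi>: "series_hom \<iota> p \<kappa> \<phi>" and q: "subalgebra_in_field \<iota> q" "q \<subseteq> p"
    and R: "field_extension \<kappa>" "subalgebra \<kappa> R" "alg_hom_on R \<kappa> (\<lambda>z. z) s"
    and coeff: "\<And>a i. a \<in> q \<Longrightarrow> \<phi> a $ i \<in> R"
  defines "\<psi> \<equiv> \<lambda>a. Abs_fps (\<lambda>i. s (\<phi> a $ i))"
  shows "series_hom \<iota> q (\<lambda>z. z) \<psi>"
    and "w \<in> kahler_forms q \<Longrightarrow> form_pullback \<psi> w $ n = s (form_pullback \<phi> w $ n)"
proof -
  interpret \<phi>: series_hom \<iota> p \<kappa> \<phi> by (rule \<phi>)
  interpret q: subalgebra_in_field \<iota> q by (rule q)
  interpret s: algebra_hom \<kappa> R "\<lambda>z. z" s by unfold_locales (use R in auto)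
  have "alg_hom_on q \<iota> fps_const \<psi>" unfolding alg_hom_on_def
  proof (intro conjI ballI allI)
    fix a b assume ab: "a \<in> q" "b \<in> q"
    then have p: "a \<in> p" "b \<in> p" using q(2) by auto
    show "\<psi> (a + b) = \<psi> a + \<psi> b"
      by (rule fps_ext) (simp add: \<psi>_def \<phi>.hom_add p s.hom_add coeff ab)
    show "\<psi> (a * b) = \<psi> a * \<psi> b"
      by (rule fps_ext) (simp add: \<psi>_def \<phi>.hom_mult p fps_mult_nth s.hom_sum s.hom_mult s.mult_in coeff ab)
  next
    fix c show "\<psi> (\<iota> c) = fps_const c"
      by (rule fps_ext) (simp add: \<psi>_def \<phi>.hom_const s.hom_const s.hom_zero)
  qed
  then show "series_hom \<iota> q (\<lambda>z. z) \<psi>"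
    by unfold_locales (auto simp: fps_const_neg[symmetric] simp del: fps_const_neg)
  assume w: "w \<in> kahler_forms q"
  have K: "b \<in> q" "Poly_Mapping.lookup w b \<in> q" if "b \<in> Poly_Mapping.keys w" for b
    using w that by (auto simp: kahler_forms_def)
  show "form_pullback \<psi> w $ n = s (form_pullback \<phi> w $ n)"
    unfolding form_pullback_def fps_sum_nth fps_mult_nth fps_deriv_nth
    by (simp add: \<psi>_def s.hom_sum s.hom_mult s.hom_of_nat s.sum_in s.mult_in s.of_nat_in K coeff
        del: of_nat_Suc of_nat_add cong: sum.cong)
qed

section \<open>Tangential arcs\<close>

locale foliated_variety = variety_loc \<iota> W for \<iota> :: "complex \<Rightarrow> 'f::field" and W +
  fixes G :: "'f foliation_data"
  assumes fol: "foliation \<iota> W G"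
begin

lemma generatorD:
  assumes "(A, w) \<in> G"
  shows "affine_open \<iota> W A" "w \<in> kahler_forms A"
  using fol assms unfolding foliation_def by blast+

lemma local_generator_form:
  assumes "w \<in> local_generators G p" shows "w \<in> kahler_forms p"
proof -
  obtain A where A: "(A, w) \<in> G" "p \<in> spec_points A" using assms by (auto simp: local_generators_def)
  have "A \<subseteq> p" by (rule spec_pointsD(1)[OF ext affine_openD(1)[OF generatorD(1)[OF A(1)]] A(2)])
  then show ?thesis using generatorD(2)[OF A(1)] by (auto simp: kahler_forms_def)
qed

lemma local_generators_mono:
  assumes "q \<subseteq> p" "p \<in> W" shows "local_generators G q \<subseteq> local_generators G p"
  using generization_in_spec[OF generatorD(1) _ assms(2,1)] by (auto simp: local_generators_def)

text \<open>Generators of the foliation agree up to a factor from the stalk and modulo Kaehler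
  relations, so tangency need only be tested on one of them.\<close>

lemma local_generators_pullback:
  assumes "series_hom \<iota> p \<kappa> \<phi>" "v \<in> local_generators G p" "form_pullback \<phi> v = 0" "w \<in> local_generators G p"
  shows "form_pullback \<phi> w = 0"
proof -
  interpret series_hom \<iota> p \<kappa> \<phi> by (rule assms)
  obtain u where "u \<in> p" "form_eq \<iota> p w (form_smult u v)"
    using assms(2,4) fol unfolding foliation_def local_generators_def by blast
  then show ?thesis
    using form_pullback_proportional assms local_generator_form by simp
qed

text \<open>A representative \<open>v\<close> with coefficients in the maximal ideal of
  \<open>p\<close> serves at \<open>q\<close> too, once \<open>q\<close> contains its keys and
  coefficients and the elements used to identify it with \<open>w\<close>: non-units of
  \<open>p\<close> in the smaller ring \<open>q\<close> are non-units there.\<close>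

lemma sing_specialization:
  assumes "p \<in> foliation_sing \<iota> W G"
  obtains A w F where "(A, w) \<in> G" "p \<in> spec_points A" "finite F" "F \<subseteq> p"
    "\<And>q. q \<in> spec_points A \<Longrightarrow> q \<subseteq> p \<Longrightarrow> F \<subseteq> q \<Longrightarrow> q \<in> foliation_sing \<iota> W G"
proof -
  obtain w v where pW: "p \<in> W" and w: "w \<in> local_generators G p" and v: "v \<in> kahler_forms p"
    "\<And>b. b \<in> Poly_Mapping.keys v \<Longrightarrow> Poly_Mapping.lookup v b \<in> nonunits p" "form_eq \<iota> p w v"
    using assms unfolding foliation_sing_def by blast
  interpret p: subalgebra_in_field \<iota> p by (rule points(3)[OF pW])
  obtain A where A: "(A, w) \<in> G" "p \<in> spec_points A" using w by (auto simp: local_generators_def)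
  obtain F where F: "finite F" "F \<subseteq> p" "\<And>q. subalgebra \<iota> q \<Longrightarrow> F \<subseteq> q \<Longrightarrow> w - v \<in> kahler_relations \<iota> q"
    using p.kahler_relations_localize v(3) unfolding form_eq_def by metis
  let ?K = "Poly_Mapping.keys v" let ?F = "F \<union> ?K \<union> Poly_Mapping.lookup v ` ?K"
  show thesis
  proof (rule that[OF A])
    show "finite ?F" using F by simp
    show "?F \<subseteq> p" using F v(1) by (auto simp: kahler_forms_def)
    fix q assume q: "q \<in> spec_points A" "q \<subseteq> p" "?F \<subseteq> q"
    have qW: "q \<in> W" using q affine_openD(2)[OF generatorD(1)[OF A(1)]] by blast
    have "w \<in> local_generators G q" using A q by (auto simp: local_generators_def)
    moreover have "v \<in> kahler_forms q" using q by (auto simp: kahler_forms_def)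
    moreover have "\<forall>b\<in>?K. Poly_Mapping.lookup v b \<in> nonunits q"
      using nonunits_mono[OF q(2)] v(2) q(3) by blast
    moreover have "form_eq \<iota> q w v" unfolding form_eq_def using F(3) points(1)[OF qW] q(3) by blast
    ultimately show "q \<in> foliation_sing \<iota> W G" unfolding foliation_sing_def using qW by blast
  qed
qed

text \<open>The kernel of \<open>formal_ext\<close> is an ideal, so killing the equations of
  \<open>D\<close> is the same as killing the generator \<open>x\<^sub>1 \<cdots> x\<^sub>r\<close>
  of the ideal they span; this is compared with tangency in the normal form.\<close>

lemma chart_arc_tangential_iff:
  assumes chart: "log_simple_adapted_chart \<iota> G D q f"
    and hom: "series_hom \<iota> q (\<lambda>z. z) \<psi>" and centre: "\<And>a. a \<in> nonunits q \<Longrightarrow> \<psi> a $ 0 = 0"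
  shows "(\<forall>w\<in>local_generators G q. form_pullback \<psi> w = 0) \<longleftrightarrow> (\<forall>a\<in>stalk_ideal D q. \<psi> a = 0)"
proof -
  have coords: "formal_coordinates \<iota> q f" using chart by (simp add: log_simple_adapted_chart_def)
  interpret \<psi>: series_hom \<iota> q "\<lambda>z. z" \<psi> by (rule hom)
  interpret formal_arc \<iota> q \<psi> f by unfold_locales (use coords centre in auto)
  obtain r lam u h w where r: "r \<in> {1..3}" and w: "w \<in> local_generators G q"
    and I: "ideal_gen UNIV (f ` stalk_ideal D q) = ideal_gen UNIV {\<Prod>i\<in>{1..r}. coord3 i}"
    and u: "u dvd 1"
    and lam: "\<forall>a :: nat \<Rightarrow> nat. (\<exists>i\<in>{1..r}. a i \<noteq> 0) \<longrightarrow> (\<Sum>i\<in>{1..r}. of_nat (a i) * lam i) \<noteq> 0"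
    and coeff: "\<forall>k\<in>{1..3}. formal_coeff f w k =
           u * (if k \<le> r then const3 (lam k) * (\<Prod>i\<in>{1..r} - {k}. coord3 i)
                else (\<Prod>i\<in>{1..r}. coord3 i) * h k)"
    using chart unfolding log_simple_adapted_chart_def
    by (elim conjE bexE exE, intro that) assumption+
  let ?P = "\<Prod>i\<in>{1..r}. coord3 i" and ?N = "{F. formal_ext F = 0}"
  have N: "is_ideal UNIV ?N"
    by (auto simp: is_ideal_def formal_ext_zero formal_ext_add formal_ext_mult)
  have gen: "ideal_gen UNIV S \<subseteq> ?N \<longleftrightarrow> S \<subseteq> ?N" for S
    using ideal_gen_least[OF N, of S] order_trans[OF subset_ideal_gen[of S UNIV], of ?N] by argo
  have "(\<forall>a\<in>stalk_ideal D q. \<psi> a = 0) \<longleftrightarrow> f ` stalk_ideal D q \<subseteq> ?N"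
    by (auto simp: stalk_ideal_def formal_ext_hom)
  also have "\<dots> \<longleftrightarrow> ideal_gen UNIV (f ` stalk_ideal D q) \<subseteq> ?N"
    by (rule gen[symmetric])
  also have "\<dots> \<longleftrightarrow> formal_ext ?P = 0"
    unfolding I gen by simp
  also have "\<dots> \<longleftrightarrow> form_pullback \<psi> w = 0"
    using in_divisor_if_tangential[OF r u local_generator_form[OF w], of lam h]
      tangential_if_in_divisor[OF r u local_generator_form[OF w], of lam h] coeff lam by blast
  also have "\<dots> \<longleftrightarrow> (\<forall>w\<in>local_generators G q. form_pullback \<psi> w = 0)"
    using local_generators_pullback[OF hom w] w by blast
  finally show ?thesis by blast
qed

text \<open>The chart \<open>A\<close> is fixed before \<open>c\<close>, so that \<open>c\<close>
  may be taken from coefficients of functions or forms on it. The specialised centre stays singular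
  and in \<open>D\<close> and is closed, which is where a formal chart exists.\<close>

lemma singular_arc_specialization:
  fixes \<kappa> :: "complex \<Rightarrow> 'k::field"
  assumes D: "closedin (zariski \<iota> W) D"
    and charts: "log_simple_adapted \<iota> W G D (foliation_sing \<iota> W G \<inter> D)"
    and \<kappa>: "field_extension \<kappa>" and arc: "(p, \<phi>) \<in> arcs \<iota> \<kappa> W"
    and p: "p \<in> foliation_sing \<iota> W G" "p \<in> D"
  obtains A w where "(A, w) \<in> G" "p \<in> spec_points A"
    "\<And>c. c \<in> subalgebra_gen \<kappa> {\<phi> a $ i |a i. a \<in> A} \<Longrightarrow> c \<noteq> 0 \<Longrightarrow>
      \<exists>q s. q \<in> spec_points A \<and> q \<subseteq> p \<and> s 0 = 0 \<and> s c \<noteq> 0 \<and>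
        (\<forall>w\<in>kahler_forms q. \<forall>n. form_pullback (\<lambda>a. Abs_fps (\<lambda>i. s (\<phi> a $ i))) w $ n = s (form_pullback \<phi> w $ n)) \<and>
        ((\<forall>w\<in>local_generators G q. form_pullback (\<lambda>a. Abs_fps (\<lambda>i. s (\<phi> a $ i))) w = 0) \<longleftrightarrow>
         (\<forall>a\<in>stalk_ideal D q. \<forall>i. s (\<phi> a $ i) = (0::complex)))"
proof -
  obtain A w F where A: "(A, w) \<in> G" "p \<in> spec_points A" and F: "finite F" "F \<subseteq> p"
    "\<And>q. q \<in> spec_points A \<Longrightarrow> q \<subseteq> p \<Longrightarrow> F \<subseteq> q \<Longrightarrow> q \<in> foliation_sing \<iota> W G"
    by (rule sing_specialization[OF p(1)]) blast
  show thesis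
  proof (rule that[OF A])
    fix c assume c: "c \<in> subalgebra_gen \<kappa> {\<phi> a $ i |a i. a \<in> A}" "c \<noteq> 0"
    obtain q R s where q: "q \<in> spec_points A" "q \<subseteq> p" "closedin (zariski \<iota> W) {q}" "F \<subseteq> q"
      and R: "subalgebra \<kappa> R" "alg_hom_on R \<kappa> (\<lambda>z. z) s" "s c \<noteq> 0"
        "\<And>a i. a \<in> q \<Longrightarrow> \<phi> a $ i \<in> R" and centre: "\<And>a. a \<in> nonunits q \<Longrightarrow> s (\<phi> a $ 0) = 0"
      by (rule arc_specialization[OF \<kappa> arc generatorD(1)[OF A(1)] A(2) F(1,2) c]) blast
    let ?\<psi> = "\<lambda>a. Abs_fps (\<lambda>i. s (\<phi> a $ i))"
    have qW: "q \<in> W" using q affine_openD(2)[OF generatorD(1)[OF A(1)]] by blast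
    note sp = specialized_series_hom[OF arcs_series_hom(1)[OF var \<kappa> arc] points(3)[OF qW] q(2) \<kappa> R(1,2,4)]
    have "q \<in> D" by (rule closed_specialization[OF D qW p(2) q(2)])
    moreover have "q \<in> foliation_sing \<iota> W G" by (rule F(3)[OF q(1,2,4)])
    ultimately obtain f where chart: "log_simple_adapted_chart \<iota> G D q f"
      using charts q(3) unfolding log_simple_adapted_def by blast
    have "s 0 = 0"
      using R(2) field_extensionD(1)[OF \<kappa>] unfolding alg_hom_on_def by metis
    moreover have "(\<forall>w\<in>local_generators G q. form_pullback ?\<psi> w = 0) \<longleftrightarrow> (\<forall>a\<in>stalk_ideal D q. ?\<psi> a = 0)"
      by (rule chart_arc_tangential_iff[OF chart sp(1)]) (use centre in auto)
    then have "(\<forall>w\<in>local_generators G q. form_pullback ?\<psi> w = 0) \<longleftrightarrow>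
        (\<forall>a\<in>stalk_ideal D q. \<forall>i. s (\<phi> a $ i) = 0)" by (simp add: fps_eq_iff)
    ultimately show "\<exists>q s. q \<in> spec_points A \<and> q \<subseteq> p \<and> s 0 = 0 \<and> s c \<noteq> 0 \<and>
        (\<forall>w\<in>kahler_forms q. \<forall>n. form_pullback (\<lambda>a. Abs_fps (\<lambda>i. s (\<phi> a $ i))) w $ n = s (form_pullback \<phi> w $ n)) \<and>
        ((\<forall>w\<in>local_generators G q. form_pullback (\<lambda>a. Abs_fps (\<lambda>i. s (\<phi> a $ i))) w = 0) \<longleftrightarrow>
         (\<forall>a\<in>stalk_ideal D q. \<forall>i. s (\<phi> a $ i) = (0::complex)))"
      using q(1,2) R(3) sp(2) by blast
  qed
qed

text \<open>The two inclusions are not symmetric under specialisation. Tangency passes to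
  \<open>q\<close> since generators at \<open>q\<close> are generators at \<open>p\<close>, but the
  equation violated at \<open>p\<close> must first be spread to \<open>q\<close>. Conversely,
  equations at \<open>q\<close> hold at \<open>p\<close>, and the violated form is already defined
  on the chart.\<close>

lemma tangential_arcs_eq:
  fixes \<kappa> :: "complex \<Rightarrow> 'k::field"
  assumes D: "closedin (zariski \<iota> W) D" and \<Sigma>: "\<Sigma> = foliation_sing \<iota> W G \<inter> D"
    and charts: "log_simple_adapted \<iota> W G D \<Sigma>" and \<kappa>: "field_extension \<kappa>"
  shows "tangential_arcs \<iota> \<kappa> W G \<Sigma> = arcs_on \<iota> \<kappa> W D \<Sigma>"
proof -
  have DW: "D \<subseteq> W" using closedin_subset[OF D] topspace_zariski by blast
  have "(p, \<phi>) \<in> tangential_arcs \<iota> \<kappa> W G \<Sigma> \<longleftrightarrow> (p, \<phi>) \<in> arcs_on \<iota> \<kappa> W D \<Sigma>"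
    if arc: "(p, \<phi>) \<in> arcs \<iota> \<kappa> W" and p\<Sigma>: "p \<in> \<Sigma>" for p \<phi>
  proof -
    have p: "p \<in> foliation_sing \<iota> W G" "p \<in> D" using p\<Sigma> \<Sigma> by auto
    then have pW: "p \<in> W" using DW by blast
    interpret \<phi>: series_hom \<iota> p \<kappa> \<phi> by (rule arcs_series_hom[OF var \<kappa> arc])
    obtain A w where A: "(A, w) \<in> G" "p \<in> spec_points A" and spec:
      "\<And>c. c \<in> subalgebra_gen \<kappa> {\<phi> a $ i |a i. a \<in> A} \<Longrightarrow> c \<noteq> 0 \<Longrightarrow>
      \<exists>q s. q \<in> spec_points A \<and> q \<subseteq> p \<and> s 0 = 0 \<and> s c \<noteq> 0 \<and>
        (\<forall>w\<in>kahler_forms q. \<forall>n. form_pullback (\<lambda>a. Abs_fps (\<lambda>i. s (\<phi> a $ i))) w $ n = s (form_pullback \<phi> w $ n)) \<and>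
        ((\<forall>w\<in>local_generators G q. form_pullback (\<lambda>a. Abs_fps (\<lambda>i. s (\<phi> a $ i))) w = 0) \<longleftrightarrow>
         (\<forall>a\<in>stalk_ideal D q. \<forall>i. s (\<phi> a $ i) = (0::complex)))"
      by (rule singular_arc_specialization[OF D charts[unfolded \<Sigma>] \<kappa> arc p]) blast
    note Aop = generatorD(1)[OF A(1)]
    have Ap: "A \<subseteq> p" by (rule spec_pointsD(1)[OF ext affine_openD(1)[OF Aop] A(2)])
    have wp: "w \<in> local_generators G p" using A by (auto simp: local_generators_def)
    let ?R = "subalgebra_gen \<kappa> {\<phi> a $ i |a i. a \<in> A}"
    interpret R: subalgebra_in_field \<kappa> ?R by unfold_locales (rule \<kappa> subalgebra_subalgebra_gen)+
    have coeff: "\<phi> a $ i \<in> ?R" if "a \<in> A" for a i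
      using that subset_subalgebra_gen[of "{\<phi> a $ i |a i. a \<in> A}" \<kappa>] by blast
    show ?thesis
    proof
      assume "(p, \<phi>) \<in> tangential_arcs \<iota> \<kappa> W G \<Sigma>"
      then have tang: "form_pullback \<phi> w = 0" if "w \<in> local_generators G p" for w
        using that by (auto simp: tangential_arcs_def)
      have "\<phi> a = 0" if a: "a \<in> stalk_ideal D p" for a
      proof (rule ccontr)
        assume a0: "\<phi> a \<noteq> 0"
        have ap: "a \<in> p" using a by (simp add: stalk_ideal_def)
        obtain c b where b: "c \<in> A" "b \<in> A" "b \<notin> nonunits p" "b \<noteq> 0" "a = c / b"
          by (rule spec_pointsE[OF ext affine_openD(1)[OF Aop] A(2) ap])
        have unit: "\<phi> b \<noteq> 0" if "b \<in> A" "b \<notin> nonunits p" for b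
          using arcs_series_hom(2)[OF var \<kappa> arc] that Ap by (metis fps_zero_nth subsetD)
        have c: "c = b * a" using b by simp
        have "c \<in> nonunits y" if "y \<in> D" "p \<subseteq> y" for y
          unfolding c using that a b Ap DW by (intro nonunits_absorb) (auto simp: stalk_ideal_def)
        then have "c \<in> stalk_ideal D p" using b(1) Ap by (auto simp: stalk_ideal_def)
        then obtain d where d: "d \<in> A" "d \<notin> nonunits p" "\<And>q. q \<in> spec_points A \<Longrightarrow> c * d \<in> stalk_ideal D q"
          using stalk_ideal_spread[OF D Aop A(2) b(1)] by blast
        have in_p: "b \<in> p" "d \<in> p" "b * a \<in> p" using b d Ap ap \<phi>.mult_in by blast+
        have "\<phi> (c * d) = \<phi> b * \<phi> a * \<phi> d" unfolding c using in_p ap by (simp add: \<phi>.hom_mult)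
        also have "\<dots> \<noteq> 0" using a0 unit b d by simp
        \<comment> \<open>This coefficient is kept non-zero, so \<open>c * d\<close>, an equation of
          \<open>D\<close> also at \<open>q\<close>, does not vanish on the specialised arc.\<close>
        finally obtain n where n: "\<phi> (c * d) $ n \<noteq> 0" by (auto simp: fps_eq_iff)
        have "c * d \<in> A"
          using b(1) d(1) affine_openD(1)[OF Aop] by (auto simp: subalgebra_def)
        from spec[OF coeff[OF this] n]
        obtain q s where q: "q \<in> spec_points A" "q \<subseteq> p" "s 0 = 0" "s (\<phi> (c * d) $ n) \<noteq> 0"
          and pb: "\<forall>w\<in>kahler_forms q. \<forall>n. form_pullback (\<lambda>a. Abs_fps (\<lambda>i. s (\<phi> a $ i))) w $ n = s (form_pullback \<phi> w $ n)"
          and iff: "(\<forall>w\<in>local_generators G q. form_pullback (\<lambda>a. Abs_fps (\<lambda>i. s (\<phi> a $ i))) w = 0) \<longleftrightarrow>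
             (\<forall>a\<in>stalk_ideal D q. \<forall>i. s (\<phi> a $ i) = (0::complex))"
          by (elim exE conjE, intro that) assumption+
        have "form_pullback (\<lambda>a. Abs_fps (\<lambda>i. s (\<phi> a $ i))) w = 0" if w: "w \<in> local_generators G q" for w
        proof -
          have "form_pullback \<phi> w = 0" using tang local_generators_mono[OF q(2) pW] w by blast
          then show ?thesis by (intro fps_ext) (simp add: pb[rule_format, OF local_generator_form[OF w]] q(3))
        qed
        then show False using iff d(3)[OF q(1)] q(4) by blast
      qed
      then show "(p, \<phi>) \<in> arcs_on \<iota> \<kappa> W D \<Sigma>" using arc p\<Sigma> by (simp add: arcs_on_def)
    next
      assume "(p, \<phi>) \<in> arcs_on \<iota> \<kappa> W D \<Sigma>"
      then have on: "\<phi> a = 0" if "a \<in> stalk_ideal D p" for a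
        using that by (auto simp: arcs_on_def)
      have "form_pullback \<phi> w = 0"
      proof (rule ccontr)
        assume "form_pullback \<phi> w \<noteq> 0"
        then obtain n where n: "form_pullback \<phi> w $ n \<noteq> 0" by (auto simp: fps_eq_iff)
        have "b \<in> A" "Poly_Mapping.lookup w b \<in> A" if "b \<in> Poly_Mapping.keys w" for b
          using generatorD(2)[OF A(1)] that by (auto simp: kahler_forms_def)
        then have "form_pullback \<phi> w $ n \<in> ?R"
          unfolding form_pullback_def fps_sum_nth fps_mult_nth fps_deriv_nth
          by (intro R.sum_in R.mult_in R.of_nat_in coeff)
        from spec[OF this n]
        obtain q s where q: "q \<in> spec_points A" "q \<subseteq> p" "s 0 = 0" "s (form_pullback \<phi> w $ n) \<noteq> 0"
          and pb: "\<forall>w\<in>kahler_forms q. \<forall>n. form_pullback (\<lambda>a. Abs_fps (\<lambda>i. s (\<phi> a $ i))) w $ n = s (form_pullback \<phi> w $ n)"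
          and iff: "(\<forall>w\<in>local_generators G q. form_pullback (\<lambda>a. Abs_fps (\<lambda>i. s (\<phi> a $ i))) w = 0) \<longleftrightarrow>
             (\<forall>a\<in>stalk_ideal D q. \<forall>i. s (\<phi> a $ i) = (0::complex))"
          by (elim exE conjE, intro that) assumption+
        have wq: "w \<in> local_generators G q" using A q by (auto simp: local_generators_def)
        \<comment> \<open>Every point of \<open>D\<close> generizing \<open>p\<close> also generizes
          \<open>q\<close>, so there are fewer conditions at \<open>p\<close>.\<close>
        have "stalk_ideal D q \<subseteq> {a. \<phi> a = 0}"
        proof
          fix a assume a: "a \<in> stalk_ideal D q"
          then have "a \<in> stalk_ideal D p" using q(2) by (auto simp: stalk_ideal_def)
          then show "a \<in> {a. \<phi> a = 0}" using on by simp
        qed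
        then have "form_pullback (\<lambda>a. Abs_fps (\<lambda>i. s (\<phi> a $ i))) w = 0" using iff wq q(3) by auto
        then show False using pb[rule_format, OF local_generator_form[OF wq], of n] q(4) by simp
      qed
      then show "(p, \<phi>) \<in> tangential_arcs \<iota> \<kappa> W G \<Sigma>"
        using local_generators_pullback[OF \<phi>.series_hom_axioms wp] arc p\<Sigma> by (auto simp: tangential_arcs_def)
    qed
  qed
  then show ?thesis by (auto simp: tangential_arcs_def arcs_on_def)
qed

end

section \<open>The generic point of an arc\<close>

text \<open>\<open>y\<close> is the image of the generic point of the spectrum of
  \<open>K[[t]]\<close>: as power series over a field form a domain, the functions killed by the arc
  form a prime ideal. The arc lies on exactly those closed sets that contain
  \<open>y\<close>.\<close>

lemma (in variety_loc) arc_generic_point: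
  assumes \<kappa>: "field_extension \<kappa>" and arc: "(p, \<phi>) \<in> arcs \<iota> \<kappa> W"
  obtains y where "y \<in> W" "p \<subseteq> y" "\<And>a. a \<in> p \<Longrightarrow> a \<in> nonunits y \<longleftrightarrow> \<phi> a = 0"
    "\<And>E. closedin (zariski \<iota> W) E \<Longrightarrow> (\<And>a. a \<in> stalk_ideal E p \<Longrightarrow> \<phi> a = 0) \<Longrightarrow> y \<in> E"
proof -
  have pW: "p \<in> W" using arc by (auto simp: arcs_def)
  interpret \<phi>: series_hom \<iota> p \<kappa> \<phi> by (rule arcs_series_hom[OF var \<kappa> arc])
  note nonunit = arcs_series_hom(2)[OF var \<kappa> arc]
  obtain A where A: "affine_open \<iota> W A" "p \<in> spec_points A" using affine_cover[OF pW] .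
  interpret A: subalgebra_in_field \<iota> A by unfold_locales (rule ext affine_openD(1)[OF A(1)])+
  have Ap: "A \<subseteq> p" by (rule spec_pointsD(1)[OF ext A.sub A(2)])
  define Q where "Q = {a \<in> A. \<phi> a = 0}"
  have Q: "is_prime_ideal A Q" unfolding is_prime_ideal_def is_ideal_def
    using Ap by (auto simp: Q_def A.zero_in A.one_in A.add_in A.mult_in \<phi>.hom_zero \<phi>.hom_one
      \<phi>.hom_add \<phi>.hom_mult subset_iff)
  define y where "y = localization A Q"
  have y: "y \<in> spec_points A" using Q unfolding y_def spec_points_def by blast
  have yW: "y \<in> W" using y affine_openD(2)[OF A(1)] by blast
  have yQ: "A \<inter> nonunits y = Q" unfolding y_def by (rule A.nonunits_localization_Int[OF Q])
  have unit: "\<phi> b \<noteq> 0" if "b \<in> p" "b \<notin> nonunits p" for b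
    using nonunit[OF that(1)] that(2) by (metis fps_zero_nth)
  have py: "p \<subseteq> y"
  proof
    fix x assume "x \<in> p"
    then obtain a b where ab: "a \<in> A" "b \<in> A" "b \<notin> nonunits p" "b \<noteq> 0" "x = a / b"
      by (rule spec_pointsE[OF ext A.sub A(2)])
    then have "b \<notin> Q" using unit[of b] Ap by (auto simp: Q_def)
    then show "x \<in> y" using ab unfolding y_def localization_def by blast
  qed
  have nu: "x \<in> nonunits y \<longleftrightarrow> \<phi> x = 0" if x: "x \<in> p" for x
  proof -
    obtain a b where ab: "a \<in> A" "b \<in> A" "b \<notin> nonunits p" "b \<noteq> 0" "x = a / b"
      using x by (rule spec_pointsE[OF ext A.sub A(2)])
    have b: "b \<in> p" "inverse b \<in> p" using ab Ap by (auto simp: nonunits_def)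
    have a: "a = b * x" "x = inverse b * a" using ab by (simp_all add: field_simps)
    have "b \<in> y" "inverse b \<in> y" using b py by blast+
    then have "x \<in> nonunits y \<longleftrightarrow> a \<in> nonunits y"
      using nonunits_absorb[OF yW, of b x] nonunits_absorb[OF yW, of "inverse b" a]
      unfolding a(1)[symmetric] a(2)[symmetric] by blast
    also have "\<dots> \<longleftrightarrow> \<phi> a = 0" using yQ ab(1) by (auto simp: Q_def)
    also have "\<dots> \<longleftrightarrow> \<phi> x = 0" using unit[OF b(1) ab(3)] \<phi>.hom_mult[OF b(1) x] a(1) by simp
    finally show ?thesis .
  qed
  have "y \<in> E" if E: "closedin (zariski \<iota> W) E" and on: "\<And>a. a \<in> stalk_ideal E p \<Longrightarrow> \<phi> a = 0" for E
  proof (rule ccontr)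
    assume "y \<notin> E"
    then obtain h where h: "h \<in> A" "h \<notin> nonunits y" "\<And>z. z \<in> spec_points A \<Longrightarrow> z \<in> E \<Longrightarrow> h \<in> nonunits z"
      using closed_principal[OF E A(1) y] by blast
    have "E \<subseteq> W" using closedin_subset[OF E] topspace_zariski by blast
    \<comment> \<open>A function separating \<open>y\<close> from \<open>E\<close> would be an
      equation of \<open>E\<close> at \<open>p\<close> that the arc does not satisfy.\<close>
    then have "h \<in> stalk_ideal E p"
      using h Ap generization_in_spec[OF A] unfolding stalk_ideal_def by blast
    then show False using nu[of h] on h Ap by blast
  qed
  then show thesis using that yW py nu by blast
qed

theorem theorem1p2:
  fixes \<iota> :: "complex \<Rightarrow> 'f::field" and \<kappa> :: "complex \<Rightarrow> 'k::field"
    and W D \<Sigma> :: "'f set set" and G :: "'f foliation_data"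
  assumes "smooth_threefold \<iota> W"
    and "foliation \<iota> W G"
    and "invariant_divisor \<iota> W G D"
    and "\<Sigma> = foliation_sing \<iota> W G \<inter> D"
    and "log_simple_adapted \<iota> W G D \<Sigma>"
    and "field_extension \<kappa>"
  shows "tangential_arcs \<iota> \<kappa> W G \<Sigma> = arcs_on \<iota> \<kappa> W D \<Sigma> \<and>
    (\<forall>C \<gamma>. tangential_cylinder \<iota> W G \<Sigma> C \<and> irreducible_in (tangential_topology \<iota> W G \<Sigma>) C \<and>
        generic_arc \<iota> \<kappa> W G \<Sigma> C \<gamma> \<and> \<not> (\<exists>S\<in>conductor_strata \<iota> W D. \<gamma> \<in> arcs_on \<iota> \<kappa> W S W) \<longrightarrow>
      (\<exists>!E. E \<in> irreducible_components (zariski \<iota> W) D \<and> \<gamma> \<in> arcs_on \<iota> \<kappa> W E W))"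
proof -
  interpret foliated_variety \<iota> W G
    using assms(1,2) by unfold_locales (auto simp: smooth_threefold_def)
  have D: "closedin (zariski \<iota> W) D"
    using assms(3) by (simp add: invariant_divisor_def reduced_divisor_def)
  have eq: "tangential_arcs \<iota> \<kappa> W G \<Sigma> = arcs_on \<iota> \<kappa> W D \<Sigma>"
    by (rule tangential_arcs_eq[OF D assms(4,5,6)])
  let ?I = "irreducible_components (zariski \<iota> W) D"
  have "\<exists>!E. E \<in> ?I \<and> \<gamma> \<in> arcs_on \<iota> \<kappa> W E W"
    if cyl: "tangential_cylinder \<iota> W G \<Sigma> C" and gen: "generic_arc \<iota> \<kappa> W G \<Sigma> C \<gamma>"
      and ncond: "\<not> (\<exists>S\<in>conductor_strata \<iota> W D. \<gamma> \<in> arcs_on \<iota> \<kappa> W S W)" for C \<gamma>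
  proof -
    obtain p \<phi> where \<gamma>: "\<gamma> = (p, \<phi>)" by (cases \<gamma>)
    have arc: "(p, \<phi>) \<in> arcs \<iota> \<kappa> W" using gen by (simp add: generic_arc_def \<gamma>)
    have "arc_point \<kappa> \<gamma> \<in> tangential_points \<iota> W G \<Sigma>"
      using cyl gen unfolding tangential_cylinder_def generic_arc_def by blast
    then have "\<gamma> \<in> arcs_on \<iota> \<kappa> W D \<Sigma>"
      using tangential_points_arc[OF assms(6)] arc eq \<gamma> by blast
    then have on: "\<And>a. a \<in> stalk_ideal D p \<Longrightarrow> \<phi> a = 0" by (auto simp: arcs_on_def \<gamma>)
    obtain y where y: "y \<in> W" "p \<subseteq> y" and nu: "\<And>a. a \<in> p \<Longrightarrow> a \<in> nonunits y \<longleftrightarrow> \<phi> a = 0"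
      and yE: "\<And>E. closedin (zariski \<iota> W) E \<Longrightarrow> (\<And>a. a \<in> stalk_ideal E p \<Longrightarrow> \<phi> a = 0) \<Longrightarrow> y \<in> E"
      by (rule arc_generic_point[OF assms(6) arc]) blast
    \<comment> \<open>Lying on a closed set becomes a condition on the single point
      \<open>y\<close>, and therefore passes to intersections of components.\<close>
    have iff: "\<gamma> \<in> arcs_on \<iota> \<kappa> W E W \<longleftrightarrow> y \<in> E" if "closedin (zariski \<iota> W) E" for E
    proof
      assume "\<gamma> \<in> arcs_on \<iota> \<kappa> W E W"
      then show "y \<in> E" by (intro yE[OF that]) (auto simp: arcs_on_def \<gamma>)
    next
      assume "y \<in> E"
      then have "\<phi> a = 0" if "a \<in> stalk_ideal E p" for a
        using that y(2) nu[of a] by (auto simp: stalk_ideal_def)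
      then show "\<gamma> \<in> arcs_on \<iota> \<kappa> W E W" using arc by (auto simp: arcs_on_def \<gamma> arcs_def)
    qed
    have closed: "closedin (zariski \<iota> W) E" if "E \<in> ?I" for E
      by (rule closedin_irreducible_component[OF that D])
    \<comment> \<open>Existence of a branch: the one-point set is irreducible and contained in
      \<open>D\<close>, hence lies in a component.\<close>
    have "irreducible_in (zariski \<iota> W) {y}"
      using y(1) by (auto simp: irreducible_in_def topspace_zariski)
    then obtain E where E: "E \<in> ?I" "{y} \<subseteq> E"
      using irreducible_in_component[of _ "{y}" D] yE[OF D on] by blast
    show ?thesis
    proof (rule ex1I)
      show "E \<in> ?I \<and> \<gamma> \<in> arcs_on \<iota> \<kappa> W E W" using E iff closed by blast
      fix E' assume E': "E' \<in> ?I \<and> \<gamma> \<in> arcs_on \<iota> \<kappa> W E' W"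
      show "E' = E"
      proof (rule ccontr)
        assume "E' \<noteq> E"
        then have "E \<inter> E' \<in> conductor_strata \<iota> W D" using E E' unfolding conductor_strata_def by blast
        moreover have "\<gamma> \<in> arcs_on \<iota> \<kappa> W (E \<inter> E') W"
          using iff[of "E \<inter> E'"] iff[of E'] closed E E' by (simp add: closedin_Int)
        ultimately show False using ncond by blast
      qed
    qed
  qed
  then show ?thesis using eq by blast
qed

end
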